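(* Let $X$ be a complex Banach space and let $A:D(A)\to X$ be the generator of a $C_0$-semigroup on $X$. Put $K:=\{t\in\mathbb{R}: it\in\sigma(A)\}$. Assume that there is $a\in(0,\infty)$ with $K\subset(-a,a)$, and that there is $\theta\in(\tfrac12,\infty)$ with $\sup\{|t|^{\theta}\,\|R(it,A)\| : t\in\mathbb{R}\setminus(-a,a)\}<\infty$. Let $F\subset\mathbb{R}\setminus K$ be a closed subset of $\mathbb{R}$ and let $\phi\in L^{\infty}(\mathbb{R},X)$ have Beurling spectrum $sp(\phi)\subset F$. Let $\mathbb{J}\in\{\mathbb{R},\mathbb{R}_+\}$ and let $\mathcal{F}\subset L^1_{loc}(\mathbb{J},X)$ be a class of functions satisfying: (i) $\mathcal{F}$ is a linear subspace of $L^1_{loc}(\mathbb{J},X)\subset X^{\mathbb{J}}$; (ii) if $(\phi_n)\subset\mathcal{F}\cap BUC(\mathbb{J},X)$ and $\phi_n\to\psi$ uniformly on $\mathbb{J}$, then $\psi\in\mathcal{F}$; (iii) if $f\in BUC(\mathbb{R},X)$ and $f|\mathbb{J}\in\mathcal{F}$, then $f_a|\mathbb{J}\in\mathcal{F}$ for all $a\in\mathbb{R}$, where $f_a(t)=f(a+t)$; (iv) if $f\in BUC(\mathbb{R},X)$ and $f|\mathbb{J}\in\mathcal{F}$, then $(B\circ f)|\mathbb{J}\in\mathcal{F}$ for each $B\in L(X)$. Assume $\phi|\mathbb{J}\in\mathcal{M}\mathcal{F}$. Then there exists $G\in L^1(\mathbb{R},L(X))$ such that $u_\phi:=G*\phi$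 is a mild solution of $u'=Au+\phi$ on $\mathbb{R}$, $u_\phi\in BUC(\mathbb{R},X)$, and $u_\phi|\mathbb{J}\in\mathcal{F}$.
   Context: $\mathbb{R}_+=[0,\infty)$. $L(X)$ is the Banach algebra of bounded linear operators on $X$; $BUC(\mathbb{J},X)$ is the space of bounded uniformly continuous functions $\mathbb{J}\to X$; $\sigma(A)$ is the spectrum of $A$ and $R(\lambda,A)=(\lambda-A)^{-1}$ for $\lambda\in\mathbb{C}\setminus\sigma(A)$. Elements of $L^1_{loc}(\mathbb{J},X)$ are treated as functions $\mathbb{J}\to X$. The mean class is $\mathcal{M}\mathcal{F}:=\{f\in L^1_{loc}(\mathbb{J},X): M_hf\in\mathcal{F}\text{ for all }h>0\}$, where $(M_hf)(t)=\frac1h\int_0^hf(t+s)\,ds$. Convolution: $(G*\phi)(t)=\int_{\mathbb{R}}G(s)\phi(t-s)\,ds$ (Bochner integral). For $f\in L^1(\mathbb{R},\mathbb{C})$, $\widehat f(\lambda)=\int_{\mathbb{R}}f(t)e^{-i\lambda t}\,dt$. The Beurling spectrum of $\phi\in L^\infty(\mathbb{R},X)$ is $sp(\phi)=\{\omega\in\mathbb{R}: \text{for every } f\in L^1(\mathbb{R},\mathbb{C}),\ \phi*f=0 \text{ implies } \widehat f(\omega)=0\}$. A mild solution of $u'=Au+\phi$ on $\mathbb{R}$ is a function $u\in C(\mathbb{R},X)$ such that, for all $t\in\mathbb{R}$, $\int_0^t u(s)\,ds\in D(A)$ and $u(t)=u(0)+A\int_0^t u(s)\,ds+\int_0^t\phi(s)\,ds$.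 *)

theory Defs
  imports "HOL-Analysis.Analysis"
begin

section \<open>Complex Banach spaces\<close>

(* The distribution only provides real Banach spaces. *)
class complex_banach = banach +
  fixes scaleC :: "complex \<Rightarrow> 'a \<Rightarrow> 'a" (infixr "*\<^sub>C" 75)
  assumes scaleC_add_right: "c *\<^sub>C (x + y) = c *\<^sub>C x + c *\<^sub>C y"
    and scaleC_add_left: "(c + d) *\<^sub>C x = c *\<^sub>C x + d *\<^sub>C x"
    and scaleC_scaleC: "c *\<^sub>C d *\<^sub>C x = (c * d) *\<^sub>C x"
    and scaleC_of_real: "complex_of_real r *\<^sub>C x = r *\<^sub>R x"
    and norm_scaleC: "norm (c *\<^sub>C x) = cmod c * norm x"

instantiation complex :: complex_banach
begin

definition "scaleC_complex (c :: complex) (x :: complex) = c * x"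

instance
  by standard (simp_all add: scaleC_complex_def algebra_simps norm_mult scaleR_conv_of_real)

end

(* L(X): inside the real bounded operators, with the same operator norm. *)
definition bounded_clinear_ops :: "('a::complex_banach \<Rightarrow>\<^sub>L 'a) set" where
  "bounded_clinear_ops = {B. \<forall>c x. blinfun_apply B (c *\<^sub>C x) = c *\<^sub>C blinfun_apply B x}"


section \<open>The Bochner integral\<close>

(* The library integral needs a second countable range type, which would exclude non-separable X
   and L(X). The definition below is the library's, with Borel measurability replaced by
   strong measurability. It is used only for complete measures, so that norm (f x - s i x) is
   measurable and the nonnegative integrals have their usual meaning. *)

definition strongly_measurable :: "'b measure \<Rightarrow> ('b \<Rightarrow> 'a::real_normed_vector) \<Rightarrow> bool" where
  "strongly_measurable M f \<longleftrightarrow>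
     (\<exists>s. (\<forall>i::nat. simple_function M (s i)) \<and> (AE x in M. (\<lambda>i. s i x) \<longlonglongrightarrow> f x))"

definition has_bochner_int ::
    "'b measure \<Rightarrow> ('b \<Rightarrow> 'a::real_normed_vector) \<Rightarrow> 'a \<Rightarrow> bool" where
  "has_bochner_int M f I \<longleftrightarrow> strongly_measurable M f \<and>
     (\<exists>s. (\<forall>i::nat. Bochner_Integration.simple_bochner_integrable M (s i)) \<and>
          (\<lambda>i. \<integral>\<^sup>+x. ennreal (norm (f x - s i x)) \<partial>M) \<longlonglongrightarrow> 0 \<and>
          (\<lambda>i. Bochner_Integration.simple_bochner_integral M (s i)) \<longlonglongrightarrow> I)"

definition bochner_integrable :: "'b measure \<Rightarrow> ('b \<Rightarrow> 'a::real_normed_vector) \<Rightarrow> bool" where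
  "bochner_integrable M f \<longleftrightarrow> (\<exists>I. has_bochner_int M f I)"

definition bochner_integral :: "'b measure \<Rightarrow> ('b \<Rightarrow> 'a::real_normed_vector) \<Rightarrow> 'a" where
  "bochner_integral M f = (THE I. has_bochner_int M f I)"

definition integral_from_0 :: "real \<Rightarrow> (real \<Rightarrow> 'a::real_normed_vector) \<Rightarrow> 'a" where
  "integral_from_0 t f =
     (if 0 \<le> t then bochner_integral (lebesgue_on {0..t}) f
      else - bochner_integral (lebesgue_on {t..0}) f)"


section \<open>Function spaces\<close>

(* A function from J to X is encoded as a function on the reals vanishing outside J; this is a
   linear bijection onto its image. Functions are not identified almost everywhere. *)

definition restr :: "real set \<Rightarrow> (real \<Rightarrow> 'a::real_normed_vector) \<Rightarrow> real \<Rightarrow> 'a" where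
  "restr J f = (\<lambda>t. if t \<in> J then f t else 0)"

definition L1loc :: "real set \<Rightarrow> (real \<Rightarrow> 'a::real_normed_vector) set" where
  "L1loc J = {f. restr J f = f \<and>
     (\<forall>C. compact C \<and> C \<subseteq> J \<longrightarrow> bochner_integrable (lebesgue_on C) f)}"

definition Linf :: "(real \<Rightarrow> 'a::real_normed_vector) set" where
  "Linf = {f. strongly_measurable lebesgue f \<and> (\<exists>C. AE t in lebesgue. norm (f t) \<le> C)}"

definition BUC :: "real set \<Rightarrow> (real \<Rightarrow> 'a::real_normed_vector) set" where
  "BUC J = {f. restr J f = f \<and> bounded (f ` J) \<and> uniformly_continuous_on J f}"

definition mean :: "real set \<Rightarrow> real \<Rightarrow> (real \<Rightarrow> 'a::real_normed_vector) \<Rightarrow> real \<Rightarrow> 'a" where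
  "mean J h f = restr J (\<lambda>t. (1 / h) *\<^sub>R bochner_integral (lebesgue_on {0..h}) (\<lambda>s. f (t + s)))"

definition mean_class ::
    "real set \<Rightarrow> (real \<Rightarrow> 'a::real_normed_vector) set \<Rightarrow> (real \<Rightarrow> 'a) set" where
  "mean_class J \<F> = {f \<in> L1loc J. \<forall>h>0. mean J h f \<in> \<F>}"


section \<open>Convolution and Beurling spectrum\<close>

definition convolution ::
    "('b \<Rightarrow> 'c \<Rightarrow> 'a::real_normed_vector) \<Rightarrow> (real \<Rightarrow> 'b) \<Rightarrow> (real \<Rightarrow> 'c) \<Rightarrow> real \<Rightarrow> 'a" where
  "convolution p g f t = bochner_integral lebesgue (\<lambda>s. p (g s) (f (t - s)))"

definition fourier :: "(real \<Rightarrow> complex) \<Rightarrow> real \<Rightarrow> complex" where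
  "fourier f w = (LINT t|lebesgue. f t * exp (- (\<i> * complex_of_real (w * t))))"

definition beurling_spectrum :: "(real \<Rightarrow> 'a::complex_banach) \<Rightarrow> real set" where
  "beurling_spectrum \<phi> =
     {w. \<forall>f :: real \<Rightarrow> complex. integrable lebesgue f \<longrightarrow>
           (\<forall>t. convolution (\<lambda>x c. c *\<^sub>C x) \<phi> f t = 0) \<longrightarrow> fourier f w = 0}"


section \<open>Semigroups, generators and spectra\<close>

(* An unbounded operator is a pair (D, A); the values of A outside D are irrelevant.
   A semigroup T is only considered on [0, \<infinity>). *)

definition C0_semigroup :: "(real \<Rightarrow> 'a::complex_banach \<Rightarrow>\<^sub>L 'a) \<Rightarrow> bool" where
  "C0_semigroup T \<longleftrightarrow>
     (\<forall>t\<ge>0. T t \<in> bounded_clinear_ops) \<and>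
     T 0 = id_blinfun \<and>
     (\<forall>s\<ge>0. \<forall>t\<ge>0. T (s + t) = T s o\<^sub>L T t) \<and>
     (\<forall>x. ((\<lambda>t. blinfun_apply (T t) x) \<longlongrightarrow> x) (at_right 0))"

definition is_generator ::
    "'a set \<Rightarrow> ('a \<Rightarrow> 'a) \<Rightarrow> (real \<Rightarrow> 'a::complex_banach \<Rightarrow>\<^sub>L 'a) \<Rightarrow> bool" where
  "is_generator D A T \<longleftrightarrow>
     D = {x. \<exists>y. ((\<lambda>h. (1 / h) *\<^sub>R (blinfun_apply (T h) x - x)) \<longlongrightarrow> y) (at_right 0)} \<and>
     (\<forall>x\<in>D. ((\<lambda>h. (1 / h) *\<^sub>R (blinfun_apply (T h) x - x)) \<longlongrightarrow> A x) (at_right 0))"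

definition resolvent ::
    "'a set \<Rightarrow> ('a \<Rightarrow> 'a) \<Rightarrow> complex \<Rightarrow> 'a::complex_banach \<Rightarrow> 'a" where
  "resolvent D A z = inv_into D (\<lambda>x. z *\<^sub>C x - A x)"

definition op_spectrum :: "'a::complex_banach set \<Rightarrow> ('a \<Rightarrow> 'a) \<Rightarrow> complex set" where
  "op_spectrum D A =
     - {z. bij_betw (\<lambda>x. z *\<^sub>C x - A x) D UNIV \<and> bounded_linear (resolvent D A z)}"

definition mild_solution ::
    "'a::complex_banach set \<Rightarrow> ('a \<Rightarrow> 'a) \<Rightarrow> (real \<Rightarrow> 'a) \<Rightarrow> (real \<Rightarrow> 'a) \<Rightarrow> bool" where
  "mild_solution D A \<phi> u \<longleftrightarrow>
     continuous_on UNIV u \<and>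
     (\<forall>t. integral_from_0 t u \<in> D \<and>
          u t = u 0 + A (integral_from_0 t u) + integral_from_0 t \<phi>)"

end

theory Submission
  imports Defs "HOL-Probability.Sinc_Integral" "HOL-Probability.Characteristic_Functions"
begin

text \<open>
  Choose a cutoff \<open>\<eta>\<close> of class \<open>C\<^sup>2\<close>, supported in \<open>(-a, a)\<close>, equal to 1 near \<open>K\<close> and vanishing near the
  spectrum of \<open>\<phi>\<close>. Its inverse transform \<open>\<beta>\<close> satisfies \<open>\<beta> * \<phi> = 0\<close>: near each frequency outside the
  spectrum some \<open>f\<close> with \<open>f * \<phi> = 0\<close> has nonzero transform, and \<open>f\<close> convolved with a sufficiently narrow
  plateau is close to a multiple of the plateau.

  The solution kernel \<open>G\<close> has the symbol \<open>H(s) = (1 - \<eta>(s)) R(is, A)\<close>. Differentiating the resolvent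
  produces powers of it, so \<open>H'\<close> decays like \<open>|s|\<^sup>-\<^sup>2\<^sup>\<theta>\<close> with \<open>2\<theta> > 1\<close> and \<open>H''\<close> like \<open>|s|\<^sup>-\<^sup>3\<^sup>\<theta>\<close>. Hence \<open>t G(t)\<close>
  is Hoelder continuous at 0 and \<open>t\<^sup>2 G(t)\<close> is bounded, which makes \<open>G\<close> integrable, and the
  inverse transforms of truncations of \<open>H\<close> converge to \<open>G\<close> in \<open>L\<^sup>1\<close>. They solve \<open>k' = A k + (\<rho> - \<beta>)\<close>
  for an approximate identity \<open>\<rho>\<close>; convolving with \<open>\<phi>\<close> kills \<open>\<beta>\<close>, and the limit is the mild equation,
  which is expressed through the bounded operator \<open>R(ia, A)\<close> since \<open>A\<close> is unbounded. Identities between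
  vector integrals are reduced to scalar ones by Hahn--Banach.

  For \<open>f\<close> bounded and uniformly continuous, \<open>G * f\<close> is a uniform limit of sums of translates of \<open>f\<close>
  under bounded operators, so it inherits membership in the class. Applied to the means of \<open>\<phi>\<close>,
  this gives the means of \<open>G * \<phi>\<close>, which tend to \<open>G * \<phi>\<close> uniformly.
\<close>

hide_const (open) Convolution.convolution

text \<open>The exponent \<theta> may be below 1, so \<open>H\<close> need not be integrable and
  \<open>G\<close> has no absolutely convergent inversion integral; it is reached through the
  transforms of the first two derivatives. The threshold 1/2 leaves decay to spare: with \<theta>
  capped at 1, \<open>H'\<close> times |s| to the power \<theta> - 1/2 is still integrable, which
  bounds \<open>G t\<close> near 0 by a multiple of |t| to the power \<theta> - 3/2. A second
  obstacle is that X and L(X) need not be separable. Vector functions are therefore handled as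
  everywhere limits of simple functions, a class closed under continuous maps and measurable
  substitutions, and Fubini is applied to scalar images only. A third is that \<open>\<phi>\<close>
  is merely bounded and measurable: its mollifications need not converge pointwise. The equation is
  therefore carried in a form integrated over intervals, since interval integrals of
  \<open>\<phi>\<close> depend Lipschitz continuously on the position of the interval.\<close>

section \<open>Linear functionals from minimal sublinear ones (Hahn-Banach)\<close>

definition sublinear :: "('a::real_vector \<Rightarrow> real) \<Rightarrow> bool" where
  "sublinear q \<longleftrightarrow> (\<forall>x y. q (x + y) \<le> q x + q y) \<and> (\<forall>c>0. \<forall>x. q (c *\<^sub>R x) \<le> c * q x)"

lemma sublinear_add: "sublinear q \<Longrightarrow> q (x + y) \<le> q x + q y"
  by (simp add: sublinear_def)

lemma sublinear_scale:
  assumes "sublinear q" "c > 0"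
  shows "q (c *\<^sub>R x) = c * q x"
proof (rule antisym)
  have "q ((1/c) *\<^sub>R (c *\<^sub>R x)) \<le> (1/c) * q (c *\<^sub>R x)"
    using assms unfolding sublinear_def by (meson divide_pos_pos zero_less_one)
  then show "c * q x \<le> q (c *\<^sub>R x)" using assms(2) by (simp add: field_simps)
qed (use assms in \<open>auto simp: sublinear_def\<close>)

lemma sublinear_zero: "sublinear q \<Longrightarrow> q 0 = 0"
  using sublinear_scale[of q 2 0] by simp

lemma sublinear_ge: "sublinear q \<Longrightarrow> - q (- y) \<le> q y"
  using sublinear_add[of q y "-y"] sublinear_zero[of q] by simp

text \<open>Shrinking a sublinear functional in the direction of \<open>z\<close> makes it affine along \<open>z\<close>;
  hence minimal sublinear functionals are linear.\<close>

definition shrink :: "'a \<Rightarrow> ('a::real_vector \<Rightarrow> real) \<Rightarrow> 'a \<Rightarrow> real" where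
  "shrink z q y = (INF t\<in>{0..}. q (y + t *\<^sub>R z) - t * q z)"

lemma shrink_bdd:
  assumes "sublinear q" shows "bdd_below ((\<lambda>t. q (y + t *\<^sub>R z) - t * q z) ` {0..})"
proof (rule bdd_belowI2)
  fix t :: real assume "t \<in> {0..}"
  have "q (t *\<^sub>R z) = t * q z"
    using sublinear_scale[OF assms, of t z] sublinear_zero[OF assms] \<open>t \<in> {0..}\<close>
    by (cases "t = 0") auto
  moreover have "q (t *\<^sub>R z) \<le> q (y + t *\<^sub>R z) + q (- y)"
    using sublinear_add[OF assms, of "y + t *\<^sub>R z" "-y"] by simp
  ultimately show "- q (- y) \<le> q (y + t *\<^sub>R z) - t * q z" by simp
qed

lemma shrink_le: "sublinear q \<Longrightarrow> t \<ge> 0 \<Longrightarrow> shrink z q y \<le> q (y + t *\<^sub>R z) - t * q z"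
  unfolding shrink_def by (rule cINF_lower[OF shrink_bdd]) auto

text \<open>The parameters add up: near-optimal s for x and t for y give the admissible parameter s
  + t for x + y. For homogeneity the parameter is rescaled from t to c t.\<close>

lemma sublinear_shrink:
  assumes "sublinear q" shows "sublinear (shrink z q)"
  unfolding sublinear_def
proof (intro conjI allI impI)
  fix x y
  show "shrink z q (x + y) \<le> shrink z q x + shrink z q y"
  proof (rule field_le_epsilon)
    fix e :: real assume "e > 0"
    then have "shrink z q x < shrink z q x + e/2" "shrink z q y < shrink z q y + e/2" by auto
    then obtain s t where st: "s \<ge> 0" "t \<ge> 0"
      "q (x + s *\<^sub>R z) - s * q z < shrink z q x + e/2"
      "q (y + t *\<^sub>R z) - t * q z < shrink z q y + e/2"
      unfolding shrink_def
      by (subst (asm) (1 2) cINF_less_iff[OF _ shrink_bdd[OF assms]]) auto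
    have "shrink z q (x + y) \<le> q ((x + y) + (s + t) *\<^sub>R z) - (s + t) * q z"
      using shrink_le[OF assms, of "s + t"] st by simp
    also have "\<dots> \<le> (q (x + s *\<^sub>R z) - s * q z) + (q (y + t *\<^sub>R z) - t * q z)"
      using sublinear_add[OF assms, of "x + s *\<^sub>R z" "y + t *\<^sub>R z"] by (simp add: algebra_simps)
    finally show "shrink z q (x + y) \<le> shrink z q x + shrink z q y + e" using st by linarith
  qed
next
  fix c :: real and x assume c: "c > 0"
  show "shrink z q (c *\<^sub>R x) \<le> c * shrink z q x"
  proof -
    have "shrink z q (c *\<^sub>R x) / c \<le> shrink z q x"
      unfolding shrink_def[of z q x]
    proof (rule cINF_greatest)
      fix t :: real assume t: "t \<in> {0..}"
      have "shrink z q (c *\<^sub>R x) \<le> q (c *\<^sub>R x + (c * t) *\<^sub>R z) - (c * t) * q z"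
        using shrink_le[OF assms, of "c * t"] c t by simp
      also have "c *\<^sub>R x + (c * t) *\<^sub>R z = c *\<^sub>R (x + t *\<^sub>R z)" by (simp add: algebra_simps)
      finally show "shrink z q (c *\<^sub>R x) / c \<le> q (x + t *\<^sub>R z) - t * q z"
        unfolding sublinear_scale[OF assms c] using c by (simp add: field_simps)
    qed auto
    then show ?thesis using c by (simp add: field_simps)
  qed
qed

text \<open>Zorn's lemma is applied to sublinear functionals instead of partial extensions from
  subspaces. A chain is bounded by its pointwise infimum: of two members chosen for x and for y, the
  smaller one serves both arguments, which gives subadditivity.\<close>

theorem exists_linear_below_sublinear:
  fixes p :: "'a::real_vector \<Rightarrow> real"
  assumes p: "sublinear p"
  obtains l where "linear l" "\<And>y. l y \<le> p y"
proof -
  define S where "S = {q. sublinear q \<and> (\<forall>y. q y \<le> p y)}"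
  \<comment> \<open>The order is reversed, so that the maximal element delivered by Zorn's lemma is
    a minimal functional.\<close>
  define P where "P = (\<lambda>q1 q2 :: 'a \<Rightarrow> real. \<forall>y. q2 y \<le> q1 y)"
  have "\<exists>m\<in>S. \<forall>q\<in>S. P m q \<longrightarrow> q = m"
  proof (rule predicate_Zorn)
    show "partial_order_on S (relation_of P S)"
      by (rule partial_order_on_relation_ofI)
        (auto simp: P_def fun_eq_iff intro: order_trans antisym)
    fix C assume C: "C \<in> Chains (relation_of P S)"
    then have CS: "q \<in> S" if "q \<in> C" for q
      using that by (auto simp: Chains_def relation_of_def)
    have chain: "P q1 q2 \<or> P q2 q1" if "q1 \<in> C" "q2 \<in> C" for q1 q2
      using that C by (auto simp: Chains_def relation_of_def)
    show "\<exists>u\<in>S. \<forall>a\<in>C. P a u"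
    proof (cases "C = {}")
      case True
      then show ?thesis using p by (auto simp: S_def)
    next
      case False
      define u where "u = (\<lambda>y. INF q\<in>C. q y)"
      \<comment> \<open>A bound common to all members: q(y) \<ge> - q(-y) \<ge> - p(-y).\<close>
      have bdd: "bdd_below ((\<lambda>q. q y) ` C)" for y
      proof (rule bdd_belowI2)
        fix q assume "q \<in> C"
        then have "sublinear q" "q (-y) \<le> p (-y)" using CS by (auto simp: S_def)
        then show "- p (-y) \<le> q y" using sublinear_ge[of q y] by linarith
      qed
      have u_le: "u y \<le> q y" if "q \<in> C" for q y
        unfolding u_def by (rule cINF_lower[OF bdd that])
      have "sublinear u"
        unfolding sublinear_def
      proof (intro conjI allI impI)
        fix x y
        show "u (x + y) \<le> u x + u y"
        proof (rule field_le_epsilon)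
          fix e :: real assume "e > 0"
          then have "u x < u x + e/2" "u y < u y + e/2" by auto
          then obtain q1 q2 where q: "q1 \<in> C" "q2 \<in> C" "q1 x < u x + e/2" "q2 y < u y + e/2"
            unfolding u_def by (subst (asm) (1 2) cINF_less_iff[OF False bdd]) auto
          obtain q where "q \<in> C" "q x \<le> q1 x" "q y \<le> q2 y"
            using chain[OF q(1,2)] q(1,2) by (auto simp: P_def)
          moreover have "q (x + y) \<le> q x + q y"
            using CS[OF \<open>q \<in> C\<close>] by (auto simp: S_def intro: sublinear_add)
          ultimately show "u (x + y) \<le> u x + u y + e"
            using u_le[of q "x + y"] q by linarith
        qed
      next
        fix c :: real and x assume c: "c > 0"
        have "u (c *\<^sub>R x) / c \<le> (INF q\<in>C. q x)"
        proof (rule cINF_greatest[OF False])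
          fix q assume "q \<in> C"
          then have "sublinear q" using CS by (auto simp: S_def)
          then show "u (c *\<^sub>R x) / c \<le> q x"
            using u_le[OF \<open>q \<in> C\<close>, of "c *\<^sub>R x"] sublinear_scale[of q c x] c
            by (simp add: field_simps)
        qed
        then have "u (c *\<^sub>R x) / c \<le> u x" by (simp add: u_def)
        then show "u (c *\<^sub>R x) \<le> c * u x" using c by (simp add: field_simps)
      qed
      moreover have "u y \<le> p y" for y
        using False CS u_le by (fastforce simp: S_def intro: order_trans)
      ultimately show ?thesis using u_le by (auto simp: S_def P_def)
    qed
  qed
  then obtain m where m: "sublinear m" "\<And>y. m y \<le> p y"
    and minimal: "\<And>q. sublinear q \<Longrightarrow> (\<And>y. q y \<le> m y) \<Longrightarrow> q = m"
    unfolding S_def P_def by (auto, meson order_trans)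
  have "m y + m z = m (y + z)" for y z
  proof -
    \<comment> \<open>Parameter 0 shows that shrinking only decreases \<open>m\<close>, so
      minimality forces equality. Parameter 1 then gives m y + m z \<le> m (y + z), the inequality
      opposite to subadditivity.\<close>
    have "shrink z m = m"
      using shrink_le[OF m(1), of 0 z] by (intro minimal sublinear_shrink m) auto
    then have "m y \<le> m (y + z) - m z" using shrink_le[OF m(1), of 1 z y] by simp
    then show ?thesis using sublinear_add[OF m(1), of y z] by linarith
  qed
  note add = this[symmetric]
  have neg: "m (- y) = - m y" for y using add[of y "-y"] sublinear_zero[OF m(1)] by simp
  have "linear m"
  proof (rule linearI)
    fix c x
    show "m (c *\<^sub>R x) = c *\<^sub>R m x"
      using sublinear_scale[OF m(1), of c x] sublinear_scale[OF m(1), of "-c" x] neg[of "c *\<^sub>R x"]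
        sublinear_zero[OF m(1)]
      by (cases c "0::real" rule: linorder_cases) auto
  qed (rule add)
  then show thesis using m(2) that by blast
qed

text \<open>The norm is shrunk in the direction of x before a linear functional is placed below it.
  At -x the parameter 1 gives the value - norm x, hence l (-x) \<le> - norm x, which pins down l
  x.\<close>

corollary exists_norming_functional:
  fixes x :: "'a::real_normed_vector"
  obtains l :: "'a \<Rightarrow> real" where "bounded_linear l" "\<And>y. \<bar>l y\<bar> \<le> norm y" "l x = norm x"
proof -
  have n: "sublinear (norm :: 'a \<Rightarrow> real)"
    by (auto simp: sublinear_def norm_triangle_ineq)
  obtain l where l: "linear l" "\<And>y. l y \<le> shrink x norm y"
    using exists_linear_below_sublinear[OF sublinear_shrink[OF n]] by blast
  have le: "l y \<le> norm y" for y
    using l(2)[of y] shrink_le[OF n, of 0 x y] by simp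
  have abs: "\<bar>l y\<bar> \<le> norm y" for y
    using le[of y] le[of "-y"] linear_neg[OF l(1), of y] by simp
  have "l (- x) \<le> - norm x"
    using l(2)[of "-x"] shrink_le[OF n, of 1 x "-x"] by simp
  then have "l x = norm x"
    using linear_neg[OF l(1), of x] le[of x] by simp
  moreover have "bounded_linear l"
    using l(1) abs by (intro bounded_linear_intro[where K = 1])
      (auto simp: linear_add linear_scale)
  ultimately show thesis using abs that by blast
qed

lemma eq_if_functionals_eq:
  fixes x y :: "'a::real_normed_vector"
  assumes "\<And>l :: 'a \<Rightarrow> real. bounded_linear l \<Longrightarrow> l x = l y"
  shows "x = y"
proof -
  obtain l :: "'a \<Rightarrow> real" where "bounded_linear l" "l (x - y) = norm (x - y)"
    using exists_norming_functional by blast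
  then show ?thesis using assms[of l] by (simp add: bounded_linear.linear linear_diff)
qed

lemma norm_le_if_functionals_le:
  fixes x :: "'a::real_normed_vector"
  assumes "\<And>l :: 'a \<Rightarrow> real. bounded_linear l \<Longrightarrow> (\<And>y. \<bar>l y\<bar> \<le> norm y) \<Longrightarrow> l x \<le> C"
  shows "norm x \<le> C"
  using exists_norming_functional[of x] assms by metis

section \<open>Strong measurability and the Bochner integral seen through functionals\<close>

text \<open>Convergence is required at every point, not almost everywhere. The property then
  survives composition with any measurable map, such as subtraction on a product space, without
  control over preimages of null sets.\<close>

definition simple_limit :: "'b measure \<Rightarrow> ('b \<Rightarrow> 'a::real_normed_vector) \<Rightarrow> bool" where
  "simple_limit M f \<longleftrightarrow>
     (\<exists>s. (\<forall>i::nat. simple_function M (s i)) \<and> (\<forall>x\<in>space M. (\<lambda>i. s i x) \<longlonglongrightarrow> f x))"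

lemma simple_limit_strongly_measurable: "simple_limit M f \<Longrightarrow> strongly_measurable M f"
  unfolding simple_limit_def strongly_measurable_def by (blast intro: AE_I2)

lemma simple_limit_const: "simple_limit M (\<lambda>_. c)"
  unfolding simple_limit_def by (rule exI[of _ "\<lambda>_ _. c"]) auto

lemma simple_limit_compose2:
  assumes f: "simple_limit M f" and g: "simple_limit M g"
    and p: "continuous_on UNIV (\<lambda>z. p (fst z) (snd z))"
  shows "simple_limit M (\<lambda>x. p (f x) (g x))"
proof -
  obtain s t where st: "\<And>i. simple_function M (s i)" "\<And>i. simple_function M (t i)"
    "\<And>x. x \<in> space M \<Longrightarrow> (\<lambda>i::nat. s i x) \<longlonglongrightarrow> f x" "\<And>x. x \<in> space M \<Longrightarrow> (\<lambda>i::nat. t i x) \<longlonglongrightarrow> g x"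
    using f g unfolding simple_limit_def by metis
  have "(\<lambda>i. p (s i x) (t i x)) \<longlonglongrightarrow> p (f x) (g x)" if "x \<in> space M" for x
    using continuous_on_tendsto_compose[OF p tendsto_Pair[OF st(3,4)[OF that]]] by simp
  moreover have "simple_function M (\<lambda>x. p (s i x) (t i x))" for i
    by (rule simple_function_compose2[OF st(1,2)])
  ultimately show ?thesis
    unfolding simple_limit_def by (intro exI[of _ "\<lambda>i x. p (s i x) (t i x)"] conjI allI ballI)
qed

lemma simple_limit_simple_function: "simple_function M s \<Longrightarrow> simple_limit M s"
  unfolding simple_limit_def by (rule exI[of _ "\<lambda>_. s"]) auto

lemma simple_limit_diff:
  assumes "simple_limit M f" "simple_limit M g"
  shows "simple_limit M (\<lambda>x. f x - g x)"
  by (rule simple_limit_compose2[OF assms, where p = "\<lambda>x y. x - y"]) (intro continuous_intros)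

lemma simple_limit_bilinear:
  assumes "bounded_bilinear p" "simple_limit M f" "simple_limit M g"
  shows "simple_limit M (\<lambda>x. p (f x) (g x))"
  using assms(2,3)
  by (rule simple_limit_compose2)
    (intro bounded_bilinear.continuous_on[OF assms(1)] continuous_intros)

lemma simple_limit_comp:
  assumes f: "simple_limit M f" and h: "h \<in> measurable N M"
  shows "simple_limit N (\<lambda>x. f (h x))"
proof -
  obtain s where s: "\<And>i. simple_function M (s i)" "\<And>x. x \<in> space M \<Longrightarrow> (\<lambda>i::nat. s i x) \<longlonglongrightarrow> f x"
    using f unfolding simple_limit_def by metis
  have "simple_function N (\<lambda>x. s i (h x))" for i
    using simple_function_comp[OF h s(1)[of i]] by (simp add: comp_def)
  then show ?thesis
    unfolding simple_limit_def using s(2) measurable_space[OF h]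
    by (intro exI[of _ "\<lambda>i x. s i (h x)"]) auto
qed

lemma simple_limit_borel_measurable:
  fixes l :: "'a::real_normed_vector \<Rightarrow> 'c::real_normed_vector"
  assumes f: "simple_limit M f" and l: "continuous_on UNIV l"
  shows "(\<lambda>x. l (f x)) \<in> borel_measurable M"
proof -
  obtain s where s: "\<And>i. simple_function M (s i)" "\<And>x. x \<in> space M \<Longrightarrow> (\<lambda>i::nat. s i x) \<longlonglongrightarrow> f x"
    using f unfolding simple_limit_def by metis
  have "(\<lambda>x. l (s i x)) \<in> borel_measurable M" for i
    using borel_measurable_simple_function simple_function_compose1[OF s(1)[of i], of l] by blast
  moreover have "(\<lambda>i. l (s i x)) \<longlonglongrightarrow> l (f x)" if "x \<in> space M" for x
    using continuous_on_tendsto_compose[OF l s(2)[OF that]] by simp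
  ultimately show ?thesis by (rule borel_measurable_LIMSEQ_metric)
qed

lemma simple_limit_norm:
  "simple_limit M f \<Longrightarrow> (\<lambda>x. norm (f x)) \<in> borel_measurable M"
  by (rule simple_limit_borel_measurable[where l = norm]) (auto intro: continuous_on_norm_id)

text \<open>The function is sampled at the grid points floor(i x) / i, and the window |x| \<le> i
  leaves finitely many samples. One exceptional point is allowed because the limit kernel
  \<open>G\<close> is known to be continuous only away from 0.\<close>

lemma simple_limit_if_isCont:
  fixes f :: "real \<Rightarrow> 'a::real_normed_vector"
  assumes "\<And>x. x \<noteq> 0 \<Longrightarrow> isCont f x"
  shows "simple_limit borel f"
proof -
  define r where "r = (\<lambda>(i::nat) (x::real). of_int \<lfloor>real i * x\<rfloor> / real i)"
  \<comment> \<open>The inner guard repeats the outer one, so that the sample point is by itself a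
    simple function of x and can be composed with \<open>f\<close>.\<close>
  define s where "s = (\<lambda>(i::nat) x. if x = 0 then f 0 else if \<bar>x\<bar> \<le> real i
    then f (if \<bar>x\<bar> \<le> real i then r i x else 0) else 0)"
  have "simple_function borel (s i)" for i
  proof -
    have r: "simple_function borel (\<lambda>x. if \<bar>x\<bar> \<le> real i then r i x else 0)"
    proof (rule simple_function_borel_measurable)
      show "(\<lambda>x. if \<bar>x\<bar> \<le> real i then r i x else 0) \<in> borel_measurable borel"
        unfolding r_def by measurable
      have "(\<lambda>x. if \<bar>x\<bar> \<le> real i then r i x else 0) ` space borel \<subseteq>
          insert 0 ((\<lambda>k. of_int k / real i) ` {\<lfloor>- (real i * real i)\<rfloor>..\<lfloor>real i * real i\<rfloor>})"
      proof (rule image_subsetI)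
        fix x :: real
        have "\<lfloor>real i * x\<rfloor> \<in> {\<lfloor>- (real i * real i)\<rfloor>..\<lfloor>real i * real i\<rfloor>}" if "\<bar>x\<bar> \<le> real i"
          using mult_left_mono[of x "real i" "real i"] mult_left_mono[of "- real i" x "real i"] that
          by (auto intro!: floor_mono)
        then show "(if \<bar>x\<bar> \<le> real i then r i x else 0) \<in>
            insert 0 ((\<lambda>k. of_int k / real i) ` {\<lfloor>- (real i * real i)\<rfloor>..\<lfloor>real i * real i\<rfloor>})"
          by (auto simp: r_def)
      qed
      then show "finite ((\<lambda>x. if \<bar>x\<bar> \<le> real i then r i x else 0) ` space borel)"
        by (rule finite_subset) auto
    qed
    show ?thesis
      unfolding s_def
    proof (intro simple_function_If simple_function_const)
      have "simple_function borel (\<lambda>x. f (if \<bar>x\<bar> \<le> real i then r i x else 0))"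
        using r by (rule simple_function_compose1)
      then show "simple_function borel (\<lambda>x. f (if \<bar>x\<bar> \<le> real i then r i x else 0))" .
    qed measurable
  qed
  moreover have "(\<lambda>i. s i x) \<longlonglongrightarrow> f x" for x
  proof (cases "x = 0")
    case True
    then show ?thesis by (simp add: s_def)
  next
    case False
    have "(\<lambda>i. r i x) \<longlonglongrightarrow> x"
    proof (rule LIMSEQ_I)
      fix e :: real assume "e > 0"
      then obtain N :: nat where N: "N > 0" "1 / real N < e"
        using real_arch_inverse[of e] by (auto simp: field_simps)
      have "norm (r i x - x) < e" if "i \<ge> N" for i
      proof -
        have i: "real i > 0" using that N by simp
        have "r i x - x = (of_int \<lfloor>real i * x\<rfloor> - real i * x) / real i"
          using i by (simp add: r_def field_simps)
        moreover have "\<bar>of_int \<lfloor>real i * x\<rfloor> - real i * x\<bar> \<le> 1" by linarith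
        ultimately have "\<bar>r i x - x\<bar> \<le> 1 / real i"
          using i by (simp add: divide_right_mono)
        also have "\<dots> \<le> 1 / real N" using N that by (simp add: frac_le)
        finally show ?thesis using N by simp
      qed
      then show "\<exists>no. \<forall>n\<ge>no. norm (r n x - x) < e" by blast
    qed
    then have "(\<lambda>i. f (r i x)) \<longlonglongrightarrow> f x"
      using assms[OF False] isCont_tendsto_compose by blast
    moreover have "\<forall>\<^sub>F i in sequentially. f (r i x) = s i x"
      using eventually_ge_at_top[of "nat \<lceil>\<bar>x\<bar>\<rceil>"]
    proof eventually_elim
      case (elim i)
      then have "\<bar>x\<bar> \<le> real i" by linarith
      then show ?case using False by (simp add: s_def)
    qed
    ultimately show ?thesis by (rule Lim_transform_eventually)
  qed
  ultimately show ?thesis unfolding simple_limit_def by blast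
qed

lemma simple_limit_continuous:
  "continuous_on UNIV f \<Longrightarrow> simple_limit borel (f :: real \<Rightarrow> 'a::real_normed_vector)"
  by (rule simple_limit_if_isCont) (simp add: continuous_on_eq_continuous_at)


text \<open>Pointwise approximants become approximants in mean once they are dominated. Their
  integrals then form a Cauchy sequence, and completeness supplies the value.\<close>

lemma has_bochner_int_exists:
  fixes f :: "'b \<Rightarrow> 'a::banach"
  assumes f: "simple_limit M f" and fin: "(\<integral>\<^sup>+x. norm (f x) \<partial>M) < \<infinity>"
  shows "\<exists>I. has_bochner_int M f I"
proof -
  obtain s where s: "\<And>i. simple_function M (s i)" "\<And>x. x \<in> space M \<Longrightarrow> (\<lambda>i::nat. s i x) \<longlonglongrightarrow> f x"
    using f unfolding simple_limit_def by metis
  \<comment> \<open>Values larger than twice \<open>norm (f x)\<close> are replaced by 0. This gives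
    the majorant 3 |f| for the error and preserves convergence: where f x is nonzero the cut is
    eventually inactive, and where f x = 0 it forces the value 0.\<close>
  define t where "t = (\<lambda>i x. if norm (s i x) \<le> 2 * norm (f x) then s i x else 0)"
  have nf[measurable]: "(\<lambda>x. norm (f x)) \<in> borel_measurable M"
    by (rule simple_limit_norm[OF f])
  have ns[measurable]: "(\<lambda>x. norm (s i x)) \<in> borel_measurable M" for i
    by (rule borel_measurable_simple_function) (rule simple_function_compose1[OF s(1)])
  have t: "simple_function M (t i)" for i
    unfolding t_def by (intro simple_function_If s simple_function_const) measurable
  have t_le: "norm (t i x) \<le> 2 * norm (f x)" for i x by (simp add: t_def)
  have t_lim: "(\<lambda>i. norm (f x - t i x)) \<longlonglongrightarrow> 0" if "x \<in> space M" for x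
  proof (cases "f x = 0")
    case True
    then have "t i x = 0" for i using t_le[of i x] by simp
    then show ?thesis using True by simp
  next
    case False
    have "\<forall>\<^sub>F i in sequentially. norm (s i x) < 2 * norm (f x)"
      using order_tendstoD(2)[OF tendsto_norm[OF s(2)[OF that]]] False by simp
    then have "\<forall>\<^sub>F i in sequentially. norm (f x - s i x) = norm (f x - t i x)"
      by eventually_elim (simp add: t_def)
    moreover have "(\<lambda>i. norm (f x - s i x)) \<longlonglongrightarrow> 0"
      using tendsto_norm[OF tendsto_diff[OF tendsto_const[of "f x"] s(2)[OF that]]] by simp
    ultimately show ?thesis by (rule Lim_transform_eventually[rotated])
  qed
  have diff: "simple_limit M (\<lambda>x. f x - t i x)" for i
    by (intro simple_limit_diff f simple_limit_simple_function t)
  note [measurable] = simple_limit_norm[OF diff]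
  have int0: "(\<lambda>i. \<integral>\<^sup>+x. ennreal (norm (f x - t i x)) \<partial>M) \<longlonglongrightarrow> (\<integral>\<^sup>+x. 0 \<partial>M)"
  proof (rule nn_integral_dominated_convergence[where w = "\<lambda>x. 3 * ennreal (norm (f x))"])
    show "(\<integral>\<^sup>+x. 3 * ennreal (norm (f x)) \<partial>M) < \<infinity>"
      using fin by (simp add: nn_integral_cmult ennreal_mult_less_top)
    show "AE x in M. ennreal (norm (f x - t i x)) \<le> 3 * ennreal (norm (f x))" for i
    proof (intro AE_I2)
      fix x
      have "norm (f x - t i x) \<le> 3 * norm (f x)"
        using norm_triangle_ineq4[of "f x" "t i x"] t_le[of i x] by linarith
      then show "ennreal (norm (f x - t i x)) \<le> 3 * ennreal (norm (f x))"
        by (metis ennreal_leI ennreal_mult' ennreal_numeral zero_le_numeral)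
    qed
    show "AE x in M. (\<lambda>i. ennreal (norm (f x - t i x))) \<longlonglongrightarrow> 0"
      using t_lim tendsto_ennrealI by (intro AE_I2) fastforce
  qed auto
  then have int0: "(\<lambda>i. \<integral>\<^sup>+x. ennreal (norm (f x - t i x)) \<partial>M) \<longlonglongrightarrow> 0" by simp
  have sbi: "Bochner_Integration.simple_bochner_integrable M (t i)" for i
  proof (rule simple_bochner_integrableI_bounded[OF t])
    have "(\<integral>\<^sup>+x. norm (t i x) \<partial>M) \<le> (\<integral>\<^sup>+x. 2 * ennreal (norm (f x)) \<partial>M)"
      using t_le by (intro nn_integral_mono)
        (metis ennreal_leI ennreal_mult' ennreal_numeral zero_le_numeral)
    also have "\<dots> < \<infinity>" using fin by (simp add: nn_integral_cmult ennreal_mult_less_top)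
    finally show "(\<integral>\<^sup>+x. norm (t i x) \<partial>M) < \<infinity>" .
  qed
  have dist: "ennreal (norm (Bochner_Integration.simple_bochner_integral M (t i) - Bochner_Integration.simple_bochner_integral M (t j)))
      \<le> (\<integral>\<^sup>+x. ennreal (norm (f x - t i x)) \<partial>M) + (\<integral>\<^sup>+x. ennreal (norm (f x - t j x)) \<partial>M)" for i j
  proof -
    have "Bochner_Integration.simple_bochner_integral M (t i) - Bochner_Integration.simple_bochner_integral M (t j) =
        Bochner_Integration.simple_bochner_integral M (\<lambda>x. t i x - t j x)"
      by (rule simple_bochner_integral_diff[symmetric]) (rule sbi)+
    moreover have sd: "Bochner_Integration.simple_bochner_integrable M (\<lambda>x. t i x - t j x)"
      by (rule simple_bochner_integrable_compose2) (auto intro: sbi)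
    moreover have sn: "Bochner_Integration.simple_bochner_integrable M (\<lambda>x. norm (t i x - t j x))"
      by (rule simple_bochner_integrable_compose2[where p = "\<lambda>x y. norm (x - y)"]) (auto intro: sbi)
    ultimately have "ennreal (norm (Bochner_Integration.simple_bochner_integral M (t i) - Bochner_Integration.simple_bochner_integral M (t j)))
        \<le> (\<integral>\<^sup>+x. norm (t i x - t j x) \<partial>M)"
      using simple_bochner_integral_norm_bound[OF sd] simple_bochner_integral_eq_nn_integral[OF sn]
      by (metis ennreal_leI norm_ge_zero)
    also have "\<dots> \<le> (\<integral>\<^sup>+x. ennreal (norm (f x - t i x)) + ennreal (norm (f x - t j x)) \<partial>M)"
    proof (rule nn_integral_mono)
      fix x
      have "norm (t i x - t j x) \<le> norm (f x - t i x) + norm (f x - t j x)"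
        using norm_triangle_ineq4[of "f x - t j x" "f x - t i x"] by simp
      then show "ennreal (norm (t i x - t j x)) \<le> ennreal (norm (f x - t i x)) + ennreal (norm (f x - t j x))"
        by (metis ennreal_leI ennreal_plus norm_ge_zero)
    qed
    also have "\<dots> = (\<integral>\<^sup>+x. ennreal (norm (f x - t i x)) \<partial>M) + (\<integral>\<^sup>+x. ennreal (norm (f x - t j x)) \<partial>M)"
      by (rule nn_integral_add) auto
    finally show ?thesis .
  qed
  have "Cauchy (\<lambda>i. Bochner_Integration.simple_bochner_integral M (t i))"
  proof (rule metric_CauchyI)
    fix e :: real assume "e > 0"
    then have "\<forall>\<^sub>F i in sequentially. (\<integral>\<^sup>+x. ennreal (norm (f x - t i x)) \<partial>M) < ennreal (e/2)"
      using order_tendstoD(2)[OF int0, of "ennreal (e/2)"] by simp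
    then obtain N where N: "\<And>i. i \<ge> N \<Longrightarrow> (\<integral>\<^sup>+x. ennreal (norm (f x - t i x)) \<partial>M) < ennreal (e/2)"
      by (auto simp: eventually_sequentially)
    have "dist (Bochner_Integration.simple_bochner_integral M (t i)) (Bochner_Integration.simple_bochner_integral M (t j)) < e"
      if "i \<ge> N" "j \<ge> N" for i j
    proof -
      have "ennreal (norm (Bochner_Integration.simple_bochner_integral M (t i) - Bochner_Integration.simple_bochner_integral M (t j)))
          < ennreal (e/2) + ennreal (e/2)"
        using dist[of i j] add_strict_mono[OF N[OF that(1)] N[OF that(2)]] by (rule le_less_trans)
      also have "\<dots> = ennreal e" using \<open>e > 0\<close> by (simp flip: ennreal_plus)
      finally show ?thesis by (simp add: dist_norm ennreal_less_iff)
    qed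
    then show "\<exists>M'. \<forall>m\<ge>M'. \<forall>n\<ge>M'. dist (Bochner_Integration.simple_bochner_integral M (t m)) (Bochner_Integration.simple_bochner_integral M (t n)) < e"
      by blast
  qed
  then obtain I where "(\<lambda>i. Bochner_Integration.simple_bochner_integral M (t i)) \<longlonglongrightarrow> I"
    using Cauchy_convergent convergent_def by blast
  then show ?thesis
    unfolding has_bochner_int_def using simple_limit_strongly_measurable[OF f] sbi int0 by blast
qed

text \<open>The images under \<open>l\<close> of the approximating simple functions approximate
  \<open>l\<close> composed with \<open>f\<close>, with an error larger by at most the factor K.
  This is the bridge from the vector integral to the integral in a second countable space.\<close>

lemma has_bochner_int_functional:
  fixes f :: "'b \<Rightarrow> 'a::real_normed_vector" and l :: "'a \<Rightarrow> 'c::{banach, second_countable_topology}"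
  assumes f: "simple_limit M f" and I: "has_bochner_int M f I" and l: "bounded_linear l"
  shows "has_bochner_integral M (\<lambda>x. l (f x)) (l I)"
proof -
  interpret l: bounded_linear l by fact
  obtain s where s: "\<And>i. Bochner_Integration.simple_bochner_integrable M (s i)"
    "(\<lambda>i::nat. \<integral>\<^sup>+x. ennreal (norm (f x - s i x)) \<partial>M) \<longlonglongrightarrow> 0"
    "(\<lambda>i. Bochner_Integration.simple_bochner_integral M (s i)) \<longlonglongrightarrow> I"
    using I unfolding has_bochner_int_def by blast
  obtain K where K: "K > 0" "\<And>x. norm (l x) \<le> norm x * K" using l.pos_bounded by blast
  have "simple_limit M (\<lambda>x. f x - s i x)" for i
    using s(1)[of i] by (intro simple_limit_diff f simple_limit_simple_function)
      (auto elim: simple_bochner_integrable.cases)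
  note [measurable] = simple_limit_norm[OF this]
  show ?thesis
  proof (rule has_bochner_integral.intros)
    show "(\<lambda>x. l (f x)) \<in> borel_measurable M"
      by (rule simple_limit_borel_measurable[OF f linear_continuous_on[OF l]])
    show "Bochner_Integration.simple_bochner_integrable M (\<lambda>x. l (s i x))" for i
      by (rule simple_bochner_integrable_compose2[where p = "\<lambda>x y. l x", OF _ s(1) s(1)]) (rule l.zero)
    show "(\<lambda>i. \<integral>\<^sup>+x. norm (l (f x) - l (s i x)) \<partial>M) \<longlonglongrightarrow> 0"
    proof (rule tendsto_sandwich[where f = "\<lambda>_. 0" and
          h = "\<lambda>i. ennreal K * (\<integral>\<^sup>+x. ennreal (norm (f x - s i x)) \<partial>M)"])
      show "\<forall>\<^sub>F i in sequentially. (\<integral>\<^sup>+x. norm (l (f x) - l (s i x)) \<partial>M)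
          \<le> K * (\<integral>\<^sup>+x. ennreal (norm (f x - s i x)) \<partial>M)"
      proof (intro always_eventually allI)
        fix i
        have "(\<integral>\<^sup>+x. norm (l (f x) - l (s i x)) \<partial>M) \<le> (\<integral>\<^sup>+x. ennreal K * norm (f x - s i x) \<partial>M)"
          using K by (intro nn_integral_mono)
            (auto simp: l.diff[symmetric] ennreal_mult[symmetric] mult.commute simp del: ennreal_mult)
        also have "\<dots> = K * (\<integral>\<^sup>+x. ennreal (norm (f x - s i x)) \<partial>M)"
          by (rule nn_integral_cmult) simp
        finally show "(\<integral>\<^sup>+x. norm (l (f x) - l (s i x)) \<partial>M)
          \<le> K * (\<integral>\<^sup>+x. ennreal (norm (f x - s i x)) \<partial>M)" .
      qed
      show "(\<lambda>i. ennreal K * (\<integral>\<^sup>+x. ennreal (norm (f x - s i x)) \<partial>M)) \<longlonglongrightarrow> 0"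
        using ennreal_tendsto_cmult[OF _ s(2), of K] by simp
    qed auto
    show "(\<lambda>i. Bochner_Integration.simple_bochner_integral M (\<lambda>x. l (s i x))) \<longlonglongrightarrow> l I"
      using l.tendsto[OF s(3)] simple_bochner_integral_linear[OF l.linear_axioms s(1)] by simp
  qed
qed

lemma has_bochner_int_unique:
  assumes "simple_limit M f" "has_bochner_int M f I" "has_bochner_int M f I'"
  shows "I = I'"
  by (rule eq_if_functionals_eq)
    (use assms has_bochner_int_functional has_bochner_integral_eq in blast)

lemma has_bochner_int_bochner_integral:
  fixes f :: "'b \<Rightarrow> 'a::banach"
  assumes "simple_limit M f" "(\<integral>\<^sup>+x. norm (f x) \<partial>M) < \<infinity>"
  shows "has_bochner_int M f (bochner_integral M f)"
proof -
  obtain I where I: "has_bochner_int M f I" using has_bochner_int_exists[OF assms] by blast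
  then show ?thesis
    unfolding bochner_integral_def
    by (rule theI) (use I assms has_bochner_int_unique in blast)
qed

lemma has_bochner_int_cong_AE:
  assumes "AE x in M. f x = g x"
  shows "has_bochner_int M f = has_bochner_int M g"
proof -
  have "(AE x in M. (\<lambda>i. s i x) \<longlonglongrightarrow> f x) \<longleftrightarrow> (AE x in M. (\<lambda>i. s i x) \<longlonglongrightarrow> g x)" for s :: "nat \<Rightarrow> _"
    using assms by (auto elim: AE_mp)
  moreover have "(\<integral>\<^sup>+x. ennreal (norm (f x - s x)) \<partial>M) = (\<integral>\<^sup>+x. ennreal (norm (g x - s x)) \<partial>M)" for s
    using assms by (intro nn_integral_cong_AE) auto
  ultimately show ?thesis
    by (simp add: has_bochner_int_def strongly_measurable_def fun_eq_iff)
qed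

lemma bochner_integral_cong_AE:
  "AE x in M. f x = g x \<Longrightarrow> bochner_integral M f = bochner_integral M g"
  using has_bochner_int_cong_AE[of f g M] by (simp add: bochner_integral_def)

lemma simple_limit_lebesgue_on: "simple_limit borel f \<Longrightarrow> simple_limit (lebesgue_on S) f"
  by (rule simple_limit_comp[where h = "\<lambda>x. x"])
    (auto intro!: measurable_restrict_space1 measurable_completion)

lemma nn_integral_lebesgue_on:
  fixes f :: "real \<Rightarrow> 'a::real_normed_vector"
  assumes "S \<in> sets borel" "simple_limit borel f" "set_integrable lborel S (\<lambda>x. norm (f x))"
  shows "(\<integral>\<^sup>+x. norm (f x) \<partial>lebesgue_on S) < \<infinity>"
proof -
  have "(\<integral>\<^sup>+x. norm (f x) \<partial>lebesgue_on S) = (\<integral>\<^sup>+x. ennreal (norm (f x)) * indicator S x \<partial>lborel)"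
    using assms(1) by (subst nn_integral_restrict_space) (auto simp: nn_integral_completion)
  also have "\<dots> = (\<integral>\<^sup>+x. ennreal (norm (indicator S x *\<^sub>R norm (f x))) \<partial>lborel)"
    by (intro nn_integral_cong) (auto split: split_indicator)
  also have "\<dots> < \<infinity>"
    using assms(3) by (simp add: set_integrable_def integrable_iff_bounded)
  finally show ?thesis .
qed

text \<open>The vector integral is taken over the complete measure, the scalar one over
  \<open>lborel\<close>, where the product measure and Fubini are used. Borel measurability of the
  integrand makes the two agree.\<close>

lemma bochner_integral_functional:
  fixes f :: "real \<Rightarrow> 'a::banach" and l :: "'a \<Rightarrow> 'c::{banach, second_countable_topology}"
  assumes S: "S \<in> sets borel" and f: "simple_limit borel f"
    and int: "set_integrable lborel S (\<lambda>x. norm (f x))" and l: "bounded_linear l"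
  shows "set_integrable lborel S (\<lambda>x. l (f x))"
    and "l (bochner_integral (lebesgue_on S) f) = (LINT x:S|lborel. l (f x))"
proof -
  have m: "(\<lambda>x. l (f x)) \<in> borel_measurable lborel"
    using simple_limit_borel_measurable[OF f linear_continuous_on[OF l]] by simp
  have "has_bochner_integral (lebesgue_on S) (\<lambda>x. l (f x)) (l (bochner_integral (lebesgue_on S) f))"
    using has_bochner_int_functional has_bochner_int_bochner_integral
      simple_limit_lebesgue_on[OF f] nn_integral_lebesgue_on[OF S f int] l by blast
  then have "integrable (lebesgue_on S) (\<lambda>x. l (f x))"
    and eq: "(LINT x|lebesgue_on S. l (f x)) = l (bochner_integral (lebesgue_on S) f)"
    by (auto simp: has_bochner_integral_iff)
  then have "integrable lebesgue (\<lambda>x. indicator S x *\<^sub>R l (f x))"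
    using S by (subst (asm) integrable_restrict_space) auto
  then show "set_integrable lborel S (\<lambda>x. l (f x))"
    using m S by (simp add: set_integrable_def integrable_completion)
  have "(LINT x|lebesgue_on S. l (f x)) = (LINT x|lebesgue. indicator S x *\<^sub>R l (f x))"
    using S by (subst integral_restrict_space) auto
  also have "\<dots> = (LINT x:S|lborel. l (f x))"
    using m S by (simp add: set_lebesgue_integral_def integral_completion)
  finally show "l (bochner_integral (lebesgue_on S) f) = (LINT x:S|lborel. l (f x))"
    using eq by simp
qed

lemma bochner_integral_functional_UNIV:
  fixes f :: "real \<Rightarrow> 'a::banach" and l :: "'a \<Rightarrow> 'c::{banach, second_countable_topology}"
  assumes f: "simple_limit borel f"
    and int: "integrable lborel (\<lambda>x. norm (f x))" and l: "bounded_linear l"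
  shows "integrable lborel (\<lambda>x. l (f x))"
    and "l (bochner_integral lebesgue f) = (LINT x|lborel. l (f x))"
  using bochner_integral_functional[of UNIV f l] assms
  by (simp_all add: set_integrable_def set_lebesgue_integral_def lebesgue_on_UNIV_eq)

lemma bochner_integrable_UNIV:
  fixes f :: "real \<Rightarrow> 'a::banach"
  assumes "simple_limit borel f" "integrable lborel (\<lambda>x. norm (f x))"
  shows "bochner_integrable lebesgue f"
proof -
  have "set_integrable lborel UNIV (\<lambda>x. norm (f x))" using assms by (simp add: set_integrable_def)
  then show ?thesis
    using nn_integral_lebesgue_on[of UNIV f] simple_limit_lebesgue_on[of f UNIV] assms
    unfolding bochner_integrable_def lebesgue_on_UNIV_eq
    by (intro has_bochner_int_exists) auto
qed

lemma norm_bochner_integral_le: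
  fixes f :: "real \<Rightarrow> 'a::banach"
  assumes f: "simple_limit borel f" and g: "integrable lborel g" and le: "\<And>x. norm (f x) \<le> g x"
  shows "norm (bochner_integral lebesgue f) \<le> (LINT x|lborel. g x)"
proof (rule norm_le_if_functionals_le)
  fix l :: "'a \<Rightarrow> real" assume l: "bounded_linear l" "\<And>y. \<bar>l y\<bar> \<le> norm y"
  have int: "integrable lborel (\<lambda>x. norm (f x))"
    by (rule Bochner_Integration.integrable_bound[OF g])
      (use simple_limit_norm[OF f] le in \<open>auto intro: order_trans[OF _ abs_ge_self]\<close>)
  have "l (f x) \<le> g x" for x using l(2)[of "f x"] le[of x] by linarith
  then show "l (bochner_integral lebesgue f) \<le> (LINT x|lborel. g x)"
    unfolding bochner_integral_functional_UNIV(2)[OF f int l(1)]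
    using bochner_integral_functional_UNIV(1)[OF f int l(1)] g by (intro integral_mono)
qed

text \<open>Each simple function for the completed measure agrees almost everywhere with a Borel
  one. The countably many exceptional sets, the failure of convergence and the failure of the bound
  fit into one Borel null set, on which the representative is set to 0; convergence and bound then
  hold everywhere.\<close>

lemma strongly_measurable_ex_simple_limit:
  fixes f :: "real \<Rightarrow> 'a::real_normed_vector"
  assumes f: "strongly_measurable lebesgue f" and C: "AE t in lebesgue. norm (f t) \<le> C" and "C \<ge> 0"
  obtains f' where "simple_limit borel f'" "AE t in lborel. f t = f' t" "\<And>t. norm (f' t) \<le> C"
proof -
  obtain s where s: "\<And>i::nat. simple_function lebesgue (s i)"
    "AE x in lebesgue. (\<lambda>i. s i x) \<longlonglongrightarrow> f x"
    using f unfolding strongly_measurable_def by blast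
  have "\<forall>i. \<exists>s'. simple_function lborel s' \<and> (AE x in lborel. s i x = s' x)"
    using completion_ex_simple_function[OF s(1)] by blast
  then obtain s' where s': "\<And>i. simple_function lborel (s' i)" "\<And>i. AE x in lborel. s i x = s' i x"
    by metis
  have "AE x in lborel. (\<lambda>i. s' i x) \<longlonglongrightarrow> f x \<and> norm (f x) \<le> C"
  proof -
    have "AE x in lborel. \<forall>i. s i x = s' i x" using s'(2) by (simp add: AE_all_countable)
    moreover have "AE x in lborel. (\<lambda>i. s i x) \<longlonglongrightarrow> f x" "AE x in lborel. norm (f x) \<le> C"
      using s(2) C by (simp_all add: AE_completion_iff)
    ultimately show ?thesis by eventually_elim simp
  qed
  then obtain N where N: "N \<in> null_sets lborel"
    "{x \<in> space lborel. \<not> ((\<lambda>i. s' i x) \<longlonglongrightarrow> f x \<and> norm (f x) \<le> C)} \<subseteq> N"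
    unfolding eventually_ae_filter by blast
  then have N': "x \<notin> N \<Longrightarrow> (\<lambda>i. s' i x) \<longlonglongrightarrow> f x" "x \<notin> N \<Longrightarrow> norm (f x) \<le> C" for x by auto
  define f' where "f' = (\<lambda>x. if x \<in> N then 0 else f x)"
  have "simple_limit lborel f'"
    unfolding simple_limit_def
  proof (intro exI[of _ "\<lambda>i x. if x \<in> N then 0 else s' i x"] conjI allI ballI)
    show "simple_function lborel (\<lambda>x. if x \<in> N then 0 else s' i x)" for i
      using N(1) by (intro simple_function_If_set s') auto
    show "(\<lambda>i. if x \<in> N then 0 else s' i x) \<longlonglongrightarrow> f' x" for x
      using N'(1)[of x] by (auto simp: f'_def)
  qed
  then have "simple_limit borel f'"
    by (rule simple_limit_comp[where h = "\<lambda>x. x"]) auto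
  moreover have "AE t in lborel. f t = f' t"
    using AE_not_in[OF N(1)] by eventually_elim (simp add: f'_def)
  moreover have "norm (f' t) \<le> C" for t using N'(2) \<open>C \<ge> 0\<close> by (auto simp: f'_def)
  ultimately show thesis using that by blast
qed

lemma AE_lborel_affine:
  fixes c t :: real
  assumes "AE x in lborel. P x" "c \<noteq> 0"
  shows "AE x in lborel. P (t + c * x)"
proof -
  obtain N where N: "N \<in> null_sets lborel" "\<And>x. x \<notin> N \<Longrightarrow> P x"
    using assms(1) unfolding eventually_ae_filter by auto
  have "AE x in lborel. t + c * x \<notin> N"
    by (rule AE_borel_affine) (use N assms(2) AE_not_in[OF N(1)] in auto)
  then show ?thesis by eventually_elim (rule N(2))
qed

section \<open>Complex scalars\<close>

lemma bounded_bilinear_scaleC: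
  "bounded_bilinear (scaleC :: complex \<Rightarrow> 'a::complex_banach \<Rightarrow> 'a)"
proof
  fix r :: real and c c' :: complex and x x' :: 'a
  show "(c + c') *\<^sub>C x = c *\<^sub>C x + c' *\<^sub>C x" by (rule scaleC_add_left)
  show "c *\<^sub>C (x + x') = c *\<^sub>C x + c *\<^sub>C x'" by (rule scaleC_add_right)
  show "(r *\<^sub>R c) *\<^sub>C x = r *\<^sub>R (c *\<^sub>C x)"
    unfolding scaleR_conv_of_real[of r c] scaleC_scaleC[symmetric] scaleC_of_real ..
  show "c *\<^sub>C (r *\<^sub>R x) = r *\<^sub>R (c *\<^sub>C x)"
    by (simp only: scaleC_of_real[symmetric] scaleC_scaleC mult.commute)
  show "\<exists>K. \<forall>(a::complex) b::'a. norm (a *\<^sub>C b) \<le> norm a * norm b * K"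
    by (rule exI[of _ 1]) (simp add: norm_scaleC)
qed

interpretation scaleC: bounded_bilinear "scaleC :: complex \<Rightarrow> 'a::complex_banach \<Rightarrow> 'a"
  by (rule bounded_bilinear_scaleC)

lemmas continuous_on_scaleC [continuous_intros] = scaleC.continuous_on
lemmas has_vector_derivative_scaleC = scaleC.has_vector_derivative

lemma scaleC_one [simp]: "1 *\<^sub>C x = (x::'a::complex_banach)"
  using scaleC_of_real[of 1 x] by simp

lemma scaleC_scaleR_commute: "c *\<^sub>C (r *\<^sub>R x) = r *\<^sub>R (c *\<^sub>C (x::'a::complex_banach))"
  by (rule scaleC.scaleR_right)

text \<open>With scalars acting on values, operator-valued symbols fall under the same inverse
  transform as scalar ones. The type consists of real-linear operators, so complex linearity of
  \<open>G\<close> is tracked separately through \<open>bounded_clinear_ops\<close>.\<close>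

instantiation blinfun :: (real_normed_vector, complex_banach) complex_banach
begin

lift_definition scaleC_blinfun :: "complex \<Rightarrow> ('a \<Rightarrow>\<^sub>L 'b) \<Rightarrow> 'a \<Rightarrow>\<^sub>L 'b"
  is "\<lambda>c f x. c *\<^sub>C f x"
  by (rule bounded_linear_compose[OF scaleC.bounded_linear_right])

instance
proof
  fix c d :: complex and f g :: "'a \<Rightarrow>\<^sub>L 'b" and r :: real
  show "c *\<^sub>C (f + g) = c *\<^sub>C f + c *\<^sub>C g"
    by (rule blinfun_eqI) (simp add: scaleC_blinfun.rep_eq blinfun.add_left scaleC_add_right)
  show "(c + d) *\<^sub>C f = c *\<^sub>C f + d *\<^sub>C f"
    by (rule blinfun_eqI) (simp add: scaleC_blinfun.rep_eq blinfun.add_left scaleC_add_left)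
  show assoc: "c *\<^sub>C d *\<^sub>C f = (c * d) *\<^sub>C f" for c d and f :: "'a \<Rightarrow>\<^sub>L 'b"
    by (rule blinfun_eqI) (simp add: scaleC_blinfun.rep_eq scaleC_scaleC)
  show real: "complex_of_real r *\<^sub>C f = r *\<^sub>R f" for r and f :: "'a \<Rightarrow>\<^sub>L 'b"
    by (rule blinfun_eqI) (simp add: scaleC_blinfun.rep_eq scaleC_of_real blinfun.scaleR_left)
  have le: "norm (c *\<^sub>C f) \<le> cmod c * norm f" for c and f :: "'a \<Rightarrow>\<^sub>L 'b"
    by (rule norm_blinfun_bound)
      (auto simp: scaleC_blinfun.rep_eq norm_scaleC mult.assoc intro!: mult_left_mono norm_blinfun)
  show "norm (c *\<^sub>C f) = cmod c * norm f"
  proof (cases "c = 0")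
    case True
    then show ?thesis using real[of 0 f] by simp
  next
    case False
    have "norm (inverse c *\<^sub>C c *\<^sub>C f) \<le> cmod (inverse c) * norm (c *\<^sub>C f)" by (rule le)
    moreover have "inverse c *\<^sub>C c *\<^sub>C f = f"
      using False real[of 1 f] by (simp add: assoc)
    ultimately have "cmod c * norm f \<le> norm (c *\<^sub>C f)"
      using False by (simp add: norm_divide field_simps)
    then show ?thesis using le[of c f] by linarith
  qed
qed

end

section \<open>Compactly supported functions of class C2\<close>

text \<open>The derivatives are explicit arguments, so that the product rule returns formulas for
  them that can be estimated term by term.\<close>

definition C2 :: "(real \<Rightarrow> 'a::real_normed_vector) \<Rightarrow> (real \<Rightarrow> 'a) \<Rightarrow> (real \<Rightarrow> 'a) \<Rightarrow> bool" where
  "C2 f f1 f2 \<longleftrightarrow> (\<forall>s. (f has_vector_derivative f1 s) (at s)) \<and>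
     (\<forall>s. (f1 has_vector_derivative f2 s) (at s)) \<and> continuous_on UNIV f2"

definition bounded_support :: "(real \<Rightarrow> 'a::zero) \<Rightarrow> bool" where
  "bounded_support f \<longleftrightarrow> (\<exists>N. \<forall>s. \<bar>s\<bar> > N \<longrightarrow> f s = 0)"

lemma bounded_supportE:
  assumes "bounded_support f"
  obtains N where "N > 0" "\<And>s. \<bar>s\<bar> \<ge> N \<Longrightarrow> f s = 0"
proof -
  obtain N where "\<And>s. \<bar>s\<bar> > N \<Longrightarrow> f s = 0" using assms by (auto simp: bounded_support_def)
  then show thesis by (intro that[of "\<bar>N\<bar> + 1"]) auto
qed

lemma bounded_support_mono: "bounded_support f \<Longrightarrow> (\<And>s. f s = 0 \<Longrightarrow> g s = 0) \<Longrightarrow> bounded_support g"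
  unfolding bounded_support_def by metis

lemma bounded_support_add:
  fixes f g :: "real \<Rightarrow> 'a::real_normed_vector"
  assumes "bounded_support f" "bounded_support g"
  shows "bounded_support (\<lambda>s. f s + g s)"
proof -
  obtain M N where "\<And>s. \<bar>s\<bar> \<ge> M \<Longrightarrow> f s = 0" "\<And>s. \<bar>s\<bar> \<ge> N \<Longrightarrow> g s = 0"
    using assms by (metis bounded_supportE)
  then show ?thesis unfolding bounded_support_def by (intro exI[of _ "max M N"]) auto
qed

lemma bounded_support_derivative:
  assumes f: "bounded_support f" and d: "\<And>s. (f has_vector_derivative f1 s) (at s)"
  shows "bounded_support f1"
proof -
  obtain N where N: "\<And>s. \<bar>s\<bar> > N \<Longrightarrow> f s = 0" using f by (auto simp: bounded_support_def)
  have "f1 s = 0" if s: "\<bar>s\<bar> > N" for s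
  proof -
    have "open {s. \<bar>s\<bar> > N}" by (intro open_Collect_less continuous_intros)
    then have "((\<lambda>_. 0) has_vector_derivative f1 s) (at s)"
      by (rule has_vector_derivative_transform_within_open[OF d]) (use s N in auto)
    then show ?thesis using vector_derivative_unique_at has_vector_derivative_const by blast
  qed
  then show ?thesis unfolding bounded_support_def by blast
qed

lemma C2_continuous:
  assumes "C2 f f1 f2"
  shows "continuous_on UNIV f" "continuous_on UNIV f1" "continuous_on UNIV f2"
  using assms unfolding C2_def continuous_on_eq_continuous_at[OF open_UNIV]
  by (auto intro: has_vector_derivative_continuous)

lemma C2_bounded_support:
  "C2 f f1 f2 \<Longrightarrow> bounded_support f \<Longrightarrow> bounded_support f1"
  "C2 f f1 f2 \<Longrightarrow> bounded_support f \<Longrightarrow> bounded_support f2"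
  unfolding C2_def by (meson bounded_support_derivative)+

lemma C2_add: "C2 f f1 f2 \<Longrightarrow> C2 g g1 g2 \<Longrightarrow>
    C2 (\<lambda>s. f s + g s) (\<lambda>s. f1 s + g1 s) (\<lambda>s. f2 s + g2 s)"
  unfolding C2_def by (auto intro!: has_vector_derivative_add continuous_intros)

lemma C2_const: "C2 (\<lambda>_. c) (\<lambda>_. 0) (\<lambda>_. 0)"
  unfolding C2_def by auto

lemma C2_bounded_linear:
  "bounded_linear L \<Longrightarrow> C2 f f1 f2 \<Longrightarrow> C2 (\<lambda>s. L (f s)) (\<lambda>s. L (f1 s)) (\<lambda>s. L (f2 s))"
  unfolding C2_def
  by (auto intro: bounded_linear.has_vector_derivative bounded_linear.continuous_on)

lemma C2_bilinear:
  assumes p: "bounded_bilinear p" and f: "C2 f f1 f2" and g: "C2 g g1 g2"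
  shows "C2 (\<lambda>s. p (f s) (g s)) (\<lambda>s. p (f s) (g1 s) + p (f1 s) (g s))
    (\<lambda>s. (p (f s) (g2 s) + p (f1 s) (g1 s)) + (p (f1 s) (g1 s) + p (f2 s) (g s)))"
  unfolding C2_def
proof (intro conjI allI)
  fix s
  show "((\<lambda>s. p (f s) (g s)) has_vector_derivative p (f s) (g1 s) + p (f1 s) (g s)) (at s)"
    using f g by (auto simp: C2_def intro: bounded_bilinear.has_vector_derivative[OF p])
  show "((\<lambda>s. p (f s) (g1 s) + p (f1 s) (g s)) has_vector_derivative
      (p (f s) (g2 s) + p (f1 s) (g1 s)) + (p (f1 s) (g1 s) + p (f2 s) (g s))) (at s)"
    using f g by (auto simp: C2_def intro!: has_vector_derivative_add bounded_bilinear.has_vector_derivative[OF p])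
  show "continuous_on UNIV (\<lambda>s. (p (f s) (g2 s) + p (f1 s) (g1 s)) + (p (f1 s) (g1 s) + p (f2 s) (g s)))"
    by (intro continuous_intros bounded_bilinear.continuous_on[OF p] C2_continuous[OF f] C2_continuous[OF g])
qed

lemmas C2_scaleR = C2_bilinear[OF bounded_bilinear_scaleR]

lemma C2_ident: "C2 (\<lambda>s. s) (\<lambda>_. 1) (\<lambda>_. 0)"
  unfolding C2_def by (auto intro: has_vector_derivative_id)

lemma C2_affine:
  fixes f :: "real \<Rightarrow> 'a::real_normed_vector"
  assumes f: "C2 f f1 f2"
  shows "C2 (\<lambda>s. f (c * s + d)) (\<lambda>s. c *\<^sub>R f1 (c * s + d)) (\<lambda>s. (c * c) *\<^sub>R f2 (c * s + d))"
proof -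
  have lin: "((\<lambda>s. c * s + d) has_vector_derivative c) (at s)" for s
    by (auto intro!: derivative_eq_intros simp: has_real_derivative_iff_has_vector_derivative[symmetric])
  have *: "((\<lambda>s. g (c * s + d)) has_vector_derivative c *\<^sub>R g1 (c * s + d)) (at s)"
    if "\<And>s. (g has_vector_derivative g1 s) (at s)" for g g1 :: "real \<Rightarrow> 'a" and s
    using vector_diff_chain_at[OF lin that, of s] by (simp add: o_def)
  show ?thesis
    unfolding C2_def
  proof (intro conjI allI)
    fix s
    show "((\<lambda>s. f (c * s + d)) has_vector_derivative c *\<^sub>R f1 (c * s + d)) (at s)"
      using f by (intro *) (simp add: C2_def)
    show "((\<lambda>s. c *\<^sub>R f1 (c * s + d)) has_vector_derivative (c * c) *\<^sub>R f2 (c * s + d)) (at s)"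
      using f bounded_linear.has_vector_derivative[OF bounded_linear_scaleR_right *[of f1 f2 s], of c]
      by (simp add: C2_def)
  qed (intro continuous_intros continuous_on_compose2[OF C2_continuous(3)[OF f]], auto)
qed

text \<open>The only delicate point is 0, where the difference quotient of the positive part to the
  power k + 2 is bounded by |h| to the power k + 1.\<close>

lemma C2_cube_pos: "C2 (\<lambda>x::real. max 0 x ^ 3) (\<lambda>x. 3 * max 0 x ^ 2) (\<lambda>x. 6 * max 0 x)"
proof -
  \<comment> \<open>The instance k = 1 gives the first derivative of the cube, k = 0 the
    second.\<close>
  have *: "((\<lambda>x::real. max 0 x ^ Suc (Suc k)) has_real_derivative real (Suc (Suc k)) * max 0 x ^ Suc k) (at x)" for k x
  proof (cases "x = 0")
    case True
    have "((\<lambda>h::real. (max 0 h ^ Suc (Suc k)) / h) \<longlongrightarrow> 0) (at 0)"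
    proof (rule Lim_null_comparison)
      show "\<forall>\<^sub>F h::real in at 0. norm (max 0 h ^ Suc (Suc k) / h) \<le> \<bar>h\<bar> ^ Suc k"
      proof (intro always_eventually allI)
        fix h :: real
        show "norm (max 0 h ^ Suc (Suc k) / h) \<le> \<bar>h\<bar> ^ Suc k"
          using zero_le_power[OF abs_ge_zero, of h "Suc k"]
          by (cases "h > 0") (simp_all add: max_absorb2 max_absorb1 del: power_Suc,
              simp add: power_Suc)
      qed
      show "((\<lambda>h::real. \<bar>h\<bar> ^ Suc k) \<longlongrightarrow> 0) (at 0)"
        by (auto intro!: tendsto_eq_intros)
    qed
    then show ?thesis unfolding True DERIV_def by simp
  next
    case False
    show ?thesis
    proof (cases "x > 0")
      case True
      show ?thesis
        by (rule has_field_derivative_transform_within_open[of "\<lambda>x. x ^ Suc (Suc k)" _ _ "{0<..}"])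
          (use True DERIV_pow[of "Suc (Suc k)" x] in \<open>auto simp: max_def\<close>)
    next
      case False
      show ?thesis
        by (rule has_field_derivative_transform_within_open[of "\<lambda>x. 0" _ _ "{..<0}"])
          (use False \<open>x \<noteq> 0\<close> in \<open>auto intro!: derivative_eq_intros simp: max_def\<close>)
    qed
  qed
  have "((\<lambda>x::real. 3 * max 0 x ^ 2) has_real_derivative 6 * max 0 x) (at x)" for x
    using DERIV_cmult[OF *[of 0 x], of 3] by (simp add: numeral_2_eq_2 mult.assoc)
  moreover have "((\<lambda>x::real. max 0 x ^ 3) has_real_derivative 3 * max 0 x ^ 2) (at x)" for x
    using *[of 1 x] by (simp add: numeral_2_eq_2 numeral_3_eq_3)
  ultimately show ?thesis
    unfolding C2_def has_real_derivative_iff_has_vector_derivative[symmetric]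
    by (auto intro!: continuous_intros)
qed

text \<open>The antiderivative of the quadratic B-spline with knots 0, 1, 2, 3.\<close>

definition cubic_step :: "real \<Rightarrow> real" where
  "cubic_step x = (max 0 x ^ 3 - 3 * max 0 (x - 1) ^ 3 + 3 * max 0 (x - 2) ^ 3 - max 0 (x - 3) ^ 3) / 6"

lemma cubic_step_eq_0: "x \<le> 0 \<Longrightarrow> cubic_step x = 0"
  by (simp add: cubic_step_def)

lemma cubic_step_eq_1: "x \<ge> 3 \<Longrightarrow> cubic_step x = 1"
  by (simp add: cubic_step_def max_def power3_eq_cube) (simp add: algebra_simps)

lemma ex_C2_cubic_step: "\<exists>f1 f2. C2 cubic_step f1 f2"
proof -
  have cube: "\<exists>f1 f2. C2 (\<lambda>x::real. k * max 0 (x - d) ^ 3) f1 f2" for k d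
    using C2_bounded_linear[OF bounded_linear_mult_right[of k] C2_affine[OF C2_cube_pos, of 1 "-d"]]
    by auto
  have add: "\<exists>f1 f2. C2 (\<lambda>x::real. f x + g x) f1 f2"
    if "\<exists>f1 f2. C2 f f1 f2" "\<exists>f1 f2. C2 g f1 f2" for f g :: "real \<Rightarrow> real"
    using that C2_add by blast
  have eq: "cubic_step = (\<lambda>x. ((1/6) * max 0 (x - 0) ^ 3 + (-1/2) * max 0 (x - 1) ^ 3)
      + ((1/2) * max 0 (x - 2) ^ 3 + (-1/6) * max 0 (x - 3) ^ 3))"
    by (auto simp: cubic_step_def fun_eq_iff field_simps)
  show ?thesis unfolding eq by (intro add cube)
qed

text \<open>The argument 6 + 3 x sweeps the transition interval [0, 3] of \<open>cubic_step\<close>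
  for x in [-2, -1], and 6 - 3 x does so for x in [1, 2].\<close>

definition plateau :: "real \<Rightarrow> real" where
  "plateau x = cubic_step (6 + 3 * x) * cubic_step (6 - 3 * x)"

lemma plateau_eq_1: "\<bar>x\<bar> \<le> 1 \<Longrightarrow> plateau x = 1"
  by (simp add: plateau_def cubic_step_eq_1)

lemma plateau_eq_0: "\<bar>x\<bar> \<ge> 2 \<Longrightarrow> plateau x = 0"
  by (cases "x \<ge> 0") (simp_all add: plateau_def cubic_step_eq_0)

lemma bounded_support_plateau: "bounded_support plateau"
  unfolding bounded_support_def by (rule exI[of _ 2]) (simp add: plateau_eq_0)

lemma ex_C2_plateau: obtains f1 f2 where "C2 plateau f1 f2"
proof -
  obtain g1 g2 where g: "C2 cubic_step g1 g2" using ex_C2_cubic_step by blast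
  show thesis
    using C2_bilinear[OF bounded_bilinear_mult C2_affine[OF g, of 3 6] C2_affine[OF g, of "-3" 6]] that
    by (simp add: plateau_def[abs_def] add.commute)
qed

section \<open>The inverse Fourier transform of compactly supported functions\<close>

definition cc :: "(real \<Rightarrow> 'a::real_normed_vector) \<Rightarrow> bool" where
  "cc f \<longleftrightarrow> continuous_on UNIV f \<and> bounded_support f"

lemma C2_cc:
  assumes "C2 f f1 f2" "bounded_support f"
  shows "cc f" "cc f1" "cc f2"
  using C2_continuous[OF assms(1)] C2_bounded_support[OF assms(1)] assms(2)
  by (auto simp: cc_def)

lemma cc_integrable_on:
  fixes f :: "real \<Rightarrow> 'a::banach"
  assumes "cc f" shows "f integrable_on UNIV"
proof -
  obtain N where N: "\<And>s. \<bar>s\<bar> \<ge> N \<Longrightarrow> f s = 0"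
    using assms unfolding cc_def by (metis bounded_supportE)
  have "f integrable_on {-N..N}"
    using assms continuous_on_subset unfolding cc_def by (blast intro: integrable_continuous_real)
  then show ?thesis
    by (rule integrable_on_superset) (auto intro: N)
qed

lemma cc_integrable:
  fixes f :: "real \<Rightarrow> 'a::euclidean_space"
  assumes "cc f" shows "integrable lborel f"
proof -
  obtain N where N: "\<And>s. \<bar>s\<bar> \<ge> N \<Longrightarrow> f s = 0"
    using assms unfolding cc_def by (metis bounded_supportE)
  have "set_integrable lborel {-N..N} f"
    using assms continuous_on_subset unfolding cc_def
    by (intro borel_integrable_atLeastAtMost') blast
  also have "(\<lambda>s. indicator {-N..N} s *\<^sub>R f s) = f"
    using N by (force simp: fun_eq_iff indicator_def)
  then have "set_integrable lborel {-N..N} f \<longleftrightarrow> integrable lborel f"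
    by (simp add: set_integrable_def)
  finally show ?thesis .
qed

lemma cc_norm: "cc f \<Longrightarrow> cc (\<lambda>s. norm (f s))"
  unfolding cc_def by (auto intro: continuous_on_norm bounded_support_mono)

lemma cc_bounded:
  assumes "cc f" obtains C where "\<And>s. norm (f s) \<le> C" "C \<ge> 0"
proof -
  obtain N where N: "\<And>s. \<bar>s\<bar> \<ge> N \<Longrightarrow> f s = 0"
    using assms unfolding cc_def by (metis bounded_supportE)
  have "compact (f ` {-N..N})"
    using assms continuous_on_subset unfolding cc_def by (blast intro: compact_continuous_image)
  then obtain C where C: "\<And>s. s \<in> {-N..N} \<Longrightarrow> norm (f s) \<le> C"
    using compact_imp_bounded bounded_iff by (metis imageI)
  show thesis
  proof (rule that[of "max C 0"])
    show "norm (f s) \<le> max C 0" for s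
    proof (cases "\<bar>s\<bar> \<ge> N")
      case False
      then have "s \<in> {-N..N}" by auto
      then show ?thesis using C[of s] by simp
    qed (simp add: N)
  qed simp
qed

text \<open>The gauge integral is used because continuous functions of compact support possess it
  with values in any Banach space, operators included. For complex values it is identified with the
  Lebesgue integral in \<open>inv_fourier_complex\<close>.\<close>

definition inv_fourier :: "(real \<Rightarrow> 'a::complex_banach) \<Rightarrow> real \<Rightarrow> 'a" where
  "inv_fourier f t = (1 / (2 * pi)) *\<^sub>R integral UNIV (\<lambda>s. cis (t * s) *\<^sub>C f s)"

lemma cc_cis: "cc f \<Longrightarrow> cc (\<lambda>s. cis (t * s) *\<^sub>C f s)"
  unfolding cc_def
  by (auto intro!: continuous_intros elim: bounded_support_mono simp: scaleC.zero_right)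

lemma inv_fourier_bound:
  assumes f: "cc f" and g: "integrable lborel g" "\<And>s. norm (f s) \<le> g s"
  shows "norm (inv_fourier f t) \<le> (LINT s|lborel. g s)"
proof -
  have gi: "g integrable_on UNIV" "integral UNIV g = (LINT s|lborel. g s)"
    using g(1) by (auto intro: integrable_on_lborel integral_lborel)
  have "norm (integral UNIV (\<lambda>s. cis (t * s) *\<^sub>C f s)) \<le> integral UNIV g"
    by (rule integral_norm_bound_integral[OF cc_integrable_on[OF cc_cis[OF f]] gi(1)])
      (simp add: norm_scaleC g)
  moreover have "norm (inv_fourier f t) \<le> 1 * norm (integral UNIV (\<lambda>s. cis (t * s) *\<^sub>C f s))"
    using pi_ge_two unfolding inv_fourier_def norm_scaleR
    by (intro mult_right_mono) (auto simp: field_simps)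
  ultimately show ?thesis using gi(2) by simp
qed

lemma inv_fourier_add:
  "cc f \<Longrightarrow> cc g \<Longrightarrow> inv_fourier (\<lambda>s. f s + g s) t = inv_fourier f t + inv_fourier g t"
  unfolding inv_fourier_def scaleC_add_right
  by (subst integral_add) (auto intro: cc_integrable_on cc_cis simp: scaleR_add_right)

lemma inv_fourier_linear:
  assumes L: "bounded_linear L" and c: "\<And>c x. L (c *\<^sub>C x) = c *\<^sub>C L x" and f: "cc f"
  shows "inv_fourier (\<lambda>s. L (f s)) t = L (inv_fourier f t)"
  using integral_linear[OF cc_integrable_on[OF cc_cis[OF f]] L, of t]
  by (simp add: inv_fourier_def o_def c bounded_linear.linear[OF L] linear_scale)

lemma cis_has_vector_derivative:
  "((\<lambda>s. cis (t * s)) has_vector_derivative (\<i> * of_real t * cis (t * s))) (at s within S)"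
proof -
  have "((\<lambda>s. cos (t * s)) has_vector_derivative - t * sin (t * s)) (at s within S)"
    "((\<lambda>s. sin (t * s)) has_vector_derivative t * cos (t * s)) (at s within S)"
    unfolding has_real_derivative_iff_has_vector_derivative[symmetric]
    by (auto intro!: derivative_eq_intros)
  then show ?thesis
    by (subst has_vector_derivative_complex_iff) (auto simp: has_real_derivative_iff_has_vector_derivative)
qed

text \<open>Integration by parts: \<open>h\<close> is the derivative of
  \<open>cis (t * s) *\<^sub>C f s\<close>, and its integral over a window that contains the
  supports of \<open>f\<close> and \<open>f1\<close> has no boundary terms.\<close>

lemma inv_fourier_derivative:
  assumes f: "\<And>s. (f has_vector_derivative f1 s) (at s)" "bounded_support f" and f1: "continuous_on UNIV f1"
  shows "(\<i> * of_real t) *\<^sub>C inv_fourier f t = - inv_fourier f1 t"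
proof -
  have cf: "cc f"
    using f by (auto simp: cc_def continuous_on_eq_continuous_at intro: has_vector_derivative_continuous)
  have cf1: "cc f1" using bounded_support_derivative[OF f(2,1)] f1 by (simp add: cc_def)
  define h where "h = (\<lambda>s. cis (t * s) *\<^sub>C f1 s + (\<i> * of_real t * cis (t * s)) *\<^sub>C f s)"
  obtain N where N: "N > 0" "\<And>s. \<bar>s\<bar> \<ge> N \<Longrightarrow> f s = 0" using f(2) by (metis bounded_supportE)
  obtain N1 where N1: "\<And>s. \<bar>s\<bar> \<ge> N1 \<Longrightarrow> f1 s = 0"
    using cf1 unfolding cc_def by (metis bounded_supportE)
  define M where "M = max N N1"
  have "(h has_integral (cis (t * M) *\<^sub>C f M - cis (t * (-M)) *\<^sub>C f (-M))) {-M..M}"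
  proof (rule fundamental_theorem_of_calculus)
    show "- M \<le> M" using N(1) by (simp add: M_def)
    show "((\<lambda>s. cis (t * s) *\<^sub>C f s) has_vector_derivative h s) (at s within {- M..M})" for s
      unfolding h_def
      by (rule has_vector_derivative_scaleC[OF cis_has_vector_derivative has_vector_derivative_at_within[OF f(1)]])
  qed
  moreover have "f M = 0" "f (-M) = 0" using N by (auto simp: M_def)
  ultimately have "(h has_integral 0) {-M..M}" by (simp add: scaleC.zero_right)
  then have "(h has_integral 0) UNIV"
    by (rule has_integral_on_superset) (use N(2) N1 in \<open>force simp: h_def M_def scaleC.zero_right\<close>)+
  then have "integral UNIV h = 0" by (rule integral_unique)
  moreover have "integral UNIV h = integral UNIV (\<lambda>s. cis (t * s) *\<^sub>C f1 s)
      + integral UNIV (\<lambda>s. (\<i> * of_real t) *\<^sub>C (cis (t * s) *\<^sub>C f s))"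
    unfolding h_def
    using cc_integrable_on[OF cc_cis[OF cf1]]
      integrable_linear[OF cc_integrable_on[OF cc_cis[OF cf]] scaleC.bounded_linear_right[of "\<i> * of_real t"]]
    by (subst integral_add) (auto simp: o_def scaleC_scaleC)
  moreover have "integral UNIV (\<lambda>s. (\<i> * of_real t) *\<^sub>C (cis (t * s) *\<^sub>C f s))
      = (\<i> * of_real t) *\<^sub>C integral UNIV (\<lambda>s. cis (t * s) *\<^sub>C f s)"
    using integral_linear[OF cc_integrable_on[OF cc_cis[OF cf]] scaleC.bounded_linear_right[of "\<i> * of_real t"]]
    by (simp add: o_def)
  ultimately show ?thesis
    by (simp add: inv_fourier_def scaleC_scaleR_commute add_eq_0_iff2 scaleR_minus_right[symmetric] del: scaleR_minus_right)
qed

lemma inv_fourier_second_derivative: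
  assumes f: "C2 f f1 f2" "bounded_support f"
  shows "t\<^sup>2 *\<^sub>R inv_fourier f t = - inv_fourier f2 t"
proof -
  have "(\<i> * of_real t) *\<^sub>C (\<i> * of_real t) *\<^sub>C inv_fourier f t = (\<i> * of_real t) *\<^sub>C (- inv_fourier f1 t)"
    using f C2_continuous[OF f(1)] by (subst inv_fourier_derivative) (auto simp: C2_def)
  also have "\<dots> = inv_fourier f2 t"
    using f C2_continuous[OF f(1)] C2_bounded_support[OF f]
    by (simp only: scaleC.minus_right) (subst inv_fourier_derivative, auto simp: C2_def)
  also have "(\<i> * of_real t) *\<^sub>C (\<i> * of_real t) *\<^sub>C inv_fourier f t = of_real (- t\<^sup>2) *\<^sub>C inv_fourier f t"
    unfolding scaleC_scaleC by (simp add: power2_eq_square mult_ac)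
  finally show ?thesis unfolding scaleC_of_real by (metis add.inverse_inverse scaleR_minus_left)
qed

text \<open>The bound for small t comes from the integral of |f|, the one for large t from that of
  |f2| through two integrations by parts. This rate makes the transform integrable and is why class
  C2 is the working class.\<close>

lemma inv_fourier_decay:
  assumes f: "C2 f f1 f2" "bounded_support f"
  obtains C where "C \<ge> 0" "\<And>t. norm (inv_fourier f t) \<le> C / (1 + t\<^sup>2)"
proof -
  define C where "C = (LINT s|lborel. norm (f s)) + (LINT s|lborel. norm (f2 s))"
  note cc = C2_cc[OF f]
  have "(1 + t\<^sup>2) * norm (inv_fourier f t) \<le> C" for t
  proof -
    have "t\<^sup>2 * norm (inv_fourier f t) = norm (inv_fourier f2 t)"
      using inv_fourier_second_derivative[OF f, of t]
      by (metis abs_of_nonneg norm_minus_cancel norm_scaleR zero_le_power2)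
    then show ?thesis
      using inv_fourier_bound[OF cc(1) cc_integrable[OF cc_norm[OF cc(1)]] order_refl, of t]
        inv_fourier_bound[OF cc(3) cc_integrable[OF cc_norm[OF cc(3)]] order_refl, of t]
      by (simp add: C_def algebra_simps)
  qed
  moreover have "1 + t\<^sup>2 > 0" for t :: real using zero_le_power2[of t] by linarith
  ultimately have "norm (inv_fourier f t) \<le> C / (1 + t\<^sup>2)" for t
    by (simp add: pos_le_divide_eq mult.commute)
  moreover have "C \<ge> 0" by (simp add: C_def)
  ultimately show thesis using that by blast
qed

text \<open>Differentiation under the integral sign over a fixed window outside of which the symbol
  vanishes. The new symbol i s f(s) is written with a real factor s, so that the real product rule
  shows it to be of class C2 again.\<close>

lemma inv_fourier_has_vector_derivative:
  assumes f: "cc f"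
  shows "(inv_fourier f has_vector_derivative inv_fourier (\<lambda>s. s *\<^sub>R (\<i> *\<^sub>C f s)) t) (at t)"
proof -
  obtain N where N: "N > 0" "\<And>s. \<bar>s\<bar> \<ge> N \<Longrightarrow> f s = 0"
    using f unfolding cc_def by (metis bounded_supportE)
  have restr: "integral UNIV (\<lambda>s. cis (t * s) *\<^sub>C g s) = integral {-N..N} (\<lambda>s. cis (t * s) *\<^sub>C g s)"
    if "\<And>s. \<bar>s\<bar> \<ge> N \<Longrightarrow> g s = 0" for t and g :: "real \<Rightarrow> 'a"
  proof -
    have "(\<lambda>s. cis (t * s) *\<^sub>C g s) = (\<lambda>s. if s \<in> {-N..N} then cis (t * s) *\<^sub>C g s else 0)"
      using that by (auto simp: fun_eq_iff scaleC.zero_right)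
    then show ?thesis
      using Henstock_Kurzweil_Integration.integral_restrict_UNIV[of "{-N..N}" "\<lambda>s. cis (t * s) *\<^sub>C g s"]
      by simp
  qed
  have "((\<lambda>t. integral (cbox (-N) N) (\<lambda>s. cis (t * s) *\<^sub>C f s)) has_vector_derivative
      integral (cbox (-N) N) (\<lambda>s. cis (t * s) *\<^sub>C (s *\<^sub>R (\<i> *\<^sub>C f s)))) (at t within UNIV)"
  proof (rule leibniz_rule_vector_derivative)
    show "((\<lambda>t. cis (t * s) *\<^sub>C f s) has_vector_derivative cis (t * s) *\<^sub>C (s *\<^sub>R (\<i> *\<^sub>C f s))) (at t within UNIV)"
      for t s
    proof -
      have "((\<lambda>t. cis (t * s)) has_vector_derivative \<i> * of_real s * cis (t * s)) (at t)"
        using cis_has_vector_derivative[of s t UNIV] by (simp add: mult.commute)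
      from has_vector_derivative_scaleC[OF this has_vector_derivative_const[of "f s"]]
      show ?thesis
        by (simp add: scaleC.zero_right scaleC_of_real[symmetric] scaleC_scaleC mult_ac)
    qed
    show "(\<lambda>s. cis (t * s) *\<^sub>C f s) integrable_on cbox (- N) N" for t
      by (rule integrable_on_subcbox[OF cc_integrable_on[OF cc_cis[OF f]] subset_UNIV])
    have "continuous_on UNIV f" using f by (simp add: cc_def)
    then have [continuous_intros]: "continuous_on (UNIV \<times> cbox (- N) N) (\<lambda>z :: real \<times> real. f (snd z))"
      by (rule continuous_on_compose2[OF _ continuous_on_snd[OF continuous_on_id]]) auto
    show "continuous_on (UNIV \<times> cbox (- N) N) (\<lambda>(t, s). cis (t * s) *\<^sub>C (s *\<^sub>R (\<i> *\<^sub>C f s)))"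
      unfolding split_beta by (intro continuous_intros)
  qed auto
  then have "((\<lambda>t. (1 / (2 * pi)) *\<^sub>R integral {-N..N} (\<lambda>s. cis (t * s) *\<^sub>C f s)) has_vector_derivative
      (1 / (2 * pi)) *\<^sub>R integral {-N..N} (\<lambda>s. cis (t * s) *\<^sub>C (s *\<^sub>R (\<i> *\<^sub>C f s)))) (at t)"
    by (intro bounded_linear.has_vector_derivative[OF bounded_linear_scaleR_right]) simp
  moreover have "inv_fourier f = (\<lambda>t. (1 / (2 * pi)) *\<^sub>R integral {-N..N} (\<lambda>s. cis (t * s) *\<^sub>C f s))"
    by (simp add: fun_eq_iff inv_fourier_def restr N)
  moreover have "inv_fourier (\<lambda>s. s *\<^sub>R (\<i> *\<^sub>C f s)) t
      = (1 / (2 * pi)) *\<^sub>R integral {-N..N} (\<lambda>s. cis (t * s) *\<^sub>C (s *\<^sub>R (\<i> *\<^sub>C f s)))"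
    unfolding inv_fourier_def by (subst restr) (auto simp: N scaleC.zero_right)
  ultimately show ?thesis
    by simp
qed

lemma continuous_inv_fourier: "cc f \<Longrightarrow> continuous_on UNIV (inv_fourier f)"
  unfolding continuous_on_eq_continuous_at[OF open_UNIV]
  using inv_fourier_has_vector_derivative has_vector_derivative_continuous by blast

lemma C2_times_ident:
  assumes f: "C2 f f1 f2" "bounded_support f"
  obtains g1 g2 where "C2 (\<lambda>s. s *\<^sub>R (\<i> *\<^sub>C f s)) g1 g2" "bounded_support (\<lambda>s. s *\<^sub>R (\<i> *\<^sub>C f s))"
proof -
  note C2_scaleR[OF C2_ident C2_bounded_linear[OF scaleC.bounded_linear_right f(1)], of \<i>]
  moreover have "bounded_support (\<lambda>s. s *\<^sub>R (\<i> *\<^sub>C f s))"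
    using f(2) by (rule bounded_support_mono) (simp add: scaleC.zero_right)
  ultimately show thesis using that by blast
qed

section \<open>Scalar integrals\<close>

lemma integrable_inverse_one_plus_square: "integrable lborel (\<lambda>x::real. 1 / (1 + x\<^sup>2))"
  using integrable_inverse_1_plus_square
  by (simp add: set_integrable_def einterval_def inverse_eq_divide)

lemma integrable_bound_inverse_square:
  fixes f :: "real \<Rightarrow> 'a::{banach, second_countable_topology}"
  assumes "f \<in> borel_measurable borel" "\<And>x. norm (f x) \<le> C / (1 + x\<^sup>2)"
  shows "integrable lborel f"
proof (rule Bochner_Integration.integrable_bound)
  show "integrable lborel (\<lambda>x::real. C * (1 / (1 + x\<^sup>2)))"
    by (rule integrable_mult_right[OF integrable_inverse_one_plus_square])
  show "AE x in lborel. norm (f x) \<le> norm (C * (1 / (1 + x\<^sup>2)))"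
    by (intro AE_I2 order_trans[OF assms(2)])
      (simp add: abs_mult abs_of_nonneg[of "1 + _\<^sup>2"] divide_right_mono)
qed (use assms in auto)

lemma lborel_integral_shift:
  fixes f :: "real \<Rightarrow> 'a::{banach, second_countable_topology}"
  shows "(LINT x|lborel. f (t - x)) = (LINT x|lborel. f x)"
    "(LINT x|lborel. f (x + t)) = (LINT x|lborel. f x)"
  using lborel_integral_real_affine[of "-1" f t] lborel_integral_real_affine[of "1" f t]
  by (simp_all add: add.commute)

lemma lborel_integrable_shift:
  fixes f :: "real \<Rightarrow> 'a::{banach, second_countable_topology}"
  assumes "integrable lborel f"
  shows "integrable lborel (\<lambda>x. f (t - x))" "integrable lborel (\<lambda>x. f (x + t))"
  using lborel_integrable_real_affine[OF assms, of "-1" t] lborel_integrable_real_affine[OF assms, of "1" t]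
  by (simp_all add: add.commute)

text \<open>The shift c lets one majorant serve both kinds of double integral: c = 0 for products
  and c = 1 for convolutions. By translation invariance the inner integral of the majorant depends
  on x only through p.\<close>

lemma fubini_dominated:
  fixes w :: "real \<Rightarrow> real \<Rightarrow> 'c::{banach, second_countable_topology}"
  assumes w: "case_prod w \<in> borel_measurable (lborel \<Otimes>\<^sub>M lborel)"
    and p: "integrable lborel p" and q: "integrable lborel q"
    and le: "\<And>x y. norm (w x y) \<le> p x * q (y - c * x)"
  shows "integrable (lborel \<Otimes>\<^sub>M lborel) (case_prod w)"
proof (rule Bochner_Integration.integrable_bound)
  have [measurable]: "p \<in> borel_measurable borel" "q \<in> borel_measurable borel"
    using p q by auto
  have q': "integrable lborel (\<lambda>y. norm (q (y - c * x)))" for x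
    using integrable_norm[OF lborel_integrable_shift(2)[OF q, of "- c * x"]] by simp
  have *: "(\<lambda>y. norm (p x * q (y - c * x))) = (\<lambda>y. norm (p x) * norm (q (y - c * x)))" for x
    by (simp add: abs_mult)
  have eq: "(LINT y|lborel. norm (p x * q (y - c * x))) = norm (p x) * (LINT y|lborel. norm (q y))" for x
    unfolding * using lborel_integral_shift(2)[of "\<lambda>y. norm (q y)" "- c * x"] by simp
  show "integrable (lborel \<Otimes>\<^sub>M lborel) (\<lambda>(x, y). p x * q (y - c * x))"
  proof (rule lborel_pair.Fubini_integrable)
    show "integrable lborel (\<lambda>x. LINT y|lborel. norm (case (x, y) of (x, y) \<Rightarrow> p x * q (y - c * x)))"
      using p unfolding prod.case eq by simp
    have "integrable lborel (\<lambda>y. p x * q (y - c * x))" for x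
      using lborel_integrable_shift(2)[OF q, of "- c * x"] by simp
    then show "AE x in lborel. integrable lborel (\<lambda>y. case (x, y) of (x, y) \<Rightarrow> p x * q (y - c * x))"
      by simp
  qed measurable
  show "AE z in lborel \<Otimes>\<^sub>M lborel. norm (case_prod w z) \<le> norm (case z of (x, y) \<Rightarrow> p x * q (y - c * x))"
    using le by (intro AE_I2) (auto simp: split_beta intro: order_trans[OF _ abs_ge_self])
qed (rule w)

lemma fubini_dominated_swap:
  fixes w :: "real \<Rightarrow> real \<Rightarrow> 'c::{banach, second_countable_topology}"
  assumes "case_prod w \<in> borel_measurable (lborel \<Otimes>\<^sub>M lborel)"
    and "integrable lborel p" and "integrable lborel q"
    and "\<And>x y. norm (w x y) \<le> p x * q (y - c * x)"
  shows "(LINT x|lborel. LINT y|lborel. w x y) = (LINT y|lborel. LINT x|lborel. w x y)"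
  using lborel_pair.Fubini_integral[OF fubini_dominated[OF assms]] by simp

section \<open>Fourier inversion\<close>

lemma inv_fourier_complex:
  fixes g :: "real \<Rightarrow> complex"
  assumes "cc g"
  shows "inv_fourier g t = (1 / (2 * pi)) *\<^sub>R (LINT s|lborel. cis (t * s) * g s)"
  using integral_lborel[OF cc_integrable[OF cc_cis[OF assms, of t]]]
  by (simp add: inv_fourier_def scaleC_complex_def)

lemma integrable_inv_fourier:
  fixes g :: "real \<Rightarrow> complex"
  assumes "C2 g g1 g2" "bounded_support g"
  shows "integrable lborel (inv_fourier g)"
proof -
  obtain C where C: "\<And>t. norm (inv_fourier g t) \<le> C / (1 + t\<^sup>2)"
    using inv_fourier_decay[OF assms] by blast
  show ?thesis
    by (rule integrable_bound_inverse_square[OF _ C])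
      (intro borel_measurable_continuous_onI continuous_inv_fourier C2_cc[OF assms])
qed

lemma integral_cis_gaussian:
  "(LINT x|lborel. std_normal_density x *\<^sub>R cis (y * x)) = of_real (exp (- y\<^sup>2 / 2))"
proof -
  have "char std_normal_distribution y = of_real (exp (- y\<^sup>2 / 2))"
    by (simp add: char_std_normal_distribution)
  then show ?thesis
    unfolding char_def by (subst (asm) integral_density) (auto simp: cis_conv_exp mult.commute)
qed

lemma integrable_std_normal: "integrable lborel std_normal_density" "(LINT x|lborel. std_normal_density x) = 1"
  using integrable_std_normal_moment[of 0] integral_std_normal_moment_even[of 0] by simp_all

text \<open>Gaussian summation: a damped integral can be interchanged with the integral that defines
  the inverse transform, and what results is the average of \<open>g\<close> over a narrow Gaussian
  around \<xi>.\<close>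

theorem fourier_inversion:
  fixes g :: "real \<Rightarrow> complex"
  assumes g: "C2 g g1 g2" "bounded_support g"
  shows "(LINT t|lborel. inv_fourier g t * cis (- (\<xi> * t))) = g \<xi>"
proof -
  define e :: "nat \<Rightarrow> real" where "e n = 1 / real (Suc n)" for n
  have e: "e n > 0" for n by (simp add: e_def)
  have e_lim: "e \<longlonglongrightarrow> 0" unfolding e_def using LIMSEQ_inverse_real_of_nat by (simp add: inverse_eq_divide)
  note cc = C2_cc[OF g]
  have [measurable]: "g \<in> borel_measurable borel" "inv_fourier g \<in> borel_measurable borel"
    using C2_continuous[OF g(1)] continuous_inv_fourier[OF cc(1)]
    by (auto intro: borel_measurable_continuous_onI)
  have [measurable]: "cis \<in> borel_measurable borel"
    by (intro borel_measurable_continuous_onI continuous_intros)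
  have igs: "integrable lborel (\<lambda>s. norm (g s))" by (rule integrable_norm[OF cc_integrable[OF cc(1)]])
  \<comment> \<open>The inversion integral damped by a Gaussian of width 1 / \<open>e n\<close>. Its
    limit is found twice, by dominated convergence as it stands and after the interchange of
    integrals.\<close>
  let ?A = "\<lambda>n. LINT t|lborel. inv_fourier g t * cis (- (\<xi> * t)) * of_real (exp (- (e n * t)\<^sup>2 / 2))"
  have "?A \<longlonglongrightarrow> (LINT t|lborel. inv_fourier g t * cis (- (\<xi> * t)) * of_real 1)"
  proof (rule integral_dominated_convergence[where w = "\<lambda>t. norm (inv_fourier g t)"])
    show "AE t in lborel. (\<lambda>n. inv_fourier g t * cis (- (\<xi> * t)) * of_real (exp (- (e n * t)\<^sup>2 / 2)))
        \<longlonglongrightarrow> inv_fourier g t * cis (- (\<xi> * t)) * of_real 1"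
    proof (intro AE_I2 tendsto_mult tendsto_const tendsto_of_real)
      fix t
      have "(\<lambda>n. exp (- (e n * t)\<^sup>2 / 2)) \<longlonglongrightarrow> exp (- (0 * t)\<^sup>2 / 2)"
        by (intro tendsto_intros e_lim) simp
      then show "(\<lambda>n. exp (- (e n * t)\<^sup>2 / 2)) \<longlonglongrightarrow> 1" by simp
    qed
  qed (use integrable_inv_fourier[OF g] in \<open>auto simp: norm_mult mult_left_le\<close>)
  moreover have "?A n = (LINT x|lborel. std_normal_density x *\<^sub>R g (\<xi> + e n * x))" for n
  proof -
    let ?k = "\<lambda>t. of_real (exp (- (e n * t)\<^sup>2 / 2)) :: complex"
    have rearrange: "r *\<^sub>R (x * y * z * u) = (r *\<^sub>R y) * ((x * z) * u)" for r and x y z u :: complex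
      by (simp add: mult_ac)
    have gauss: "of_real (exp (- (e n * t)\<^sup>2 / 2)) = (sqrt (2 * pi) *\<^sub>R of_real (std_normal_density (e n * t)) :: complex)" for t
      by (simp add: std_normal_density_def scaleR_conv_of_real)
    have ie: "integrable lborel (\<lambda>t. exp (- (e n * t)\<^sup>2 / 2))"
    proof -
      have "integrable lborel (\<lambda>t. sqrt (2 * pi) * std_normal_density (0 + e n * t))"
        using e[of n] by (intro integrable_mult_right lborel_integrable_real_affine integrable_std_normal) auto
      then show ?thesis by (simp add: std_normal_density_def)
    qed
    have "?A n = (LINT t|lborel. LINT s|lborel. (1 / (2 * pi)) *\<^sub>R (cis (t * s) * g s * cis (- (\<xi> * t)) * ?k t))"
      by (intro Bochner_Integration.integral_cong refl)
        (simp add: inv_fourier_complex[OF cc(1)])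
    also have "\<dots> = (LINT s|lborel. LINT t|lborel. (1 / (2 * pi)) *\<^sub>R (cis (t * s) * g s * cis (- (\<xi> * t)) * ?k t))"
    proof (rule fubini_dominated_swap[OF _ ie igs, where c = 0])
      show "norm ((1 / (2 * pi)) *\<^sub>R (cis (t * s) * g s * cis (- (\<xi> * t)) * ?k t))
          \<le> exp (- (e n * t)\<^sup>2 / 2) * norm (g (s - 0 * t))" for t s
      proof -
        have "1 / (2 * pi) * (norm (g s) * exp (- (e n * t)\<^sup>2 / 2)) \<le> 1 * (norm (g s) * exp (- (e n * t)\<^sup>2 / 2))"
          using pi_ge_two by (intro mult_right_mono) auto
        then show ?thesis by (simp add: norm_mult mult_ac)
      qed
    qed measurable
    also have "\<dots> = (LINT s|lborel. (std_normal_density ((s - \<xi>) / e n) / e n) *\<^sub>R g s)"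
    proof (intro Bochner_Integration.integral_cong refl)
      fix s
      have "(LINT t|lborel. (1 / (2 * pi)) *\<^sub>R (cis (t * s) * g s * cis (- (\<xi> * t)) * ?k t))
          = (LINT t|lborel. ((1 / (2 * pi)) *\<^sub>R g s) * (cis (t * (s - \<xi>)) * ?k t))"
      proof (intro Bochner_Integration.integral_cong refl)
        fix t
        have "cis (t * s) * cis (- (\<xi> * t)) = cis (t * (s - \<xi>))"
          by (simp add: cis_mult algebra_simps)
        then show "(1 / (2 * pi)) *\<^sub>R (cis (t * s) * g s * cis (- (\<xi> * t)) * ?k t)
            = ((1 / (2 * pi)) *\<^sub>R g s) * (cis (t * (s - \<xi>)) * ?k t)"
          unfolding rearrange by simp
      qed
      also have "\<dots> = ((1 / (2 * pi)) *\<^sub>R g s) * (LINT t|lborel. cis (t * (s - \<xi>)) * ?k t)"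
        by simp
      \<comment> \<open>After rescaling to the standard normal density this is its characteristic
        function at (s - \<xi>) / \<open>e n\<close>, again a Gaussian.\<close>
      also have "(LINT t|lborel. cis (t * (s - \<xi>)) * ?k t) =
          (LINT t|lborel. sqrt (2 * pi) *\<^sub>R (std_normal_density (e n * t) *\<^sub>R cis ((s - \<xi>) / e n * (e n * t))))"
        using e[of n] unfolding gauss
        by (intro Bochner_Integration.integral_cong refl) (simp add: scaleR_conv_of_real mult_ac)
      also have "\<dots> = sqrt (2 * pi) *\<^sub>R ((1 / e n) *\<^sub>R (LINT t|lborel. std_normal_density t *\<^sub>R cis ((s - \<xi>) / e n * t)))"
        using lborel_integral_real_affine[of "e n" "\<lambda>t. std_normal_density t *\<^sub>R cis ((s - \<xi>) / e n * t)" 0] e[of n]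
        by (simp flip: integral_scaleR_right)
      also have "\<dots> = sqrt (2 * pi) *\<^sub>R ((1 / e n) *\<^sub>R of_real (sqrt (2 * pi) * std_normal_density ((s - \<xi>) / e n)))"
        unfolding integral_cis_gaussian by (simp add: std_normal_density_def)
      also have "\<dots> = of_real (2 * pi * (std_normal_density ((s - \<xi>) / e n) / e n))"
      proof -
        have "sqrt (2 * pi) * (1 / e n * (sqrt (2 * pi) * N)) = (sqrt (2 * pi))\<^sup>2 * (N / e n)" for N
          by (simp only: power2_eq_square) simp
        then show ?thesis by (simp add: scaleR_conv_of_real flip: of_real_mult)
      qed
      finally show "(LINT t|lborel. (1 / (2 * pi)) *\<^sub>R (cis (t * s) * g s * cis (- (\<xi> * t)) * ?k t))
        = (std_normal_density ((s - \<xi>) / e n) / e n) *\<^sub>R g s"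
        by (simp only: scaleR_conv_of_real of_real_mult of_real_divide) simp
    qed
    also have "\<dots> = (LINT x|lborel. std_normal_density x *\<^sub>R g (\<xi> + e n * x))"
      using lborel_integral_real_affine[of "e n" "\<lambda>s. (std_normal_density ((s - \<xi>) / e n) / e n) *\<^sub>R g s" \<xi>] e[of n]
      by (simp flip: integral_scaleR_right)
    finally show ?thesis .
  qed
  moreover have "(\<lambda>n. LINT x|lborel. std_normal_density x *\<^sub>R g (\<xi> + e n * x))
      \<longlonglongrightarrow> (LINT x|lborel. std_normal_density x *\<^sub>R g \<xi>)"
  proof -
    obtain C where C: "\<And>s. norm (g s) \<le> C" using cc_bounded[OF cc(1)] by metis
    show ?thesis
    proof (rule integral_dominated_convergence[where w = "\<lambda>x. std_normal_density x * C"])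
      show "AE x in lborel. (\<lambda>n. std_normal_density x *\<^sub>R g (\<xi> + e n * x)) \<longlonglongrightarrow> std_normal_density x *\<^sub>R g \<xi>"
      proof (intro AE_I2 tendsto_scaleR tendsto_const)
        fix x
        have "(\<lambda>n. \<xi> + e n * x) \<longlonglongrightarrow> \<xi> + 0 * x" by (intro tendsto_intros e_lim)
        then show "(\<lambda>n. g (\<xi> + e n * x)) \<longlonglongrightarrow> g \<xi>"
          using continuous_on_tendsto_compose[OF C2_continuous(1)[OF g(1)], of _ \<xi>] by simp
      qed
    qed (use C in \<open>auto simp: normal_density_nonneg intro!: mult_left_mono integrable_std_normal integrable_mult_left\<close>)
  qed
  moreover have "(LINT x|lborel. std_normal_density x *\<^sub>R g \<xi>) = g \<xi>"
    using integrable_std_normal by (simp add: integral_scaleR_left)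
  ultimately show ?thesis using LIMSEQ_unique by simp
qed


section \<open>Convolution with bounded scalar functions\<close>

lemma scalar_convolution_assoc:
  fixes f g \<phi> :: "real \<Rightarrow> complex"
  assumes f: "integrable lborel f" and g: "integrable lborel g"
    and \<phi>: "\<phi> \<in> borel_measurable borel" "\<And>s. norm (\<phi> s) \<le> M"
  shows "(LINT r|lborel. f r * (LINT s|lborel. g s * \<phi> (t - r - s)))
       = (LINT q|lborel. (LINT r|lborel. f r * g (q - r)) * \<phi> (t - q))"
proof -
  note [measurable] = borel_measurable_integrable[OF f] borel_measurable_integrable[OF g] \<phi>(1)
  have "(LINT r|lborel. f r * (LINT s|lborel. g s * \<phi> (t - r - s)))
      = (LINT r|lborel. LINT q|lborel. f r * g (q - r) * \<phi> (t - q))"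
  proof (intro Bochner_Integration.integral_cong refl)
    fix r
    have "(LINT s|lborel. g s * \<phi> (t - r - s)) = (LINT q|lborel. g (q - r) * \<phi> (t - q))"
      using lborel_integral_shift(2)[of "\<lambda>s. g s * \<phi> (t - r - s)" "- r"] by simp
    then show "f r * (LINT s|lborel. g s * \<phi> (t - r - s)) = (LINT q|lborel. f r * g (q - r) * \<phi> (t - q))"
      by (simp add: mult.assoc)
  qed
  also have "\<dots> = (LINT q|lborel. LINT r|lborel. f r * g (q - r) * \<phi> (t - q))"
  proof (rule fubini_dominated_swap[where c = 1])
    show "integrable lborel (\<lambda>r. M * norm (f r))" "integrable lborel (\<lambda>r. norm (g r))"
      using f g by auto
    show "norm (f r * g (q - r) * \<phi> (t - q)) \<le> M * norm (f r) * norm (g (q - 1 * r))" for r q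
      using mult_left_mono[OF \<phi>(2)[of "t - q"], of "norm (f r) * norm (g (q - r))"]
      by (simp add: norm_mult mult_ac)
  qed measurable
  also have "\<dots> = (LINT q|lborel. (LINT r|lborel. f r * g (q - r)) * \<phi> (t - q))"
    by simp
  finally show ?thesis .
qed

lemma integrable_scalar_convolution:
  fixes f g :: "real \<Rightarrow> complex"
  assumes f: "integrable lborel f" and g: "integrable lborel g"
  shows "integrable lborel (\<lambda>q. LINT r|lborel. f r * g (q - r))"
proof (rule lborel_pair.integrable_snd)
  note [measurable] = borel_measurable_integrable[OF f] borel_measurable_integrable[OF g]
  show "integrable (lborel \<Otimes>\<^sub>M lborel) (\<lambda>(r, q). f r * g (q - r))"
    by (rule fubini_dominated[OF _ integrable_norm[OF f] integrable_norm[OF g], where c = 1])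
      (auto simp: norm_mult)
qed

lemma scalar_convolution_commute:
  fixes f g :: "real \<Rightarrow> complex"
  shows "(LINT r|lborel. f r * g (q - r)) = (LINT r|lborel. g r * f (q - r))"
  using lborel_integral_shift(1)[of "\<lambda>r. f r * g (q - r)" q] by (simp add: mult.commute)

text \<open>If \<open>f * \<phi> = 0\<close> and \<open>v\<close> reproduces \<open>\<psi> = k * \<phi>\<close>, then \<open>c \<psi> = (c v - f * v) * \<psi>\<close>;
  so \<open>\<psi>\<close> vanishes once the \<open>L\<^sup>1\<close>-norm of \<open>c v - f * v\<close> is below \<open>|c|\<close>.\<close>

lemma convolution_vanishes_if_reproduced:
  fixes f k v \<phi> :: "real \<Rightarrow> complex"
  assumes f: "integrable lborel f" and k: "integrable lborel k" and v: "integrable lborel v"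
    and \<phi>: "\<phi> \<in> borel_measurable borel" "\<And>s. norm (\<phi> s) \<le> M"
    and zero: "\<And>t. (LINT s|lborel. f s * \<phi> (t - s)) = 0"
    and repr: "\<And>t. (LINT r|lborel. v r * k (t - r)) = k t"
    and small: "(LINT q|lborel. norm ((LINT r|lborel. f r * v (q - r)) - c * v q)) < norm c"
  shows "(LINT s|lborel. k s * \<phi> (t - s)) = 0"
proof -
  note [measurable] = borel_measurable_integrable[OF f] borel_measurable_integrable[OF k]
    borel_measurable_integrable[OF v] \<phi>(1)
  define \<psi> where "\<psi> t = (LINT s|lborel. k s * \<phi> (t - s))" for t
  have \<psi>_meas[measurable]: "\<psi> \<in> borel_measurable borel" unfolding \<psi>_def by measurable
  define B where "B = (LINT s|lborel. norm (k s)) * M"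
  have \<psi>_bound: "norm (\<psi> t) \<le> B" for t
  proof -
    have i: "integrable lborel (\<lambda>s. norm (k s) * M)" using k by auto
    have le: "norm (k s * \<phi> (t - s)) \<le> norm (k s) * M" for s
      unfolding norm_mult by (intro mult_left_mono \<phi>) auto
    have "integrable lborel (\<lambda>s. k s * \<phi> (t - s))"
      by (rule Bochner_Integration.integrable_bound[OF i]) (use le in \<open>auto intro: order_trans[OF _ abs_ge_self]\<close>)
    then have "norm (\<psi> t) \<le> (LINT s|lborel. norm (k s) * M)"
      unfolding \<psi>_def using le by (intro Bochner_Integration.integral_norm_bound_integral i) auto
    then show ?thesis by (simp add: B_def)
  qed
  have v\<psi>: "(LINT r|lborel. v r * \<psi> (t - r)) = \<psi> t" for t
    unfolding \<psi>_def using scalar_convolution_assoc[OF v k \<phi>, of t] by (simp add: repr)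
  \<comment> \<open>By associativity and commutativity f * (k * \<phi>) = k * (f * \<phi>), and the
    inner convolution is 0.\<close>
  have f\<psi>: "(LINT r|lborel. f r * \<psi> (t - r)) = 0" for t
  proof -
    have "(LINT r|lborel. f r * \<psi> (t - r)) = (LINT q|lborel. (LINT r|lborel. k r * f (q - r)) * \<phi> (t - q))"
      unfolding \<psi>_def scalar_convolution_assoc[OF f k \<phi>] scalar_convolution_commute[of f k] ..
    also have "\<dots> = 0"
      unfolding scalar_convolution_assoc[OF k f \<phi>, symmetric] by (simp add: zero)
    finally show ?thesis .
  qed
  define d where "d q = (LINT r|lborel. f r * v (q - r)) - c * v q" for q
  have d: "integrable lborel d"
    unfolding d_def using integrable_scalar_convolution[OF f v] v by auto
  note [measurable] = borel_measurable_integrable[OF d]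
  have prod_int: "integrable lborel (\<lambda>q. h q * \<psi> (t - q))" if "integrable lborel h" for h t
    by (rule Bochner_Integration.integrable_bound[OF integrable_mult_right[OF integrable_norm[OF that], of B]])
      (use \<psi>_bound borel_measurable_integrable[OF that] in
        \<open>auto simp: norm_mult mult.commute[of B] intro!: order_trans[OF mult_left_mono[OF \<psi>_bound] abs_ge_self]\<close>)
  have key: "norm c * norm (\<psi> t) \<le> (LINT q|lborel. norm (d q)) * S" if S: "\<And>t. norm (\<psi> t) \<le> S" for t S
  proof -
    have "(LINT q|lborel. (LINT r|lborel. f r * v (q - r)) * \<psi> (t - q)) = 0"
      unfolding scalar_convolution_assoc[OF f v \<psi>_meas \<psi>_bound, symmetric] v\<psi> by (rule f\<psi>)
    moreover have "(LINT q|lborel. c * v q * \<psi> (t - q)) = c * \<psi> t"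
      by (simp add: mult.assoc v\<psi>)
    moreover have "(LINT q|lborel. d q * \<psi> (t - q)) =
        (LINT q|lborel. (LINT r|lborel. f r * v (q - r)) * \<psi> (t - q)) - (LINT q|lborel. c * v q * \<psi> (t - q))"
      unfolding d_def left_diff_distrib
      by (intro Bochner_Integration.integral_diff prod_int integrable_scalar_convolution f v integrable_mult_right)
    ultimately have "c * \<psi> t = - (LINT q|lborel. d q * \<psi> (t - q))" by simp
    then have "norm c * norm (\<psi> t) = norm (LINT q|lborel. d q * \<psi> (t - q))"
      by (metis norm_minus_cancel norm_mult)
    also have "\<dots> \<le> (LINT q|lborel. norm (d q) * S)"
      by (rule Bochner_Integration.integral_norm_bound_integral[OF prod_int[OF d]])
        (use d S in \<open>auto simp: norm_mult intro: mult_left_mono\<close>)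
    finally show ?thesis by simp
  qed
  \<comment> \<open>Feeding the supremum itself into \<open>key\<close> bounds it by itself times a
    factor below 1, so it cannot be positive.\<close>
  define S where "S = (SUP t. norm (\<psi> t))"
  have bdd: "bdd_above (range (\<lambda>t. norm (\<psi> t)))" by (rule bdd_aboveI2[OF \<psi>_bound])
  have S: "norm (\<psi> t) \<le> S" for t unfolding S_def by (rule cSUP_upper[OF UNIV_I bdd])
  have small': "(LINT q|lborel. norm (d q)) < norm c" using small by (simp add: d_def)
  then have c: "norm c > 0" by (meson integral_nonneg_AE AE_I2 norm_ge_zero le_less_trans Bochner_Integration.integral_nonneg)
  have "norm (\<psi> t) \<le> (LINT q|lborel. norm (d q)) * S / norm c" for t
    using key[OF S, of t] c by (simp add: field_simps)
  then have "S \<le> (LINT q|lborel. norm (d q)) * S / norm c"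
    unfolding S_def by (intro cSUP_least) auto
  moreover have "(LINT q|lborel. norm (d q)) * S / norm c < S" if "S > 0"
    using small' c that by (simp add: field_simps)
  ultimately have "S \<le> 0" by linarith
  then have "norm (\<psi> t) \<le> 0" using S[of t] by linarith
  then show ?thesis by (simp add: \<psi>_def)
qed

text \<open>On the Fourier side, a plateau around 0 becomes a plateau around \<open>w\<close> whose width is scaled by \<open>d\<close>.\<close>

definition dilate :: "(real \<Rightarrow> complex) \<Rightarrow> real \<Rightarrow> real \<Rightarrow> real \<Rightarrow> complex" where
  "dilate v w d t = of_real d * v (d * t) * cis (w * t)"

lemma integrable_dilate:
  assumes "integrable lborel v" "d \<noteq> 0"
  shows "integrable lborel (dilate v w d)"
proof -
  have "integrable lborel (\<lambda>t. of_real d * v (d * t))"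
    using lborel_integrable_real_affine[OF assms, of 0] by simp
  moreover have [measurable]: "cis \<in> borel_measurable borel"
    by (intro borel_measurable_continuous_onI continuous_intros)
  ultimately show ?thesis
    unfolding dilate_def
    using Bochner_Integration.integrable_bound[of lborel "\<lambda>t. of_real d * v (d * t)"
        "\<lambda>t. of_real d * v (d * t) * cis (w * t)"] assms(1)
    by (auto simp: norm_mult)
qed

text \<open>The transform of the dilated kernel is 1 on the interval of radius d around w, and
  \<open>g\<close> vanishes outside that interval. Fubini moves the convolution to the frequency
  side, where it is multiplication by 1.\<close>

lemma dilate_reproduces:
  fixes g v :: "real \<Rightarrow> complex"
  assumes g: "C2 g g1 g2" "bounded_support g" and v: "integrable lborel v" and d: "d > 0"
    and plat: "\<And>x. \<bar>x\<bar> \<le> 1 \<Longrightarrow> (LINT t|lborel. v t * cis (- (x * t))) = 1"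
    and supp: "\<And>s. \<bar>s - w\<bar> > d \<Longrightarrow> g s = 0"
  shows "(LINT r|lborel. dilate v w d r * inv_fourier g (t - r)) = inv_fourier g t"
proof -
  note cc = C2_cc[OF g]
  have [measurable]: "g \<in> borel_measurable borel" "v \<in> borel_measurable borel" "cis \<in> borel_measurable borel"
    using C2_continuous[OF g(1)] v by (auto intro!: borel_measurable_continuous_onI continuous_intros)
  have vd: "integrable lborel (dilate v w d)" using integrable_dilate[OF v] d by simp
  note [measurable] = borel_measurable_integrable[OF vd]
  have hat: "(LINT r|lborel. dilate v w d r * cis (- (s * r))) = 1" if "\<bar>s - w\<bar> \<le> d" for s
  proof -
    have "(LINT r|lborel. dilate v w d r * cis (- (s * r)))
        = (LINT r|lborel. d *\<^sub>R (v (d * r) * cis (- ((s - w) / d * (d * r)))))"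
    proof (intro Bochner_Integration.integral_cong refl)
      fix r
      have "cis (w * r) * cis (- (s * r)) = cis (- ((s - w) / d * (d * r)))"
      proof -
        have "(s - w) / d * (d * r) = (s - w) * r" using d by simp
        then show ?thesis by (simp only: cis_mult) (simp add: algebra_simps)
      qed
      then show "dilate v w d r * cis (- (s * r)) = d *\<^sub>R (v (d * r) * cis (- ((s - w) / d * (d * r))))"
        by (simp add: dilate_def scaleR_conv_of_real mult.assoc)
    qed
    also have "\<dots> = (LINT r|lborel. v r * cis (- ((s - w) / d * r)))"
      using lborel_integral_real_affine[of d "\<lambda>r. v r * cis (- ((s - w) / d * r))" 0] d by simp
    also have "\<dots> = 1" using that d by (intro plat) (simp add: field_simps)
    finally show ?thesis .
  qed
  have "(LINT r|lborel. dilate v w d r * inv_fourier g (t - r))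
      = (LINT r|lborel. LINT s|lborel. (1 / (2 * pi)) *\<^sub>R (dilate v w d r * (cis ((t - r) * s) * g s)))"
    by (simp add: inv_fourier_complex[OF cc(1)])
  also have "\<dots> = (LINT s|lborel. LINT r|lborel. (1 / (2 * pi)) *\<^sub>R (dilate v w d r * (cis ((t - r) * s) * g s)))"
  proof (rule fubini_dominated_swap[OF _ integrable_norm[OF vd] integrable_norm[OF cc_integrable[OF cc(1)]], where c = 0])
    show "norm ((1 / (2 * pi)) *\<^sub>R (dilate v w d r * (cis ((t - r) * s) * g s)))
        \<le> norm (dilate v w d r) * norm (g (s - 0 * r))" for r s
    proof -
      have "1 / (2 * pi) * (norm (dilate v w d r) * norm (g s)) \<le> 1 * (norm (dilate v w d r) * norm (g s))"
        using pi_ge_two by (intro mult_right_mono) auto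
      then show ?thesis by (simp add: norm_mult)
    qed
  qed measurable
  also have "\<dots> = (LINT s|lborel. (1 / (2 * pi)) *\<^sub>R (cis (t * s) * g s))"
  proof (intro Bochner_Integration.integral_cong refl)
    fix s
    have "(LINT r|lborel. (1 / (2 * pi)) *\<^sub>R (dilate v w d r * (cis ((t - r) * s) * g s)))
        = (LINT r|lborel. ((1 / (2 * pi)) *\<^sub>R (cis (t * s) * g s)) * (dilate v w d r * cis (- (s * r))))"
    proof (intro Bochner_Integration.integral_cong refl)
      fix r
      have "cis ((t - r) * s) = cis (t * s) * cis (- (s * r))"
        by (simp add: cis_mult algebra_simps)
      then show "(1 / (2 * pi)) *\<^sub>R (dilate v w d r * (cis ((t - r) * s) * g s))
          = ((1 / (2 * pi)) *\<^sub>R (cis (t * s) * g s)) * (dilate v w d r * cis (- (s * r)))"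
        by (simp add: scaleR_conv_of_real)
    qed
    also have "\<dots> = ((1 / (2 * pi)) *\<^sub>R (cis (t * s) * g s)) * (LINT r|lborel. dilate v w d r * cis (- (s * r)))"
      by simp
    finally show "(LINT r|lborel. (1 / (2 * pi)) *\<^sub>R (dilate v w d r * (cis ((t - r) * s) * g s)))
        = (1 / (2 * pi)) *\<^sub>R (cis (t * s) * g s)"
      using hat[of s] supp[of s] by (cases "\<bar>s - w\<bar> \<le> d") auto
  qed
  also have "\<dots> = inv_fourier g t"
    by (simp add: inv_fourier_complex[OF cc(1)])
  finally show ?thesis .
qed

text \<open>A wide kernel hardly notices a translation by r apart from the phase
  \<open>cis (- (w * r))\<close>: after rescaling, the shift has size r / (n + 1). Averaging the
  phases against \<open>f\<close> produces the transform of \<open>f\<close> at w as an approximate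
  eigenvalue.\<close>

lemma dilate_almost_eigenfunction:
  fixes f v :: "real \<Rightarrow> complex"
  assumes f: "integrable lborel f" and v: "continuous_on UNIV v" "\<And>t. norm (v t) \<le> C / (1 + t\<^sup>2)"
  shows "(\<lambda>n. LINT q|lborel. norm ((LINT r|lborel. f r * dilate v w (1 / Suc n) (q - r))
      - (LINT r|lborel. f r * cis (- (w * r))) * dilate v w (1 / Suc n) q)) \<longlonglongrightarrow> 0"
    (is "?D \<longlonglongrightarrow> 0")
proof -
  have vb[measurable]: "v \<in> borel_measurable borel" by (rule borel_measurable_continuous_onI[OF v(1)])
  have vi: "integrable lborel v" by (rule integrable_bound_inverse_square[OF vb v(2)])
  have [measurable]: "cis \<in> borel_measurable borel"
    by (intro borel_measurable_continuous_onI continuous_intros)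
  note [measurable] = borel_measurable_integrable[OF f]
  \<comment> \<open>The modulus of continuity of \<open>v\<close> in mean. Its decay along r / (n +
    1), together with boundedness, yields the claim by dominated convergence in r with weight
    |f|.\<close>
  define om where "om y = (LINT x|lborel. norm (v (x - y) - v x))" for y
  have om_meas[measurable]: "om \<in> borel_measurable borel" unfolding om_def by measurable
  have vs: "integrable lborel (\<lambda>x. v (x - y))" for y
    using lborel_integrable_shift(2)[OF vi, of "- y"] by simp
  have om_bound: "norm (om y) \<le> 2 * (LINT x|lborel. norm (v x))" for y
  proof -
    have "om y \<le> (LINT x|lborel. norm (v (x - y)) + norm (v x))"
      unfolding om_def
      by (intro integral_mono norm_triangle_ineq4 integrable_norm Bochner_Integration.integrable_add
          Bochner_Integration.integrable_diff vs vi)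
    also have "\<dots> = (LINT x|lborel. norm (v (x - y))) + (LINT x|lborel. norm (v x))"
      by (intro Bochner_Integration.integral_add integrable_norm vs vi)
    also have "(LINT x|lborel. norm (v (x - y))) = (LINT x|lborel. norm (v x))"
      using lborel_integral_shift(2)[of "\<lambda>x. norm (v x)" "- y"] by simp
    finally show ?thesis by (simp add: om_def)
  qed
  have om_lim: "(\<lambda>n. om (r / real (Suc n))) \<longlonglongrightarrow> 0" for r
  proof -
    have C: "C \<ge> 0" using order_trans[OF norm_ge_zero v(2)[of 0]] by simp
    let ?y = "\<lambda>n. r / real (Suc n)"
    have y_lim: "?y \<longlonglongrightarrow> 0"
      using tendsto_mult[OF tendsto_const[of r] LIMSEQ_inverse_real_of_nat] by (simp add: divide_inverse)
    have "(\<lambda>n. om (?y n)) \<longlonglongrightarrow> (LINT x|(lborel :: real measure). (0::real))"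
      unfolding om_def
    proof (rule integral_dominated_convergence[where w = "\<lambda>x. (C * (2 + 2 * r\<^sup>2) + C) * (1 / (1 + x\<^sup>2))"])
      show "integrable lborel (\<lambda>x. (C * (2 + 2 * r\<^sup>2) + C) * (1 / (1 + x\<^sup>2)))"
        by (rule integrable_mult_right[OF integrable_inverse_one_plus_square])
      show "AE x in lborel. (\<lambda>n. norm (v (x - ?y n) - v x)) \<longlonglongrightarrow> 0"
      proof (intro AE_I2)
        fix x
        have "(\<lambda>n. x - ?y n) \<longlonglongrightarrow> x - 0" by (intro tendsto_intros y_lim)
        then have "(\<lambda>n. v (x - ?y n)) \<longlonglongrightarrow> v x"
          using continuous_on_tendsto_compose[OF v(1), of _ x] by simp
        then show "(\<lambda>n. norm (v (x - ?y n) - v x)) \<longlonglongrightarrow> 0"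
          by (intro tendsto_norm_zero) (simp add: LIM_zero_iff)
      qed
      \<comment> \<open>The shift never exceeds |r|. For the shifted point z this gives 1 + x^2
        \<le> (2 + 2 r^2) (1 + z^2), so the decay of \<open>v\<close> at z becomes decay at x with a
        constant independent of n.\<close>
      show "AE x in lborel. norm (norm (v (x - ?y n) - v x)) \<le> (C * (2 + 2 * r\<^sup>2) + C) * (1 / (1 + x\<^sup>2))" for n
      proof (intro AE_I2)
        fix x
        let ?z = "x - ?y n"
        have "\<bar>?y n\<bar> \<le> \<bar>r\<bar>"
          using mult_left_mono[of 1 "real (Suc n)" "\<bar>r\<bar>"] by (simp add: abs_divide divide_le_eq)
        then have y2: "(?y n)\<^sup>2 \<le> r\<^sup>2" by (rule abs_le_square_iff[THEN iffD1])
        have "x\<^sup>2 \<le> 2 * ?z\<^sup>2 + 2 * (?y n)\<^sup>2"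
          using zero_le_power2[of "?z - ?y n"] by (simp add: power2_eq_square algebra_simps)
        moreover have "(2 + 2 * r\<^sup>2) * (1 + ?z\<^sup>2) = 2 + 2 * ?z\<^sup>2 + 2 * r\<^sup>2 + 2 * (r\<^sup>2 * ?z\<^sup>2)"
          by (simp add: algebra_simps)
        moreover have "0 \<le> r\<^sup>2 * ?z\<^sup>2" by simp
        ultimately have "1 + x\<^sup>2 \<le> (2 + 2 * r\<^sup>2) * (1 + ?z\<^sup>2)"
          using y2 by linarith
        moreover have pos: "1 + x\<^sup>2 > 0" "1 + ?z\<^sup>2 > 0" by (auto intro: add_pos_nonneg)
        ultimately have "1 / (1 + ?z\<^sup>2) \<le> (2 + 2 * r\<^sup>2) / (1 + x\<^sup>2)"
          by (simp add: divide_le_eq le_divide_eq mult.commute)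
        then have "C / (1 + ?z\<^sup>2) \<le> C * (2 + 2 * r\<^sup>2) / (1 + x\<^sup>2)"
          using mult_left_mono[OF _ C] by fastforce
        then show "norm (norm (v ?z - v x)) \<le> (C * (2 + 2 * r\<^sup>2) + C) * (1 / (1 + x\<^sup>2))"
          using norm_triangle_ineq4[of "v ?z" "v x"] v(2)[of ?z] v(2)[of x]
          by (simp add: add_divide_distrib)
      qed
    qed measurable
    then show ?thesis by simp
  qed
  have C: "C \<ge> 0" using order_trans[OF norm_ge_zero v(2)[of 0]] by simp
  have D_le: "?D n \<le> (LINT r|lborel. norm (f r) * om (r / Suc n))" for n
  proof -
    define d where "d = 1 / real (Suc n)"
    have d: "d > 0" by (simp add: d_def)
    let ?v = "dilate v w d"
    have vd: "integrable lborel ?v" using integrable_dilate[OF vi] d by simp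
    note [measurable] = borel_measurable_integrable[OF vd]
    have fw: "integrable lborel (\<lambda>r. f r * cis (- (w * r)))"
      by (rule Bochner_Integration.integrable_bound[OF f]) (auto simp: norm_mult)
    have v_bd: "norm (?v t) \<le> d * C" for t
    proof -
      have "C / (1 + (d * t)\<^sup>2) \<le> C / 1" using C by (intro divide_left_mono) (auto intro: add_pos_nonneg)
      then have "norm (v (d * t)) \<le> C" using v(2)[of "d * t"] by simp
      then show ?thesis using d by (simp add: dilate_def norm_mult)
    qed
    have fv: "integrable lborel (\<lambda>r. f r * ?v (q - r))" for q
      by (rule Bochner_Integration.integrable_bound[OF integrable_mult_right[OF integrable_norm[OF f], of "d * C"]])
        (use v_bd d C in \<open>auto simp: norm_mult mult.commute[of "norm (f _)"] intro!: mult_right_mono\<close>)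
    let ?W = "\<lambda>r q. f r * ?v (q - r) - f r * cis (- (w * r)) * ?v q"
    have "integrable (lborel \<Otimes>\<^sub>M lborel) (\<lambda>(r, q). f r * ?v (q - r))"
      by (rule fubini_dominated[OF _ integrable_norm[OF f] integrable_norm[OF vd], where c = 1])
        (auto simp: norm_mult)
    moreover have "integrable (lborel \<Otimes>\<^sub>M lborel) (\<lambda>(r, q). f r * cis (- (w * r)) * ?v q)"
      by (rule fubini_dominated[OF _ integrable_norm[OF f] integrable_norm[OF vd], where c = 0])
        (auto simp: norm_mult)
    ultimately have W: "integrable (lborel \<Otimes>\<^sub>M lborel) (\<lambda>(r, q). ?W r q)"
      using Bochner_Integration.integrable_diff by (fastforce simp: split_beta')
    have nW: "integrable (lborel \<Otimes>\<^sub>M lborel) (\<lambda>(r, q). norm (?W r q))"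
      using integrable_norm[OF W] by (simp add: split_beta')
    have fst: "(LINT r|lborel. f r * ?v (q - r)) - (LINT r|lborel. f r * cis (- (w * r))) * ?v q
        = (LINT r|lborel. ?W r q)" for q
      using fv fw by simp
    have "?D n = (LINT q|lborel. norm (LINT r|lborel. ?W r q))"
      unfolding d_def[symmetric] fst ..
    also have "\<dots> \<le> (LINT q|lborel. LINT r|lborel. norm (?W r q))"
      by (intro integral_mono integral_norm_bound integrable_norm lborel_pair.integrable_snd W nW)
    also have "\<dots> = (LINT r|lborel. LINT q|lborel. norm (?W r q))"
      using lborel_pair.Fubini_integral[OF nW] by simp
    also have "\<dots> = (LINT r|lborel. norm (f r) * om (r / Suc n))"
    proof (intro Bochner_Integration.integral_cong refl)
      fix r
      \<comment> \<open>Both terms carry the same phase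
        \<open>cis (w * q) * cis (- (w * r))\<close>, which disappears under the norm; the
        difference of \<open>v\<close> at points d r apart remains.\<close>
      have eq: "norm (?W r q) = norm (f r) * (d * norm (v (d * q - d * r) - v (d * q)))" for q
      proof -
        have "?W r q = f r * cis (w * q) * cis (- (w * r)) * (of_real d * (v (d * q - d * r) - v (d * q)))"
        proof -
          have "cis (w * (q - r)) = cis (w * q) * cis (- (w * r))"
            by (simp add: cis_mult algebra_simps)
          then show ?thesis by (simp add: dilate_def algebra_simps)
        qed
        then show ?thesis using d by (simp add: norm_mult)
      qed
      have "d * (LINT q|lborel. norm (v (d * q - d * r) - v (d * q))) = om (d * r)"
        unfolding om_def
        using lborel_integral_real_affine[of d "\<lambda>x. norm (v (x - d * r) - v x)" 0] d by simp
      then show "(LINT q|lborel. norm (?W r q)) = norm (f r) * om (r / Suc n)"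
        unfolding eq integral_mult_right_zero by (simp add: d_def)
    qed
    finally show ?thesis .
  qed
  have "(\<lambda>n. LINT r|lborel. norm (f r) * om (r / Suc n)) \<longlonglongrightarrow> (LINT r|(lborel :: real measure). (0::real))"
  proof (rule integral_dominated_convergence[where w = "\<lambda>r. norm (f r) * (2 * (LINT x|lborel. norm (v x)))"])
    show "AE r in lborel. (\<lambda>n. norm (f r) * om (r / Suc n)) \<longlonglongrightarrow> 0"
      using tendsto_mult[OF tendsto_const om_lim] by (intro AE_I2) fastforce
    show "AE r in lborel. norm (norm (f r) * om (r / Suc n)) \<le> norm (f r) * (2 * (LINT x|lborel. norm (v x)))" for n
      using om_bound by (auto simp: abs_mult intro!: mult_left_mono)
  qed (use f in \<open>auto\<close>)
  then show ?thesis
    by (intro tendsto_sandwich[OF _ _ tendsto_const[of 0], where g = ?D, OF _ always_eventually[OF allI[OF D_le]]])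
      (auto intro!: always_eventually)
qed

section \<open>The Beurling spectrum\<close>

text \<open>The complex-linear functional whose real part is the given real one.\<close>

definition complex_functional :: "('a::complex_banach \<Rightarrow> real) \<Rightarrow> 'a \<Rightarrow> complex" where
  "complex_functional l x = of_real (l x) - \<i> * of_real (l (\<i> *\<^sub>C x))"

lemma bounded_linear_complex_functional:
  assumes "bounded_linear l" shows "bounded_linear (complex_functional l)"
  unfolding complex_functional_def
  by (intro bounded_linear_sub bounded_linear_compose[OF bounded_linear_of_real assms]
      bounded_linear_compose[OF bounded_linear_mult_right]
      bounded_linear_compose[OF bounded_linear_of_real bounded_linear_compose[OF assms]]
      scaleC.bounded_linear_right)

lemma complex_functional_scaleC:
  assumes l: "bounded_linear l"
  shows "complex_functional l (c *\<^sub>C x) = c * complex_functional l x"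
proof -
  interpret l: bounded_linear l by fact
  have dec: "c *\<^sub>C y = Re c *\<^sub>R y + Im c *\<^sub>R (\<i> *\<^sub>C y)" for y :: 'a
  proof -
    have "c *\<^sub>C y = (of_real (Re c) + of_real (Im c) * \<i>) *\<^sub>C y" by (simp add: complex_eq[symmetric] mult.commute)
    then show ?thesis by (simp only: scaleC_add_left scaleC_scaleC[symmetric] scaleC_of_real)
  qed
  have ii: "\<i> *\<^sub>C \<i> *\<^sub>C x = - x"
    using scaleC_of_real[of "-1" x] by (simp add: scaleC_scaleC)
  have "\<i> *\<^sub>C c *\<^sub>C x = Re c *\<^sub>R (\<i> *\<^sub>C x) + Im c *\<^sub>R (- x)"
    unfolding dec[of x] scaleC_add_right scaleC_scaleR_commute ii ..
  then show ?thesis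
    unfolding complex_functional_def dec[of x]
    by (simp add: l.add l.scaleR l.neg l.diff complex_eq_iff)
qed

lemma Re_complex_functional: "Re (complex_functional l x) = l x"
  by (simp add: complex_functional_def)

lemma eq_0_if_complex_functionals_eq_0:
  fixes x :: "'a::complex_banach"
  assumes "\<And>l :: 'a \<Rightarrow> real. bounded_linear l \<Longrightarrow> complex_functional l x = 0"
  shows "x = 0"
proof (rule eq_if_functionals_eq)
  fix l :: "'a \<Rightarrow> real" assume l: "bounded_linear l"
  then show "l x = l 0"
    using assms[OF l] Re_complex_functional[of l x] by (simp add: bounded_linear.linear linear_0)
qed

text \<open>The product is kept abstract, so that scalar kernels acting by \<open>scaleC\<close> and
  operator kernels acting by application share these estimates.\<close>

lemma convolution_integrand:
  fixes p :: "'b::real_normed_vector \<Rightarrow> 'c::real_normed_vector \<Rightarrow> 'd::banach"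
  assumes p: "bounded_bilinear p" "\<And>a b. norm (p a b) \<le> norm a * norm b"
    and k: "simple_limit borel k" "integrable lborel (\<lambda>s. norm (k s))"
    and \<phi>: "simple_limit borel \<phi>" "\<And>s. norm (\<phi> s) \<le> M"
  shows "simple_limit borel (\<lambda>s. p (k s) (\<phi> (t - s)))"
    and "integrable lborel (\<lambda>s. norm (p (k s) (\<phi> (t - s))))"
    and "norm (p (k s) (\<phi> (t - s))) \<le> norm (k s) * M"
proof -
  show sl: "simple_limit borel (\<lambda>s. p (k s) (\<phi> (t - s)))"
    by (intro simple_limit_bilinear[OF p(1)] k simple_limit_comp[OF \<phi>(1)]) measurable
  have le: "norm (p (k s) (\<phi> (t - s))) \<le> norm (k s) * M" for s
    using p(2)[of "k s" "\<phi> (t - s)"] mult_left_mono[OF \<phi>(2)[of "t - s"], of "norm (k s)"] by simp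
  show "norm (p (k s) (\<phi> (t - s))) \<le> norm (k s) * M" by (rule le)
  show "integrable lborel (\<lambda>s. norm (p (k s) (\<phi> (t - s))))"
    by (rule Bochner_Integration.integrable_bound[OF integrable_mult_left[OF k(2), of M]])
      (use simple_limit_norm[OF sl] le in \<open>auto intro: order_trans[OF _ abs_ge_self]\<close>)
qed

lemma norm_scaleC_le: "norm (c *\<^sub>C x) \<le> norm c * norm (x :: 'a::complex_banach)"
  by (simp add: norm_scaleC)

lemma complex_functional_convolution:
  fixes \<phi> :: "real \<Rightarrow> 'a::complex_banach"
  assumes l: "bounded_linear l"
    and k: "simple_limit borel k" "integrable lborel (\<lambda>s. norm (k s))"
    and \<phi>: "simple_limit borel \<phi>" "\<And>s. norm (\<phi> s) \<le> M"
  shows "complex_functional l (convolution scaleC k \<phi> t)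
    = (LINT s|lborel. k s * complex_functional l (\<phi> (t - s)))"
  unfolding Defs.convolution_def
  by (subst bochner_integral_functional_UNIV(2)[OF convolution_integrand(1,2)[OF bounded_bilinear_scaleC norm_scaleC_le k \<phi>]])
    (simp_all add: bounded_linear_complex_functional complex_functional_scaleC l)

lemma borel_measurable_simple_limit:
  fixes f :: "real \<Rightarrow> complex"
  assumes "f \<in> borel_measurable borel" shows "simple_limit borel f"
  using borel_measurable_implies_sequence_metric[OF assms, of 0] unfolding simple_limit_def by metis

lemma simple_limit_inv_fourier: "cc f \<Longrightarrow> simple_limit borel (inv_fourier f)"
  by (intro simple_limit_continuous continuous_inv_fourier)

lemma integrable_norm_inv_fourier:
  assumes "C2 g g1 g2" "bounded_support g"
  shows "integrable lborel (\<lambda>t. norm (inv_fourier g t))"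
proof -
  obtain C where C: "\<And>t. norm (inv_fourier g t) \<le> C / (1 + t\<^sup>2)"
    using inv_fourier_decay[OF assms] by blast
  show ?thesis
    by (rule integrable_bound_inverse_square[where C = C])
      (use C simple_limit_norm[OF simple_limit_inv_fourier[OF C2_cc(1)[OF assms]]] in auto)
qed

lemma integrable_lebesgue_ex_borel:
  fixes f :: "real \<Rightarrow> complex"
  assumes f: "integrable lebesgue f"
  obtains f' where "integrable lborel f'" "AE t in lborel. f t = f' t"
proof -
  have "(\<lambda>x. Re (f x)) \<in> borel_measurable lebesgue" "(\<lambda>x. Im (f x)) \<in> borel_measurable lebesgue"
    using f by (auto dest: borel_measurable_integrable)
  then obtain g h where gh: "g \<in> borel_measurable lborel" "AE x in lborel. Re (f x) = g x"
    "h \<in> borel_measurable lborel" "AE x in lborel. Im (f x) = h x"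
    using completion_ex_borel_measurable_real by blast
  define f' where "f' = (\<lambda>x. of_real (g x) + \<i> * of_real (h x))"
  have m: "f' \<in> borel_measurable lborel" using gh unfolding f'_def by measurable
  have ae: "AE t in lborel. f t = f' t"
    using gh(2,4) by eventually_elim (simp add: f'_def complex_eq_iff)
  have "integrable lebesgue f'"
    using f
  proof (rule integrable_cong_AE_imp)
    show "f' \<in> borel_measurable lebesgue" using m by (rule measurable_completion)
    show "AE x in lebesgue. f x = f' x" using ae by (rule AE_completion)
  qed
  then have "integrable lborel f'" using m by (simp add: integrable_completion)
  then show thesis using ae that by blast
qed

text \<open>The witness from the definition is only Lebesgue measurable and is convolved with
  \<open>\<phi>\<close> in the opposite order. A Borel representative and the substitution s to t -
  s bring it into the form used by the scalar lemmas, tested by complex functionals.\<close>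

lemma outside_beurling_spectrumE:
  fixes \<phi> :: "real \<Rightarrow> 'a::complex_banach"
  assumes \<phi>: "simple_limit borel \<phi>" "\<And>s. norm (\<phi> s) \<le> M" and w: "w \<notin> beurling_spectrum \<phi>"
  obtains f where "integrable lborel f" "(LINT r|lborel. f r * cis (- (w * r))) \<noteq> 0"
    "\<And>l t. bounded_linear l \<Longrightarrow> (LINT s|lborel. f s * complex_functional l (\<phi> (t - s))) = 0"
proof -
  obtain f0 where f0: "integrable lebesgue f0" "fourier f0 w \<noteq> 0"
    "\<And>t. convolution (\<lambda>x c. c *\<^sub>C x) \<phi> f0 t = 0"
    using w unfolding beurling_spectrum_def by blast
  obtain f where f: "integrable lborel f" "AE t in lborel. f0 t = f t"
    using integrable_lebesgue_ex_borel[OF f0(1)] .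
  note [measurable] = borel_measurable_integrable[OF f(1)]
  have [measurable]: "cis \<in> borel_measurable borel"
    by (intro borel_measurable_continuous_onI continuous_intros)
  have slf: "simple_limit borel f" by (rule borel_measurable_simple_limit) simp
  have "fourier f0 w = (LINT t|lebesgue. f t * cis (- (w * t)))"
    unfolding fourier_def
  proof (rule integral_cong_AE)
    show "(\<lambda>t. f0 t * exp (- (\<i> * complex_of_real (w * t)))) \<in> borel_measurable lebesgue"
    proof (rule borel_measurable_times[OF borel_measurable_integrable[OF f0(1)]])
      show "(\<lambda>t. exp (- (\<i> * complex_of_real (w * t)))) \<in> borel_measurable lebesgue"
        by (intro measurable_completion) measurable
    qed
    show "(\<lambda>t. f t * cis (- (w * t))) \<in> borel_measurable lebesgue"
      by (intro measurable_completion) simp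
    show "AE t in lebesgue. f0 t * exp (- (\<i> * complex_of_real (w * t))) = f t * cis (- (w * t))"
      using AE_completion[OF f(2)] by eventually_elim (simp add: cis_conv_exp)
  qed
  also have "\<dots> = (LINT t|lborel. f t * cis (- (w * t)))"
    by (intro integral_completion) simp
  finally have "(LINT t|lborel. f t * cis (- (w * t))) \<noteq> 0" using f0(2) by simp
  moreover have "(LINT s|lborel. f s * complex_functional l (\<phi> (t - s))) = 0" if l: "bounded_linear l" for l t
  proof -
    have "AE s in lebesgue. \<phi> s = \<phi> s \<and> f0 (t - s) = f (t - s)"
      using AE_completion[OF AE_lborel_affine[OF f(2), of "-1" t]] by simp
    then have "convolution (\<lambda>x c. c *\<^sub>C x) \<phi> f0 t = bochner_integral lebesgue (\<lambda>s. f (t - s) *\<^sub>C \<phi> s)"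
      unfolding Defs.convolution_def by (intro bochner_integral_cong_AE) auto
    then have "complex_functional l (bochner_integral lebesgue (\<lambda>s. f (t - s) *\<^sub>C \<phi> s)) = 0"
      using f0(3)[of t] bounded_linear_complex_functional[OF l] by (simp add: bounded_linear.linear linear_0)
    moreover have "complex_functional l (bochner_integral lebesgue (\<lambda>s. f (t - s) *\<^sub>C \<phi> s))
        = (LINT s|lborel. f (t - s) * complex_functional l (\<phi> s))"
    proof (subst bochner_integral_functional_UNIV(2))
      show sl: "simple_limit borel (\<lambda>s. f (t - s) *\<^sub>C \<phi> s)"
        by (intro simple_limit_bilinear[OF bounded_bilinear_scaleC] \<phi> simple_limit_comp[OF slf]) measurable
      have "norm (f (t - s) *\<^sub>C \<phi> s) \<le> norm (f (t - s)) * M" for s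
        unfolding norm_scaleC by (intro mult_left_mono \<phi>) auto
      then show "integrable lborel (\<lambda>s. norm (f (t - s) *\<^sub>C \<phi> s))"
        using simple_limit_norm[OF sl]
        by (intro Bochner_Integration.integrable_bound[OF
              integrable_mult_left[OF integrable_norm[OF lborel_integrable_shift(1)[OF f(1), of t]], of M]])
           (auto intro: order_trans[OF _ abs_ge_self])
    qed (simp_all add: bounded_linear_complex_functional complex_functional_scaleC l)
    ultimately show ?thesis
      using lborel_integral_shift(1)[of "\<lambda>s. f s * complex_functional l (\<phi> (t - s))" t] by simp
  qed
  ultimately show thesis using that f(1) by blast
qed

text \<open>The kernel is the inverse transform of the plateau, and inversion returns the plateau,
  which is 1 on [-1, 1].\<close>

lemma ex_reproducing_kernel:
  obtains v :: "real \<Rightarrow> complex" and C where "continuous_on UNIV v" "\<And>t. norm (v t) \<le> C / (1 + t\<^sup>2)"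
    "\<And>x. \<bar>x\<bar> \<le> 1 \<Longrightarrow> (LINT t|lborel. v t * cis (- (x * t))) = 1"
proof -
  obtain p1 p2 where p: "C2 plateau p1 p2" using ex_C2_plateau .
  have g: "C2 (\<lambda>s. complex_of_real (plateau s)) (\<lambda>s. of_real (p1 s)) (\<lambda>s. of_real (p2 s))"
    by (rule C2_bounded_linear[OF bounded_linear_of_real p])
  have b: "bounded_support (\<lambda>s. complex_of_real (plateau s))"
    using bounded_support_plateau by (rule bounded_support_mono) simp
  obtain C where "\<And>t. norm (inv_fourier (\<lambda>s. complex_of_real (plateau s)) t) \<le> C / (1 + t\<^sup>2)"
    using inv_fourier_decay[OF g b] by blast
  then show thesis
    using that[of "inv_fourier (\<lambda>s. complex_of_real (plateau s))" C]
      continuous_inv_fourier[OF C2_cc(1)[OF g b]] fourier_inversion[OF g b]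
    by (simp add: plateau_eq_1)
qed

text \<open>The radius depends only on \<open>f\<close>, on w and on the fixed kernel
  \<open>v\<close>. It is therefore the same for every functional and every \<open>g\<close>, which
  is what turns the scalar statements into one about vectors.\<close>

theorem convolution_eq_0_near_nonspectral_point:
  fixes \<phi> :: "real \<Rightarrow> 'a::complex_banach"
  assumes \<phi>: "simple_limit borel \<phi>" "\<And>s. norm (\<phi> s) \<le> M" and w: "w \<notin> beurling_spectrum \<phi>"
  obtains d where "d > 0" "\<And>g g1 g2 t. C2 g g1 g2 \<Longrightarrow> (\<And>s. \<bar>s - w\<bar> > d \<Longrightarrow> g s = 0) \<Longrightarrow>
      convolution scaleC (inv_fourier g) \<phi> t = 0"
proof -
  obtain f where f: "integrable lborel f" "(LINT r|lborel. f r * cis (- (w * r))) \<noteq> 0"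
    "\<And>l t. bounded_linear l \<Longrightarrow> (LINT s|lborel. f s * complex_functional l (\<phi> (t - s))) = 0"
    using outside_beurling_spectrumE[OF \<phi> w] by blast
  obtain v :: "real \<Rightarrow> complex" and C where v: "continuous_on UNIV v" "\<And>t. norm (v t) \<le> C / (1 + t\<^sup>2)"
    "\<And>x. \<bar>x\<bar> \<le> 1 \<Longrightarrow> (LINT t|lborel. v t * cis (- (x * t))) = 1"
    using ex_reproducing_kernel by metis
  have vi: "integrable lborel v"
    using v by (intro integrable_bound_inverse_square[OF borel_measurable_continuous_onI]) auto
  let ?c = "LINT r|lborel. f r * cis (- (w * r))"
  have "\<forall>\<^sub>F n in sequentially. (LINT q|lborel. norm ((LINT r|lborel. f r * dilate v w (1 / Suc n) (q - r))
      - ?c * dilate v w (1 / Suc n) q)) < norm ?c"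
    using order_tendstoD(2)[OF dilate_almost_eigenfunction[OF f(1) v(1,2)], of "norm ?c"] f(2) by simp
  then obtain n where n: "(LINT q|lborel. norm ((LINT r|lborel. f r * dilate v w (1 / Suc n) (q - r))
      - ?c * dilate v w (1 / Suc n) q)) < norm ?c"
    by (auto simp: eventually_sequentially)
  define d where "d = 1 / real (Suc n)"
  have d: "d > 0" by (simp add: d_def)
  show thesis
  proof (rule that[OF d])
    fix g g1 g2 :: "real \<Rightarrow> complex" and t
    assume g: "C2 g g1 g2" and supp: "\<And>s. \<bar>s - w\<bar> > d \<Longrightarrow> g s = 0"
    have b: "bounded_support g"
      unfolding bounded_support_def using supp by (intro exI[of _ "\<bar>w\<bar> + d"]) auto
    show "convolution scaleC (inv_fourier g) \<phi> t = 0"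
    proof (rule eq_0_if_complex_functionals_eq_0)
      fix l :: "'a \<Rightarrow> real" assume l: "bounded_linear l"
      have L: "bounded_linear (complex_functional l)" by (rule bounded_linear_complex_functional[OF l])
      obtain B where B: "B \<ge> 0" "\<And>x. norm (complex_functional l x) \<le> norm x * B"
        using bounded_linear.nonneg_bounded[OF L] by blast
      have "(LINT s|lborel. inv_fourier g s * complex_functional l (\<phi> (t - s))) = 0"
      proof (rule convolution_vanishes_if_reproduced[OF f(1) integrable_inv_fourier[OF g b] integrable_dilate[OF vi]])
        show "(\<lambda>s. complex_functional l (\<phi> s)) \<in> borel_measurable borel"
          by (rule simple_limit_borel_measurable[OF \<phi>(1) linear_continuous_on[OF L]])
        show "norm (complex_functional l (\<phi> s)) \<le> M * B" for s
          using order_trans[OF B(2) mult_right_mono[OF \<phi>(2) B(1)]] .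
        show "(LINT r|lborel. dilate v w d r * inv_fourier g (t - r)) = inv_fourier g t" for t
          by (rule dilate_reproduces[OF g b vi d v(3) supp])
      qed (use f(3)[OF l] n d in \<open>auto simp: d_def\<close>)
      then show "complex_functional l (convolution scaleC (inv_fourier g) \<phi> t) = 0"
        using complex_functional_convolution[OF l simple_limit_inv_fourier[OF C2_cc(1)[OF g b]]
            integrable_norm_inv_fourier[OF g b] \<phi>, of t] by simp
    qed
  qed
qed

lemma convolution_add:
  fixes \<phi> :: "real \<Rightarrow> 'a::complex_banach"
  assumes k: "simple_limit borel k" "integrable lborel (\<lambda>s. norm (k s))"
    and k': "simple_limit borel k'" "integrable lborel (\<lambda>s. norm (k' s))"
    and \<phi>: "simple_limit borel \<phi>" "\<And>s. norm (\<phi> s) \<le> M"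
  shows "convolution scaleC (\<lambda>s. k s + k' s) \<phi> t = convolution scaleC k \<phi> t + convolution scaleC k' \<phi> t"
proof (rule eq_if_functionals_eq)
  fix l :: "'a \<Rightarrow> real" assume l: "bounded_linear l"
  have sl: "simple_limit borel (\<lambda>s. k s + k' s)"
    by (rule simple_limit_compose2[OF k(1) k'(1), where p = "\<lambda>x y. x + y"]) (intro continuous_intros)
  have i: "integrable lborel (\<lambda>s. norm (k s + k' s))"
    by (rule Bochner_Integration.integrable_bound[OF Bochner_Integration.integrable_add[OF k(2) k'(2)]])
      (use simple_limit_norm[OF sl] in \<open>auto intro: norm_triangle_ineq\<close>)
  note int = convolution_integrand(1,2)[OF bounded_bilinear_scaleC norm_scaleC_le _ _ \<phi>, of _ t]
  note eqs = bochner_integral_functional_UNIV[OF int[OF k] l] bochner_integral_functional_UNIV[OF int[OF k'] l]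
    bochner_integral_functional_UNIV(2)[OF int[OF sl i] l]
  show "l (convolution scaleC (\<lambda>s. k s + k' s) \<phi> t) = l (convolution scaleC k \<phi> t + convolution scaleC k' \<phi> t)"
    unfolding Defs.convolution_def bounded_linear.linear[OF l, THEN linear_add] eqs(2,4,5)
    using eqs(1,3) by (simp add: scaleC_add_left bounded_linear.linear[OF l, THEN linear_add])
qed

text \<open>Compactness reduces the task to finitely many points. The bumps b around them are
  combined as 1 minus the product of the factors 1 - b: this equals 1 wherever some bump does, and
  each new term has support so close to one point that its convolution with \<open>\<phi>\<close>
  vanishes.\<close>

theorem ex_spectral_cutoff:
  fixes \<phi> :: "real \<Rightarrow> 'a::complex_banach"
  assumes \<phi>: "simple_limit borel \<phi>" "\<And>s. norm (\<phi> s) \<le> M"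
    and K: "compact K" "K \<subseteq> {-a<..<a}" "K \<inter> beurling_spectrum \<phi> = {}"
  obtains \<eta> \<eta>1 \<eta>2 :: "real \<Rightarrow> real" and U where "C2 \<eta> \<eta>1 \<eta>2" "\<And>s. \<bar>s\<bar> \<ge> a \<Longrightarrow> \<eta> s = 0" "open U" "K \<subseteq> U"
    "\<And>s. s \<in> U \<Longrightarrow> \<eta> s = 1" "\<And>t. convolution scaleC (inv_fourier (\<lambda>s. complex_of_real (\<eta> s))) \<phi> t = 0"
proof -
  \<comment> \<open>Two radii are involved: a bump is 1 within r and vanishes beyond 2 r, and the
    larger radius must lie inside (-a, a) and inside the neighbourhood where convolution
    kills.\<close>
  define good where "good w r \<longleftrightarrow> r > 0 \<and> (\<forall>s. \<bar>s - w\<bar> < 2 * r \<longrightarrow> \<bar>s\<bar> < a) \<and>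
     (\<forall>g g1 g2 t. C2 g g1 g2 \<longrightarrow> (\<forall>s. \<bar>s - w\<bar> \<ge> 2 * r \<longrightarrow> g s = 0) \<longrightarrow> convolution scaleC (inv_fourier g) \<phi> t = 0)"
    for w r :: real
  have "\<exists>r. good w r" if "w \<in> K" for w
  proof -
    have "w \<notin> beurling_spectrum \<phi>" using that K(3) by blast
    then obtain d where d: "d > 0" "\<And>g g1 g2 t. C2 g g1 g2 \<Longrightarrow> (\<And>s. \<bar>s - w\<bar> > d \<Longrightarrow> g s = 0) \<Longrightarrow>
      convolution scaleC (inv_fourier g) \<phi> t = 0"
      using convolution_eq_0_near_nonspectral_point[OF \<phi>] by metis
    have "w \<in> {-a<..<a}" using that K(2) by blast
    then have wa: "\<bar>w\<bar> < a" by auto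
    define r where "r = min d (a - \<bar>w\<bar>) / 2"
    have r: "2 * r \<le> d" "2 * r \<le> a - \<bar>w\<bar>" "r > 0" using d wa by (auto simp: r_def)
    have "good w r"
      unfolding good_def
    proof (intro conjI allI impI)
      fix g g1 g2 :: "real \<Rightarrow> complex" and t
      assume "C2 g g1 g2" "\<forall>s. 2 * r \<le> \<bar>s - w\<bar> \<longrightarrow> g s = 0"
      then show "convolution scaleC (inv_fourier g) \<phi> t = 0" using r by (intro d(2)) auto
    qed (use r in auto)
    then show ?thesis by blast
  qed
  then obtain r where r: "\<And>w. w \<in> K \<Longrightarrow> good w (r w)" by metis
  have "\<exists>\<eta> \<eta>1 \<eta>2. C2 \<eta> \<eta>1 \<eta>2 \<and> (\<forall>s. \<bar>s\<bar> \<ge> a \<longrightarrow> \<eta> s = (0::real)) \<and> (\<forall>w\<in>W. \<forall>s. \<bar>s - w\<bar> < r w \<longrightarrow> \<eta> s = 1)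
      \<and> (\<forall>t. convolution scaleC (inv_fourier (\<lambda>s. complex_of_real (\<eta> s))) \<phi> t = 0)"
    if "finite W" "W \<subseteq> K" for W
    using that
  proof (induction W rule: finite_induct)
    case empty
    have "convolution scaleC (inv_fourier (\<lambda>s. complex_of_real 0)) \<phi> t = 0" for t
    proof (rule eq_0_if_complex_functionals_eq_0)
      fix l :: "'a \<Rightarrow> real" assume l: "bounded_linear l"
      have *: "C2 (\<lambda>s::real. complex_of_real 0) (\<lambda>_. 0) (\<lambda>_. 0)" "bounded_support (\<lambda>s::real. complex_of_real 0)"
        by (auto simp: bounded_support_def C2_const)
      show "complex_functional l (convolution scaleC (inv_fourier (\<lambda>s. complex_of_real 0)) \<phi> t) = 0"
        using complex_functional_convolution[OF l simple_limit_inv_fourier[OF C2_cc(1)[OF *]]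
            integrable_norm_inv_fourier[OF *] \<phi>, of t]
        by (simp add: inv_fourier_def[abs_def] scaleC.zero_right)
    qed
    then show ?case using C2_const[of "0::real"] by (intro exI[of _ "\<lambda>_. 0"]) auto
  next
    case (insert w W)
    then obtain \<eta> \<eta>1 \<eta>2 where \<eta>: "C2 \<eta> \<eta>1 \<eta>2" "\<And>s. \<bar>s\<bar> \<ge> a \<Longrightarrow> \<eta> s = (0::real)"
      "\<And>w s. w \<in> W \<Longrightarrow> \<bar>s - w\<bar> < r w \<Longrightarrow> \<eta> s = 1"
      "\<And>t. convolution scaleC (inv_fourier (\<lambda>s. complex_of_real (\<eta> s))) \<phi> t = 0"
      by auto
    have gw: "good w (r w)" using r insert.prems by blast
    then have rw: "r w > 0" by (simp add: good_def)
    define b where "b s = plateau ((1 / r w) * s + (- w / r w))" for s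
    obtain p1 p2 where p: "C2 plateau p1 p2" using ex_C2_plateau .
    obtain b1 b2 where b: "C2 b b1 b2"
      using C2_affine[OF p, of "1 / r w" "- w / r w"] unfolding b_def[abs_def] by blast
    have b_arg: "(1 / r w) * s + (- w / r w) = (s - w) / r w" for s by (simp add: diff_divide_distrib)
    have b_1: "b s = 1" if "\<bar>s - w\<bar> < r w" for s
      unfolding b_def b_arg using that rw by (intro plateau_eq_1) (simp add: abs_divide)
    have b_0: "b s = 0" if "\<bar>s - w\<bar> \<ge> 2 * r w" for s
      unfolding b_def b_arg using that rw by (intro plateau_eq_0) (simp add: abs_divide le_divide_eq)
    \<comment> \<open>Adding b (1 - \<eta>) leaves \<eta> unchanged where it is already 1 and raises
      it to 1 where b is 1.\<close>
    define h where "h s = b s * (1 + (-1) * \<eta> s)" for s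
    obtain h1 h2 where h: "C2 h h1 h2"
      using C2_bilinear[OF bounded_bilinear_mult b C2_add[OF C2_const[of 1] C2_bounded_linear[OF bounded_linear_mult_right[of "-1"] \<eta>(1)]]]
      unfolding h_def[abs_def] by blast
    have h0: "h s = 0" if "\<bar>s - w\<bar> \<ge> 2 * r w" for s using b_0[OF that] by (simp add: h_def)
    have bs: "bounded_support (\<lambda>s. complex_of_real (\<eta> s))" "bounded_support (\<lambda>s. complex_of_real (h s))"
    proof -
      show "bounded_support (\<lambda>s. complex_of_real (\<eta> s))"
        unfolding bounded_support_def using \<eta>(2) by (intro exI[of _ a]) simp
      show "bounded_support (\<lambda>s. complex_of_real (h s))"
        unfolding bounded_support_def using h0 by (intro exI[of _ "\<bar>w\<bar> + 2 * r w"]) auto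
    qed
    have C2c: "C2 (\<lambda>s. complex_of_real (\<eta> s)) (\<lambda>s. of_real (\<eta>1 s)) (\<lambda>s. of_real (\<eta>2 s))"
      "C2 (\<lambda>s. complex_of_real (h s)) (\<lambda>s. of_real (h1 s)) (\<lambda>s. of_real (h2 s))"
      by (rule C2_bounded_linear[OF bounded_linear_of_real \<eta>(1)],
          rule C2_bounded_linear[OF bounded_linear_of_real h])
    have h_kill: "convolution scaleC (inv_fourier (\<lambda>s. complex_of_real (h s))) \<phi> t = 0" for t
    proof -
      have *: "convolution scaleC (inv_fourier g) \<phi> t = 0"
        if "C2 g g1 g2" "\<And>s. \<bar>s - w\<bar> \<ge> 2 * r w \<Longrightarrow> g s = 0" for g g1 g2
        using gw that unfolding good_def by blast
      show ?thesis by (rule *[OF C2c(2)]) (simp add: h0)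
    qed
    have "C2 (\<lambda>s. \<eta> s + h s) (\<lambda>s. \<eta>1 s + h1 s) (\<lambda>s. \<eta>2 s + h2 s)" by (rule C2_add[OF \<eta>(1) h])
    moreover have "\<eta> s + h s = 0" if "\<bar>s\<bar> \<ge> a" for s
    proof -
      have "\<bar>s - w\<bar> \<ge> 2 * r w" using gw that unfolding good_def by (meson not_le)
      then show ?thesis using \<eta>(2)[OF that] h0 by simp
    qed
    moreover have "\<eta> s + h s = 1" if "w' \<in> insert w W" "\<bar>s - w'\<bar> < r w'" for w' s
      using that b_1 \<eta>(3) by (auto simp: h_def)
    moreover have "convolution scaleC (inv_fourier (\<lambda>s. complex_of_real (\<eta> s + h s))) \<phi> t = 0" for t
    proof -
      have "inv_fourier (\<lambda>s. complex_of_real (\<eta> s + h s)) =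
          (\<lambda>t. inv_fourier (\<lambda>s. complex_of_real (\<eta> s)) t + inv_fourier (\<lambda>s. complex_of_real (h s)) t)"
        using inv_fourier_add[OF C2_cc(1)[OF C2c(1) bs(1)] C2_cc(1)[OF C2c(2) bs(2)]] by (simp add: fun_eq_iff)
      then show ?thesis
        using convolution_add[OF simple_limit_inv_fourier[OF C2_cc(1)[OF C2c(1) bs(1)]] integrable_norm_inv_fourier[OF C2c(1) bs(1)]
            simple_limit_inv_fourier[OF C2_cc(1)[OF C2c(2) bs(2)]] integrable_norm_inv_fourier[OF C2c(2) bs(2)] \<phi>, of t]
          \<eta>(4) h_kill by simp
    qed
    ultimately show ?case by blast
  qed
  note ex = this
  have "K \<subseteq> (\<Union>w\<in>K. ball w (r w))" using r by (force simp: good_def)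
  then obtain W where W: "W \<subseteq> K" "finite W" "K \<subseteq> (\<Union>w\<in>W. ball w (r w))"
    using compactE_image[OF K(1), of K "\<lambda>w. ball w (r w)"] by auto
  obtain \<eta> \<eta>1 \<eta>2 where \<eta>: "C2 \<eta> \<eta>1 \<eta>2" "\<And>s. \<bar>s\<bar> \<ge> a \<Longrightarrow> \<eta> s = (0::real)"
    "\<And>w s. w \<in> W \<Longrightarrow> \<bar>s - w\<bar> < r w \<Longrightarrow> \<eta> s = 1"
    "\<And>t. convolution scaleC (inv_fourier (\<lambda>s. complex_of_real (\<eta> s))) \<phi> t = 0"
    using ex[OF W(2,1)] by blast
  have "open (\<Union>w\<in>W. ball w (r w))" by auto
  moreover have "\<eta> s = 1" if "s \<in> (\<Union>w\<in>W. ball w (r w))" for s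
    using that \<eta>(3) by (auto simp: dist_real_def abs_minus_commute)
  ultimately show thesis using that \<eta> W(3) by blast
qed

section \<open>Resolvents\<close>

text \<open>Complex linearity of the generator on its domain, from which the resolvent calculus
  below is developed.\<close>

locale closed_under_linear =
  fixes D :: "'x::complex_banach set" and A :: "'x \<Rightarrow> 'x"
  assumes add_mem: "x \<in> D \<Longrightarrow> y \<in> D \<Longrightarrow> x + y \<in> D"
    and A_add: "x \<in> D \<Longrightarrow> y \<in> D \<Longrightarrow> A (x + y) = A x + A y"
    and scaleC_mem: "x \<in> D \<Longrightarrow> c *\<^sub>C x \<in> D"
    and A_scaleC: "x \<in> D \<Longrightarrow> A (c *\<^sub>C x) = c *\<^sub>C A x"

lemma generator_linear:
  fixes D :: "'x::complex_banach set"
  assumes T: "C0_semigroup T" and gen: "is_generator D A T"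
  shows "closed_under_linear D A"
proof -
  let ?q = "\<lambda>x h. (1 / h) *\<^sub>R (blinfun_apply (T h) x - x)"
  have D: "x \<in> D \<longleftrightarrow> (\<exists>y. (?q x \<longlongrightarrow> y) (at_right 0))" for x
    using gen unfolding is_generator_def by blast
  have A: "(?q x \<longlongrightarrow> A x) (at_right 0)" if "x \<in> D" for x
    using gen that unfolding is_generator_def by blast
  have uniq: "x \<in> D \<and> A x = y" if "(?q x \<longlongrightarrow> y) (at_right 0)" for x y
    using that A[of x] D[of x] tendsto_unique[OF trivial_limit_at_right_real] by blast
  have add: "x + y \<in> D \<and> A (x + y) = A x + A y" if "x \<in> D" "y \<in> D" for x y
  proof (rule uniq)
    have "((\<lambda>h. ?q x h + ?q y h) \<longlongrightarrow> A x + A y) (at_right 0)"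
      by (intro tendsto_add A that)
    moreover have "?q x h + ?q y h = ?q (x + y) h" for h
      by (simp add: blinfun.add_right algebra_simps)
    ultimately show "(?q (x + y) \<longlongrightarrow> A x + A y) (at_right 0)" by simp
  qed
  have scale: "c *\<^sub>C x \<in> D \<and> A (c *\<^sub>C x) = c *\<^sub>C A x" if "x \<in> D" for c x
  proof (rule uniq)
    have "((\<lambda>h. c *\<^sub>C ?q x h) \<longlongrightarrow> c *\<^sub>C A x) (at_right 0)"
      by (intro scaleC.tendsto tendsto_const A that)
    moreover have "\<forall>\<^sub>F h in at_right 0. c *\<^sub>C ?q x h = ?q (c *\<^sub>C x) h"
    proof (rule eventually_at_right_less[THEN eventually_mono])
      fix h :: real assume "0 < h"
      then have "blinfun_apply (T h) (c *\<^sub>C x) = c *\<^sub>C blinfun_apply (T h) x"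
        using T by (simp add: C0_semigroup_def bounded_clinear_ops_def)
      then show "c *\<^sub>C ?q x h = ?q (c *\<^sub>C x) h"
        by (simp add: scaleC.diff_right scaleC_scaleR_commute)
    qed
    ultimately show "(?q (c *\<^sub>C x) \<longlongrightarrow> c *\<^sub>C A x) (at_right 0)"
      by (rule Lim_transform_eventually)
  qed
  show ?thesis by unfold_locales (use add scale in blast)+
qed

context closed_under_linear
begin

text \<open>Meaningful for z outside the spectrum, where the resolvent is bounded; elsewhere the
  value is an arbitrary operator.\<close>

definition res :: "complex \<Rightarrow> 'x \<Rightarrow>\<^sub>L 'x" where
  "res z = Blinfun (resolvent D A z)"

lemma res_apply:
  assumes "z \<notin> op_spectrum D A"
  shows "blinfun_apply (res z) y \<in> D" "z *\<^sub>C blinfun_apply (res z) y - A (blinfun_apply (res z) y) = y"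
    and "x \<in> D \<Longrightarrow> blinfun_apply (res z) (z *\<^sub>C x - A x) = x"
proof -
  have bij: "bij_betw (\<lambda>x. z *\<^sub>C x - A x) D UNIV" and bl: "bounded_linear (resolvent D A z)"
    using assms by (auto simp: op_spectrum_def)
  have eq: "blinfun_apply (res z) = resolvent D A z"
    unfolding res_def by (rule bounded_linear_Blinfun_apply[OF bl])
  show "blinfun_apply (res z) y \<in> D" "z *\<^sub>C blinfun_apply (res z) y - A (blinfun_apply (res z) y) = y"
    unfolding eq resolvent_def using bij
    by (auto simp: bij_betw_def intro: inv_into_into f_inv_into_f)
  show "x \<in> D \<Longrightarrow> blinfun_apply (res z) (z *\<^sub>C x - A x) = x"
    unfolding eq resolvent_def using bij inv_into_f_f[of "\<lambda>x. z *\<^sub>C x - A x" D x]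
    by (simp add: bij_betw_def)
qed

lemma onorm_resolvent: "z \<notin> op_spectrum D A \<Longrightarrow> onorm (resolvent D A z) = norm (res z)"
  by (simp add: res_def norm_blinfun.rep_eq op_spectrum_def bounded_linear_Blinfun_apply)

lemma res_scaleC:
  assumes z: "z \<notin> op_spectrum D A"
  shows "blinfun_apply (res z) (c *\<^sub>C y) = c *\<^sub>C blinfun_apply (res z) y"
proof -
  let ?x = "blinfun_apply (res z) y"
  have "z *\<^sub>C (c *\<^sub>C ?x) - A (c *\<^sub>C ?x) = c *\<^sub>C (z *\<^sub>C ?x - A ?x)"
    by (simp add: A_scaleC res_apply(1)[OF z] scaleC.diff_right scaleC_scaleC mult.commute)
  also have "\<dots> = c *\<^sub>C y" unfolding res_apply(2)[OF z] ..
  finally show ?thesis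
    using res_apply(3)[OF z scaleC_mem[OF res_apply(1)[OF z]], of c y] by simp
qed

lemma res_clinear: "z \<notin> op_spectrum D A \<Longrightarrow> res z \<in> bounded_clinear_ops"
  by (simp add: bounded_clinear_ops_def res_scaleC)

lemma resolvent_identity:
  assumes z: "z \<notin> op_spectrum D A" and w: "w \<notin> op_spectrum D A"
  shows "res z - res w = (w - z) *\<^sub>C (res z o\<^sub>L res w)"
proof (rule blinfun_eqI)
  fix y
  let ?x = "blinfun_apply (res w) y"
  have "z *\<^sub>C ?x - A ?x = (z - w) *\<^sub>C ?x + y"
    using res_apply(2)[OF w, of y] by (simp add: scaleC.diff_left algebra_simps)
  then have "?x = blinfun_apply (res z) ((z - w) *\<^sub>C ?x + y)"
    using res_apply(3)[OF z res_apply(1)[OF w], of y] by simp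
  also have "\<dots> = (z - w) *\<^sub>C blinfun_apply (res z) ?x + blinfun_apply (res z) y"
    by (simp add: blinfun.add_right res_scaleC[OF z])
  finally have "?x - blinfun_apply (res z) y = (z - w) *\<^sub>C blinfun_apply (res z) ?x"
    by (metis add_diff_cancel_right')
  then have "blinfun_apply (res z) y - ?x = - ((z - w) *\<^sub>C blinfun_apply (res z) ?x)"
    by (metis minus_diff_eq)
  then show "blinfun_apply (res z - res w) y = blinfun_apply ((w - z) *\<^sub>C (res z o\<^sub>L res w)) y"
    by (simp add: blinfun.diff_left scaleC_blinfun.rep_eq flip: scaleC.minus_left)
qed

text \<open>On the domain z - A = (1 - B)(w - A) with B = (w - z) R(w, A) of norm below 1. The
  contraction principle inverts 1 - B through the fixed points \<open>q y\<close>, and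
  \<open>q\<close> followed by \<open>res w\<close> is the resolvent at z.\<close>

lemma spectrum_stability:
  assumes w: "w \<notin> op_spectrum D A" and near: "cmod (z - w) * norm (res w) < 1"
  shows "z \<notin> op_spectrum D A"
proof -
  define B where "B = (w - z) *\<^sub>C res w"
  define b where "b = norm B"
  have b: "0 \<le> b" "b < 1" using near by (simp_all add: b_def B_def norm_scaleC norm_minus_commute)
  have "\<exists>!x. y + blinfun_apply B x = x" for y
  proof (rule banach_fix_type[OF b])
    show "\<forall>x x'. dist (y + blinfun_apply B x) (y + blinfun_apply B x') \<le> b * dist x x'"
      using norm_blinfun[of B] by (simp add: dist_norm b_def blinfun.diff_right[symmetric])
  qed
  then obtain q where q: "\<And>y. y + blinfun_apply B (q y) = q y"
    and q_unique: "\<And>x y. y + blinfun_apply B x = x \<Longrightarrow> x = q y"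
    by metis
  have q_linear: "q (x + y) = q x + q y" "q (r *\<^sub>R x) = r *\<^sub>R q x" for x y r
  proof -
    have "x + y + blinfun_apply B (q x + q y) = (x + blinfun_apply B (q x)) + (y + blinfun_apply B (q y))"
      by (simp add: blinfun.add_right)
    then show "q (x + y) = q x + q y" using q_unique unfolding q by metis
    have "r *\<^sub>R x + blinfun_apply B (r *\<^sub>R q x) = r *\<^sub>R (x + blinfun_apply B (q x))"
      by (simp add: blinfun.scaleR_right scaleR_add_right)
    then show "q (r *\<^sub>R x) = r *\<^sub>R q x" using q_unique unfolding q by metis
  qed
  have q_bound: "norm (q y) \<le> norm y * (1 / (1 - b))" for y
  proof -
    have "norm (q y) \<le> norm y + b * norm (q y)"
      using norm_triangle_ineq[of y "blinfun_apply B (q y)"] norm_blinfun[of B "q y"] q[of y]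
      by (simp add: b_def)
    then show ?thesis using b by (simp add: field_simps)
  qed
  have q_bl: "bounded_linear q"
    by (rule bounded_linear_intro[OF q_linear q_bound])
  have inverse: "x \<in> D \<and> z *\<^sub>C x - A x = y \<longleftrightarrow> x = blinfun_apply (res w) (q y)" for x y
  proof
    assume x: "x \<in> D \<and> z *\<^sub>C x - A x = y"
    define u where "u = w *\<^sub>C x - A x"
    have xu: "x = blinfun_apply (res w) u" using res_apply(3)[OF w, of x] x by (simp add: u_def)
    have "blinfun_apply B u = (w - z) *\<^sub>C x" by (simp add: B_def scaleC_blinfun.rep_eq xu[symmetric])
    then have "y + blinfun_apply B u = u"
      using x by (auto simp: u_def scaleC.diff_left)
    then show "x = blinfun_apply (res w) (q y)" using q_unique xu by metis
  next
    assume x: "x = blinfun_apply (res w) (q y)"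
    have "z *\<^sub>C x - A x = q y - (w - z) *\<^sub>C x"
      using res_apply(2)[OF w, of "q y"] x by (simp add: scaleC.diff_left algebra_simps)
    also have "(w - z) *\<^sub>C x = blinfun_apply B (q y)" by (simp add: B_def scaleC_blinfun.rep_eq x)
    also have "q y - blinfun_apply B (q y) = y" using q[of y] by (metis add_diff_cancel_right')
    finally show "x \<in> D \<and> z *\<^sub>C x - A x = y" using res_apply(1)[OF w] x by simp
  qed
  have bij: "bij_betw (\<lambda>x. z *\<^sub>C x - A x) D UNIV"
    unfolding bij_betw_def
  proof
    show "inj_on (\<lambda>x. z *\<^sub>C x - A x) D"
    proof (rule inj_onI)
      fix x x' assume "x \<in> D" "x' \<in> D" "z *\<^sub>C x - A x = z *\<^sub>C x' - A x'"
      then show "x = x'"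
        using inverse[of x "z *\<^sub>C x' - A x'"] inverse[of x' "z *\<^sub>C x' - A x'"] by simp
    qed
    have "y \<in> (\<lambda>x. z *\<^sub>C x - A x) ` D" for y
      using inverse[of "blinfun_apply (res w) (q y)" y] by (auto intro!: image_eqI)
    then show "(\<lambda>x. z *\<^sub>C x - A x) ` D = UNIV" by blast
  qed
  have "resolvent D A z = (\<lambda>y. blinfun_apply (res w) (q y))"
  proof
    fix y
    have "resolvent D A z y \<in> D" "z *\<^sub>C resolvent D A z y - A (resolvent D A z y) = y"
      unfolding resolvent_def using bij by (auto simp: bij_betw_def intro: inv_into_into f_inv_into_f)
    then show "resolvent D A z y = blinfun_apply (res w) (q y)" using inverse by blast
  qed
  then have "bounded_linear (resolvent D A z)"
    using bounded_linear_compose[OF blinfun.bounded_linear_right q_bl] by simp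
  then show ?thesis using bij by (simp add: op_spectrum_def)
qed

text \<open>With the product at most 1/2, the resolvent identity lets half of
  \<open>norm (res z)\<close> be absorbed, so \<open>norm (res z)\<close> is at most twice
  \<open>norm (res w)\<close>.\<close>

lemma res_near:
  assumes w: "w \<notin> op_spectrum D A" and near: "cmod (z - w) * norm (res w) \<le> 1 / 2"
  shows "z \<notin> op_spectrum D A" "norm (res z - res w) \<le> cmod (z - w) * (2 * (norm (res w))\<^sup>2)"
proof -
  show z: "z \<notin> op_spectrum D A" using spectrum_stability[OF w] near by simp
  have id: "norm (res z - res w) \<le> cmod (z - w) * (norm (res z) * norm (res w))"
    unfolding resolvent_identity[OF z w] norm_scaleC norm_minus_commute[of w]
    by (intro mult_left_mono norm_blinfun_compose) auto
  have "norm (res z) \<le> norm (res w) + norm (res z - res w)"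
    using norm_triangle_ineq[of "res w" "res z - res w"] by simp
  also have "\<dots> \<le> norm (res w) + (cmod (z - w) * norm (res w)) * norm (res z)"
    using id by (simp add: mult_ac)
  also have "\<dots> \<le> norm (res w) + 1 / 2 * norm (res z)"
    using near by (intro add_left_mono mult_right_mono) auto
  finally have "norm (res z) \<le> 2 * norm (res w)" by simp
  then have "norm (res z) * norm (res w) \<le> 2 * (norm (res w))\<^sup>2"
    using mult_right_mono[of "norm (res z)" "2 * norm (res w)" "norm (res w)"]
    by (simp add: power2_eq_square)
  then show "norm (res z - res w) \<le> cmod (z - w) * (2 * (norm (res w))\<^sup>2)"
    using id mult_left_mono[of "norm (res z) * norm (res w)" "2 * (norm (res w))\<^sup>2" "cmod (z - w)"] by auto
qed

text \<open>The resolvent restricted to the imaginary axis, as a function of the real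
  frequency.\<close>

definition rim :: "real \<Rightarrow> 'x \<Rightarrow>\<^sub>L 'x" where "rim s = res (\<i> * of_real s)"

definition imag_spectrum :: "real set" where
  "imag_spectrum = {s. \<i> * of_real s \<in> op_spectrum D A}"

lemma rim_near:
  assumes w: "w \<notin> imag_spectrum" and near: "\<bar>s - w\<bar> * norm (rim w) \<le> 1 / 2"
  shows "s \<notin> imag_spectrum" "norm (rim s - rim w) \<le> \<bar>s - w\<bar> * (2 * (norm (rim w))\<^sup>2)"
proof -
  have "\<i> * of_real s - \<i> * of_real w = \<i> * complex_of_real (s - w)" by (simp add: algebra_simps)
  then have "cmod (\<i> * of_real s - \<i> * of_real w) = \<bar>s - w\<bar>" by (simp only: norm_mult norm_ii norm_of_real) simp
  then show "s \<notin> imag_spectrum" "norm (rim s - rim w) \<le> \<bar>s - w\<bar> * (2 * (norm (rim w))\<^sup>2)"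
    using res_near[of "\<i> * of_real w" "\<i> * of_real s"] assms by (auto simp: rim_def imag_spectrum_def)
qed

lemma eventually_near:
  assumes "w \<notin> imag_spectrum" shows "\<forall>\<^sub>F s in nhds w. \<bar>s - w\<bar> * norm (rim w) \<le> 1 / 2"
proof -
  have "((\<lambda>s. \<bar>s - w\<bar> * norm (rim w)) \<longlongrightarrow> \<bar>w - w\<bar> * norm (rim w)) (nhds w)"
    by (intro tendsto_intros filterlim_ident)
  then have "\<forall>\<^sub>F s in nhds w. \<bar>s - w\<bar> * norm (rim w) < 1 / 2"
    by (rule order_tendstoD) simp
  then show ?thesis by eventually_elim simp
qed

lemma closed_imag_spectrum: "closed imag_spectrum"
proof -
  have "\<forall>\<^sub>F s in nhds w. s \<in> - imag_spectrum" if "w \<in> - imag_spectrum" for w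
    using eventually_near[of w] that rim_near(1)[of w] by (auto elim: eventually_mono)
  then have "open (- imag_spectrum)"
    by (subst open_subopen) (simp add: eventually_nhds subset_eq)
  then show ?thesis by (simp add: closed_def)
qed

lemma isCont_rim: assumes w: "w \<notin> imag_spectrum" shows "isCont rim w"
proof -
  have "((\<lambda>s. rim s - rim w) \<longlongrightarrow> 0) (nhds w)"
  proof (rule Lim_null_comparison)
    show "\<forall>\<^sub>F s in nhds w. norm (rim s - rim w) \<le> \<bar>s - w\<bar> * (2 * (norm (rim w))\<^sup>2)"
      using eventually_near[OF w] by eventually_elim (rule rim_near(2)[OF w])
    have "((\<lambda>s. \<bar>s - w\<bar> * (2 * (norm (rim w))\<^sup>2)) \<longlongrightarrow> \<bar>w - w\<bar> * (2 * (norm (rim w))\<^sup>2)) (nhds w)"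
      by (intro tendsto_intros filterlim_ident)
    then show "((\<lambda>s. \<bar>s - w\<bar> * (2 * (norm (rim w))\<^sup>2)) \<longlongrightarrow> 0) (nhds w)" by simp
  qed
  then have "(rim \<longlongrightarrow> rim w) (nhds w)" by (simp add: LIM_zero_iff)
  then show ?thesis unfolding isCont_def using tendsto_mono[OF at_within_le_nhds] by blast
qed

lemma rim_identity:
  assumes "s \<notin> imag_spectrum" "w \<notin> imag_spectrum"
  shows "rim s - rim w = (s - w) *\<^sub>R ((- \<i>) *\<^sub>C (rim s o\<^sub>L rim w))"
proof -
  have "\<i> * of_real w - \<i> * of_real s = of_real (s - w) * (- \<i>)" by (simp add: algebra_simps)
  then have eq: "(\<i> * of_real w - \<i> * of_real s) *\<^sub>C X = (s - w) *\<^sub>R ((- \<i>) *\<^sub>C X)" for X :: "'x \<Rightarrow>\<^sub>L 'x"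
    by (simp only: scaleC_scaleC[symmetric] scaleC_of_real)
  show ?thesis
    using resolvent_identity[of "\<i> * of_real s" "\<i> * of_real w", unfolded eq] assms
    by (simp only: rim_def imag_spectrum_def mem_Collect_eq not_False_eq_True)
qed

text \<open>By the resolvent identity the difference quotient equals -i R(w + h) R(w), so continuity
  of the resolvent already yields differentiability.\<close>

lemma rim_has_vector_derivative:
  assumes w: "w \<notin> imag_spectrum"
  shows "(rim has_vector_derivative (- \<i>) *\<^sub>C (rim w o\<^sub>L rim w)) (at w)"
  unfolding has_vector_derivative_def has_derivative_at
proof
  show "bounded_linear (\<lambda>h. h *\<^sub>R ((- \<i>) *\<^sub>C (rim w o\<^sub>L rim w)))"
    by (rule bounded_linear_scaleR_left)
  have "\<forall>\<^sub>F s in at w. s \<notin> imag_spectrum"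
    using eventually_near[OF w] rim_near(1)[OF w]
    by (auto simp: eventually_at_filter elim: eventually_mono)
  then have ev: "\<forall>\<^sub>F h in at 0. w + h \<notin> imag_spectrum"
    by (subst (asm) at_to_0) (simp add: eventually_filtermap add.commute)
  have lim: "((\<lambda>h. norm ((- \<i>) *\<^sub>C ((rim (w + h) - rim w) o\<^sub>L rim w))) \<longlongrightarrow> 0) (at 0)"
  proof -
    have "((\<lambda>h. rim (w + h)) \<longlongrightarrow> rim w) (at 0)"
      using isCont_rim[OF w] by (simp add: isCont_iff)
    then have "((\<lambda>h. norm ((- \<i>) *\<^sub>C ((rim (w + h) - rim w) o\<^sub>L rim w))) \<longlongrightarrow> norm ((- \<i>) *\<^sub>C ((rim w - rim w) o\<^sub>L rim w))) (at 0)"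
      by (intro tendsto_norm scaleC.tendsto bounded_bilinear.tendsto[OF bounded_bilinear_blinfun_compose] tendsto_intros)
    then show ?thesis by (simp add: scaleC.zero_right)
  qed
  show "(\<lambda>h. norm (rim (w + h) - rim w - h *\<^sub>R ((- \<i>) *\<^sub>C (rim w o\<^sub>L rim w))) / norm h) \<midarrow>0\<rightarrow> 0"
  proof (rule Lim_transform_eventually[OF lim])
    show "\<forall>\<^sub>F h in at 0. norm ((- \<i>) *\<^sub>C ((rim (w + h) - rim w) o\<^sub>L rim w)) =
        norm (rim (w + h) - rim w - h *\<^sub>R ((- \<i>) *\<^sub>C (rim w o\<^sub>L rim w))) / norm h"
      using ev eventually_neq_at_within[of 0]
    proof eventually_elim
      case (elim h)
      have "rim (w + h) - rim w - h *\<^sub>R ((- \<i>) *\<^sub>C (rim w o\<^sub>L rim w))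
          = h *\<^sub>R ((- \<i>) *\<^sub>C (rim (w + h) o\<^sub>L rim w)) - h *\<^sub>R ((- \<i>) *\<^sub>C (rim w o\<^sub>L rim w))"
        using rim_identity[OF elim(1) w] by simp
      also have "\<dots> = h *\<^sub>R ((- \<i>) *\<^sub>C ((rim (w + h) o\<^sub>L rim w) - (rim w o\<^sub>L rim w)))"
        by (simp only: scaleC.diff_right scaleR_diff_right)
      also have "(rim (w + h) o\<^sub>L rim w) - (rim w o\<^sub>L rim w) = (rim (w + h) - rim w) o\<^sub>L rim w"
        by (rule bounded_bilinear.diff_left[OF bounded_bilinear_blinfun_compose, symmetric])
      finally have "rim (w + h) - rim w - h *\<^sub>R ((- \<i>) *\<^sub>C (rim w o\<^sub>L rim w))
          = h *\<^sub>R ((- \<i>) *\<^sub>C ((rim (w + h) - rim w) o\<^sub>L rim w))" .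
      then show ?case using elim(2) by simp
    qed
  qed
qed

definition rim1 :: "real \<Rightarrow> 'x \<Rightarrow>\<^sub>L 'x" where "rim1 s = (- \<i>) *\<^sub>C (rim s o\<^sub>L rim s)"

text \<open>Off the spectrum this is -2 times the cube of \<open>rim s\<close>, kept in the shape
  that the product rule produces.\<close>

definition rim2 :: "real \<Rightarrow> 'x \<Rightarrow>\<^sub>L 'x" where
  "rim2 s = (- \<i>) *\<^sub>C ((rim s o\<^sub>L rim1 s) + (rim1 s o\<^sub>L rim s))"

lemma rim1_has_vector_derivative:
  assumes "w \<notin> imag_spectrum"
  shows "(rim1 has_vector_derivative rim2 w) (at w)"
proof -
  have d: "(rim has_vector_derivative rim1 w) (at w)"
    unfolding rim1_def by (rule rim_has_vector_derivative[OF assms])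
  have "((\<lambda>s. rim s o\<^sub>L rim s) has_vector_derivative ((rim w o\<^sub>L rim1 w) + (rim1 w o\<^sub>L rim w))) (at w)"
    by (rule bounded_bilinear.has_vector_derivative[OF bounded_bilinear_blinfun_compose d d])
  from bounded_linear.has_vector_derivative[OF scaleC.bounded_linear_right this, of "- \<i>"]
  show ?thesis by (simp add: rim1_def[abs_def] rim2_def)
qed

lemma norm_rim1: "norm (rim1 s) \<le> (norm (rim s))\<^sup>2"
  unfolding rim1_def norm_scaleC using norm_blinfun_compose[of "rim s" "rim s"]
  by (simp add: power2_eq_square)

lemma norm_rim2: "norm (rim2 s) \<le> 2 * norm (rim s) ^ 3"
proof -
  have "norm (rim2 s) \<le> norm (rim s o\<^sub>L rim1 s) + norm (rim1 s o\<^sub>L rim s)"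
    unfolding rim2_def norm_scaleC by (simp add: norm_triangle_ineq)
  also have "\<dots> \<le> 2 * (norm (rim s) * norm (rim1 s))"
    using norm_blinfun_compose[of "rim s" "rim1 s"] norm_blinfun_compose[of "rim1 s" "rim s"]
    by (simp add: mult.commute)
  also have "\<dots> \<le> 2 * (norm (rim s) * (norm (rim s))\<^sup>2)"
    by (intro mult_left_mono norm_rim1) auto
  finally show ?thesis by (simp add: power2_eq_square power3_eq_cube mult.assoc)
qed

lemma isCont_rim12:
  assumes "w \<notin> imag_spectrum" shows "isCont rim1 w" "isCont rim2 w"
proof -
  show c1: "isCont rim1 w" using rim1_has_vector_derivative[OF assms] by (rule has_vector_derivative_continuous)
  show "isCont rim2 w"
    unfolding rim2_def isCont_def
    by (intro scaleC.tendsto tendsto_const tendsto_add bounded_bilinear.tendsto[OF bounded_bilinear_blinfun_compose]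
        c1[unfolded isCont_def] isCont_rim[OF assms, unfolded isCont_def])
qed

text \<open>On the imaginary spectrum \<open>rim\<close> is a junk value, which the cutoff multiplies by zero.\<close>

lemma C2_cutoff_resolvent:
  assumes \<psi>: "C2 \<psi> \<psi>1 \<psi>2" and U: "open U" "imag_spectrum \<subseteq> U" "\<And>s. s \<in> U \<Longrightarrow> \<psi> s = 0"
  shows "C2 (\<lambda>s. \<psi> s *\<^sub>R rim s) (\<lambda>s. \<psi> s *\<^sub>R rim1 s + \<psi>1 s *\<^sub>R rim s)
    (\<lambda>s. (\<psi> s *\<^sub>R rim2 s + \<psi>1 s *\<^sub>R rim1 s) + (\<psi>1 s *\<^sub>R rim1 s + \<psi>2 s *\<^sub>R rim s))"
proof -
  \<comment> \<open>Since U is open, all derivatives of a function vanishing on U vanish there as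
    well. Every term containing \<open>rim\<close> or its derivatives is thus 0 on U whatever their
    values.\<close>
  have zero_deriv: "f' s = 0" if "\<And>s. (f has_vector_derivative f' s) (at s)" "\<And>s. s \<in> U \<Longrightarrow> f s = 0" "s \<in> U"
    for f f' :: "real \<Rightarrow> real" and s
  proof -
    have "((\<lambda>_. 0) has_vector_derivative f' s) (at s)"
      by (rule has_vector_derivative_transform_within_open[OF that(1) U(1) that(3)]) (rule that(2))
    then show ?thesis using vector_derivative_unique_at has_vector_derivative_const by blast
  qed
  have \<psi>1: "\<psi>1 s = 0" if "s \<in> U" for s
    using \<psi> U(3) that by (intro zero_deriv[of \<psi> \<psi>1]) (auto simp: C2_def)
  have \<psi>2: "\<psi>2 s = 0" if "s \<in> U" for s
    using \<psi> \<psi>1 that by (intro zero_deriv[of \<psi>1 \<psi>2]) (auto simp: C2_def)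
  have on_U: "(h has_vector_derivative 0) (at s)" if "s \<in> U" "\<And>s. s \<in> U \<Longrightarrow> h s = 0" for h :: "real \<Rightarrow> 'x \<Rightarrow>\<^sub>L 'x" and s
    by (rule has_vector_derivative_transform_within_open[OF has_vector_derivative_const U(1) that(1)])
      (simp add: that(2))
  have \<psi>d: "(\<psi> has_vector_derivative \<psi>1 s) (at s)" "(\<psi>1 has_vector_derivative \<psi>2 s) (at s)" for s
    using \<psi> by (auto simp: C2_def)
  note prod = bounded_bilinear.has_vector_derivative[OF bounded_bilinear_scaleR]
  show ?thesis
    unfolding C2_def
  proof (intro conjI allI)
    fix s
    show "((\<lambda>s. \<psi> s *\<^sub>R rim s) has_vector_derivative \<psi> s *\<^sub>R rim1 s + \<psi>1 s *\<^sub>R rim s) (at s)"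
    proof (cases "s \<in> U")
      case True
      then show ?thesis using on_U[OF True, of "\<lambda>s. \<psi> s *\<^sub>R rim s"] by (simp add: U(3) \<psi>1)
    next
      case False
      then have "s \<notin> imag_spectrum" using U(2) by blast
      then show ?thesis using prod[OF \<psi>d(1) rim_has_vector_derivative] by (simp add: rim1_def)
    qed
    show "((\<lambda>s. \<psi> s *\<^sub>R rim1 s + \<psi>1 s *\<^sub>R rim s) has_vector_derivative
        (\<psi> s *\<^sub>R rim2 s + \<psi>1 s *\<^sub>R rim1 s) + (\<psi>1 s *\<^sub>R rim1 s + \<psi>2 s *\<^sub>R rim s)) (at s)"
    proof (cases "s \<in> U")
      case True
      then show ?thesis
        using on_U[OF True, of "\<lambda>s. \<psi> s *\<^sub>R rim1 s + \<psi>1 s *\<^sub>R rim s"] by (simp add: U(3) \<psi>1 \<psi>2)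
    next
      case False
      then have s: "s \<notin> imag_spectrum" using U(2) by blast
      show ?thesis
        using has_vector_derivative_add[OF prod[OF \<psi>d(1) rim1_has_vector_derivative[OF s]]
            prod[OF \<psi>d(2) rim_has_vector_derivative[OF s, folded rim1_def]]] .
    qed
  next
    let ?h = "\<lambda>s. (\<psi> s *\<^sub>R rim2 s + \<psi>1 s *\<^sub>R rim1 s) + (\<psi>1 s *\<^sub>R rim1 s + \<psi>2 s *\<^sub>R rim s)"
    have "isCont ?h s" for s
    proof (cases "s \<in> U")
      case True
      then show ?thesis using on_U[OF True, of ?h]
        by (intro has_vector_derivative_continuous[of _ 0]) (simp add: U(3) \<psi>1 \<psi>2)
    next
      case False
      then have s: "s \<notin> imag_spectrum" using U(2) by blast
      have "isCont \<psi> s" "isCont \<psi>1 s" "isCont \<psi>2 s"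
        using C2_continuous[OF \<psi>] by (auto simp: continuous_on_eq_continuous_at)
      then show ?thesis using isCont_rim[OF s] isCont_rim12[OF s] by (intro continuous_intros)
    qed
    then show "continuous_on UNIV ?h" by (simp add: continuous_on_eq_continuous_at)
  qed
qed

end

section \<open>Kernels of slowly decaying symbols\<close>

lemma integrable_even_extension:
  fixes f :: "real \<Rightarrow> real"
  assumes [measurable]: "f \<in> borel_measurable borel"
    and f: "integrable lborel (\<lambda>t. indicator {0..} t * f t)"
  shows "integrable lborel (\<lambda>t. f \<bar>t\<bar>)"
proof (rule Bochner_Integration.integrable_bound)
  show "integrable lborel (\<lambda>t. norm (indicator {0..} t * f t) + norm (indicator {0..} (0 - t) * f (0 - t)))"
    by (intro Bochner_Integration.integrable_add integrable_norm f lborel_integrable_shift(1)[OF f])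
qed (auto simp: indicator_def abs_if)

lemma integrable_one_plus_abs_powr:
  fixes p :: real
  assumes "p > 1"
  shows "integrable lborel (\<lambda>s::real. (1 + \<bar>s\<bar>) powr (- p))"
proof (rule integrable_even_extension[where f = "\<lambda>s. (1 + s) powr (- p)"])
  let ?F = "\<lambda>s. - (1 / (p - 1)) * (1 + s) powr (1 - p)"
  have "(\<integral>\<^sup>+s. ennreal ((1 + s) powr (- p)) * indicator {0..} s \<partial>lborel) = 0 - ?F 0"
  proof (rule nn_integral_FTC_atLeast)
    show "(?F has_real_derivative (1 + s) powr (- p)) (at s)" if "0 \<le> s" for s
    proof -
      have "((\<lambda>s. (1 + s) powr (1 - p)) has_real_derivative (1 - p) * (1 + s) powr (1 - p - 1)) (at s)"
        using that by (auto intro!: derivative_eq_intros)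
      note DERIV_cmult[OF this, of "- (1 / (p - 1))"]
      moreover have "- (1 / (p - 1)) * ((1 - p) * X) = X" for X :: real using assms by (simp add: field_simps)
      moreover have "1 - p - 1 = - p" by simp
      ultimately show ?thesis by (simp only:)
    qed
    have "((\<lambda>s. (1 + s) powr (1 - p)) \<longlongrightarrow> 0) at_top"
      using assms by (intro tendsto_neg_powr filterlim_tendsto_add_at_top[OF tendsto_const filterlim_ident]) auto
    from tendsto_mult_right_zero[OF this, of "- (1 / (p - 1))"]
    show "(?F \<longlongrightarrow> 0) at_top" .
  qed auto
  then have "(\<integral>\<^sup>+s. ennreal (indicator {0..} s * (1 + s) powr (- p)) \<partial>lborel) < \<infinity>"
    by (simp add: indicator_mult_ennreal mult.commute ennreal_mult' flip: ennreal_indicator)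
  then show "integrable lborel (\<lambda>s. indicator {0..} s * (1 + s) powr (- p))"
    by (intro integrableI_nonneg) auto
qed auto

lemma integrable_abs_powr_near_0:
  fixes b :: real
  assumes "b > -1"
  shows "integrable lborel (\<lambda>t::real. indicator {-1..1} t * \<bar>t\<bar> powr b)"
proof -
  have "(\<lambda>t. t powr b) integrable_on {0..1}"
    using has_integral_powr_from_0[OF assms, of 1] by (auto simp: integrable_on_def)
  then have "set_integrable lebesgue {0..1} (\<lambda>t. t powr b)"
    by (rule nonnegative_absolutely_integrable_1) auto
  then have "integrable lborel (\<lambda>t. indicator {0..1} t *\<^sub>R t powr b)"
    unfolding set_integrable_def by (subst (asm) integrable_completion) auto
  moreover have "(\<lambda>t. indicator {0..1} t *\<^sub>R t powr b) = (\<lambda>t. indicator {0..} t * (indicator {..1} t * t powr b))"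
    by (auto simp: fun_eq_iff indicator_def)
  ultimately have "integrable lborel (\<lambda>t. indicator {..1} \<bar>t\<bar> * \<bar>t\<bar> powr b)"
    by (intro integrable_even_extension[where f = "\<lambda>t. indicator {..1} t * t powr b"]) auto
  moreover have "indicator {..1} \<bar>t\<bar> = (indicator {-1..1} t :: real)" for t :: real
    by (auto simp: indicator_def)
  ultimately show ?thesis by simp
qed

text \<open>Interpolation between the trivial bound 2 for large x and the Lipschitz bound |x| for
  small x.\<close>

lemma norm_cis_minus_1_le_powr:
  assumes "0 < \<gamma>" "\<gamma> \<le> 1"
  shows "cmod (cis x - 1) \<le> 2 * \<bar>x\<bar> powr \<gamma>"
proof (cases "\<bar>x\<bar> \<ge> 1")
  case True
  have "cmod (cis x - 1) \<le> 2" using norm_triangle_ineq4[of "cis x" 1] by simp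
  also have "2 \<le> 2 * \<bar>x\<bar> powr \<gamma>" using True assms by (simp add: ge_one_powr_ge_zero)
  finally show ?thesis .
next
  case False
  have "cmod (cis x - 1) \<le> \<bar>x\<bar>" using iexp_approx1[of x 0] by (simp add: cis_conv_exp)
  also have "\<bar>x\<bar> \<le> \<bar>x\<bar> powr \<gamma>"
    using False assms powr_mono'[of \<gamma> 1 "\<bar>x\<bar>"] by (cases "x = 0") auto
  also have "\<dots> \<le> 2 * \<bar>x\<bar> powr \<gamma>" by simp
  finally show ?thesis .
qed

lemma inv_fourier_diff:
  assumes "cc f" "cc g"
  shows "cc (\<lambda>s. f s - g s)" "inv_fourier (\<lambda>s. f s - g s) t = inv_fourier f t - inv_fourier g t"
proof -
  have g: "cc (\<lambda>s. - g s)"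
    using assms(2) unfolding cc_def by (auto intro: continuous_intros bounded_support_mono)
  have "inv_fourier (\<lambda>s. f s + - g s) t = inv_fourier f t + inv_fourier (\<lambda>s. - g s) t"
    by (rule inv_fourier_add[OF assms(1) g])
  also have "inv_fourier (\<lambda>s. - g s) t = - inv_fourier g t"
    by (rule inv_fourier_linear[OF bounded_linear_minus[OF bounded_linear_ident] _ assms(2)])
      (simp add: scaleC.minus_right)
  finally show "inv_fourier (\<lambda>s. f s - g s) t = inv_fourier f t - inv_fourier g t" by simp
  show "cc (\<lambda>s. f s - g s)"
    using assms g bounded_support_add[of f "\<lambda>s. - g s"] unfolding cc_def by (auto intro: continuous_on_diff)
qed

text \<open>The mean of a derivative vanishes, so its transform is Hoelder continuous with value 0 at 0.\<close>

lemma inv_fourier_derivative_holder: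
  assumes f: "\<And>s. (f has_vector_derivative f1 s) (at s)" "bounded_support f" and f1: "continuous_on UNIV f1"
    and \<gamma>: "0 < \<gamma>" "\<gamma> \<le> 1" and g: "integrable lborel g" "\<And>s. \<bar>s\<bar> powr \<gamma> * norm (f1 s) \<le> g s"
  shows "norm (inv_fourier f1 t) \<le> 2 * \<bar>t\<bar> powr \<gamma> * (LINT s|lborel. g s)"
proof -
  have cf1: "cc f1" using bounded_support_derivative[OF f(2,1)] f1 by (simp add: cc_def)
  have "inv_fourier f1 0 = 0"
    using inv_fourier_derivative[OF f f1, of 0] by (simp add: scaleC.zero_left)
  define h where "h s = (cis (t * s) - 1) *\<^sub>C f1 s" for s
  have cch: "cc h"
    using cf1 unfolding cc_def h_def
    by (auto intro!: continuous_intros elim: bounded_support_mono simp: scaleC.zero_right)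
  have "inv_fourier f1 t = inv_fourier f1 t - inv_fourier f1 0" by (simp add: \<open>inv_fourier f1 0 = 0\<close>)
  also have "\<dots> = inv_fourier h 0"
  proof -
    have "inv_fourier f1 t = inv_fourier (\<lambda>s. cis (t * s) *\<^sub>C f1 s) 0" by (simp add: inv_fourier_def)
    then show ?thesis
      using inv_fourier_diff(2)[OF cc_cis[OF cf1, of t] cf1, of 0]
      by (simp add: h_def[abs_def] scaleC.diff_left)
  qed
  also have "norm \<dots> \<le> (LINT s|lborel. 2 * \<bar>t\<bar> powr \<gamma> * g s)"
  proof (rule inv_fourier_bound[OF cch])
    show "integrable lborel (\<lambda>s. 2 * \<bar>t\<bar> powr \<gamma> * g s)" using g(1) by simp
    fix s
    have "norm (h s) \<le> 2 * \<bar>t * s\<bar> powr \<gamma> * norm (f1 s)"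
      unfolding h_def norm_scaleC by (intro mult_right_mono norm_cis_minus_1_le_powr \<gamma>) auto
    also have "\<dots> = 2 * \<bar>t\<bar> powr \<gamma> * (\<bar>s\<bar> powr \<gamma> * norm (f1 s))" by (simp add: abs_mult powr_mult)
    also have "\<dots> \<le> 2 * \<bar>t\<bar> powr \<gamma> * g s" by (intro mult_left_mono g) auto
    finally show "norm (h s) \<le> 2 * \<bar>t\<bar> powr \<gamma> * g s" .
  qed
  finally show ?thesis by simp
qed

text \<open>\<open>Suc n\<close> avoids a division by 0, and the added 0 keeps the affine shape of
  \<open>C2_affine\<close>.\<close>

definition cutoff :: "nat \<Rightarrow> real \<Rightarrow> real" where
  "cutoff n s = plateau ((1 / real (Suc n)) * s + 0)"

lemma bounded_support_cutoff: "bounded_support (cutoff n)"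
proof -
  have "cutoff n s = 0" if "\<bar>s\<bar> > 2 * real (Suc n)" for s
    unfolding cutoff_def using that by (intro plateau_eq_0) (simp add: abs_divide le_divide_eq)
  then show ?thesis unfolding bounded_support_def by blast
qed

lemma cutoff_eq_1: "\<bar>s\<bar> \<le> real n \<Longrightarrow> cutoff n s = 1"
  unfolding cutoff_def by (intro plateau_eq_1) (simp add: abs_divide divide_le_eq)

lemma cutoff_bounded_support:
  fixes f :: "real \<Rightarrow> 'c::real_normed_vector"
  shows "bounded_support (\<lambda>s. cutoff n s *\<^sub>R f s)"
  using bounded_support_cutoff[of n] by (rule bounded_support_mono) simp

text \<open>Both derivatives get the same weight, integrable because 2 \<theta> > 1. The bound
  \<theta> \<le> 1 concerns the truncation: the derivatives of the cutoff contribute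
  \<open>H\<close> times a factor of order 1 / (1 + |s|), and the exponent \<theta> + 1 must not be
  smaller than 2 \<theta>.\<close>

locale decaying_symbol =
  fixes H H1 H2 :: "real \<Rightarrow> 'b::complex_banach" and \<theta> C :: real
  assumes C2: "C2 H H1 H2" and \<theta>: "1 / 2 < \<theta>" "\<theta> \<le> 1" and C: "C \<ge> 0"
    and H_le: "norm (H s) \<le> C * (1 + \<bar>s\<bar>) powr (- \<theta>)"
    and H1_le: "norm (H1 s) \<le> C * (1 + \<bar>s\<bar>) powr (- (2 * \<theta>))"
    and H2_le: "norm (H2 s) \<le> C * (1 + \<bar>s\<bar>) powr (- (2 * \<theta>))"
begin

definition w :: "real \<Rightarrow> real" where "w s = (1 + \<bar>s\<bar>) powr (- (2 * \<theta>))"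

definition kernel :: "nat \<Rightarrow> real \<Rightarrow> 'b" where
  "kernel n = inv_fourier (\<lambda>s. cutoff n s *\<^sub>R H s)"

lemma integrable_w: "integrable lborel w"
  unfolding w_def using \<theta> by (intro integrable_one_plus_abs_powr) auto

lemma w_nonneg: "w s \<ge> 0" by (simp add: w_def)

text \<open>The point is uniformity in n. Differentiating the cutoff costs a factor 1 / (n + 1) and
  leaves a function living where |s| is of order n at most, so the result is bounded by a constant
  over 1 + |s| that does not depend on n.\<close>

lemma ex_cut_derivatives:
  obtains F1 F2 Q where "\<And>n. C2 (\<lambda>s. cutoff n s *\<^sub>R H s) (F1 n) (F2 n)" "Q \<ge> 0"
    "\<And>n s. norm (F1 n s) \<le> Q * w s" "\<And>n s. norm (F2 n s) \<le> Q * w s"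
    "\<And>n s. \<bar>s\<bar> \<le> real n \<Longrightarrow> F1 n s = H1 s"
proof -
  obtain p1 p2 where p: "C2 plateau p1 p2" using ex_C2_plateau .
  note cc = C2_cc[OF p bounded_support_plateau]
  have *: "\<exists>B\<ge>0. \<forall>x. (1 + \<bar>x\<bar>) * \<bar>q x\<bar> \<le> B" if "cc q" for q :: "real \<Rightarrow> real"
  proof -
    have c: "cc (\<lambda>x. (1 + \<bar>x\<bar>) * q x)"
      using that unfolding cc_def by (auto intro!: continuous_intros elim: bounded_support_mono)
    obtain B where "\<And>x. norm ((1 + \<bar>x\<bar>) * q x) \<le> B" "B \<ge> 0" using cc_bounded[OF c] by blast
    then show ?thesis by (auto simp: abs_mult)
  qed
  obtain B0 B1 B2 where B012: "B0 \<ge> 0" "B1 \<ge> 0" "B2 \<ge> 0" "\<And>x. (1 + \<bar>x\<bar>) * \<bar>plateau x\<bar> \<le> B0"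
    "\<And>x. (1 + \<bar>x\<bar>) * \<bar>p1 x\<bar> \<le> B1" "\<And>x. (1 + \<bar>x\<bar>) * \<bar>p2 x\<bar> \<le> B2"
  proof -
    obtain B0 B1 B2 where "B0 \<ge> 0 \<and> (\<forall>x. (1 + \<bar>x\<bar>) * \<bar>plateau x\<bar> \<le> B0)"
      "B1 \<ge> 0 \<and> (\<forall>x. (1 + \<bar>x\<bar>) * \<bar>p1 x\<bar> \<le> B1)" "B2 \<ge> 0 \<and> (\<forall>x. (1 + \<bar>x\<bar>) * \<bar>p2 x\<bar> \<le> B2)"
      using *[OF cc(1)] *[OF cc(2)] *[OF cc(3)] by blast
    then show thesis using that by blast
  qed
  define B where "B = B0 + B1 + B2"
  have B: "B \<ge> 0" "\<And>x. (1 + \<bar>x\<bar>) * \<bar>plateau x\<bar> \<le> B"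
    "\<And>x. (1 + \<bar>x\<bar>) * \<bar>p1 x\<bar> \<le> B" "\<And>x. (1 + \<bar>x\<bar>) * \<bar>p2 x\<bar> \<le> B"
  proof -
    fix x
    show "(1 + \<bar>x\<bar>) * \<bar>plateau x\<bar> \<le> B" "(1 + \<bar>x\<bar>) * \<bar>p1 x\<bar> \<le> B" "(1 + \<bar>x\<bar>) * \<bar>p2 x\<bar> \<le> B"
      unfolding B_def using B012(1-3) B012(4-6)[of x] by linarith+
  qed (use B012(1-3) in \<open>simp add: B_def\<close>)
  let ?a = "\<lambda>n s. (1 / real (Suc n)) * s + 0"
  let ?c1 = "\<lambda>n s. (1 / real (Suc n)) *\<^sub>R p1 (?a n s)"
  let ?c2 = "\<lambda>n s. ((1 / real (Suc n)) * (1 / real (Suc n))) *\<^sub>R p2 (?a n s)"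
  define F1 where "F1 n s = cutoff n s *\<^sub>R H1 s + ?c1 n s *\<^sub>R H s" for n s
  define F2 where "F2 n s = (cutoff n s *\<^sub>R H2 s + ?c1 n s *\<^sub>R H1 s) + (?c1 n s *\<^sub>R H1 s + ?c2 n s *\<^sub>R H s)" for n s
  have F: "C2 (\<lambda>s. cutoff n s *\<^sub>R H s) (F1 n) (F2 n)" for n
    unfolding F1_def[abs_def] F2_def[abs_def] cutoff_def
    by (rule C2_scaleR[OF C2_affine[OF p, of "1 / real (Suc n)" 0] C2])
  have cut_le: "\<bar>cutoff n s\<bar> \<le> B" for n s
  proof -
    have "1 * \<bar>plateau x\<bar> \<le> (1 + \<bar>x\<bar>) * \<bar>plateau x\<bar>" for x by (intro mult_right_mono) auto
    then show ?thesis using B(2) unfolding cutoff_def by (metis mult_1 order_trans)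
  qed
  \<comment> \<open>With m = n + 1 the bound for q at s / m, multiplied by m, has the weight m +
    |s|, which is at least 1 + |s|.\<close>
  have scaled: "(1 / real (Suc n)) * \<bar>q (?a n s)\<bar> \<le> B / (1 + \<bar>s\<bar>)" if "\<And>x. (1 + \<bar>x\<bar>) * \<bar>q x\<bar> \<le> B" for q :: "real \<Rightarrow> real" and n s
  proof -
    let ?m = "real (Suc n)"
    have m: "?m \<ge> 1" by simp
    have "(?m + \<bar>s\<bar>) * ((1 / ?m) * \<bar>q (?a n s)\<bar>) = (1 + \<bar>?a n s\<bar>) * \<bar>q (?a n s)\<bar>"
      using m by (simp add: abs_divide field_simps)
    also have "\<dots> \<le> B" by (rule that)
    finally have "(?m + \<bar>s\<bar>) * ((1 / ?m) * \<bar>q (?a n s)\<bar>) \<le> B" .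
    moreover have "(1 + \<bar>s\<bar>) * ((1 / ?m) * \<bar>q (?a n s)\<bar>) \<le> (?m + \<bar>s\<bar>) * ((1 / ?m) * \<bar>q (?a n s)\<bar>)"
      using m by (intro mult_right_mono) auto
    ultimately have "(1 + \<bar>s\<bar>) * ((1 / ?m) * \<bar>q (?a n s)\<bar>) \<le> B" by linarith
    then show ?thesis by (simp add: pos_le_divide_eq mult.commute add_pos_nonneg)
  qed
  have c1: "\<bar>?c1 n s\<bar> \<le> B / (1 + \<bar>s\<bar>)" for n s
    using scaled[OF B(3), of n s] by (simp add: abs_mult abs_divide)
  have c2: "\<bar>?c2 n s\<bar> \<le> B / (1 + \<bar>s\<bar>)" for n s
  proof -
    have "\<bar>?c2 n s\<bar> = (1 / real (Suc n)) * ((1 / real (Suc n)) * \<bar>p2 (?a n s)\<bar>)"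
      by (simp add: abs_mult abs_divide)
    also have "\<dots> \<le> 1 * ((1 / real (Suc n)) * \<bar>p2 (?a n s)\<bar>)" by (intro mult_right_mono) auto
    finally show ?thesis using scaled[OF B(4), of n s] by simp
  qed
  have B_le: "B / (1 + \<bar>s\<bar>) \<le> B" for s :: real using B(1) by (simp add: divide_le_eq mult_le_cancel_left1)
  have h_le: "B / (1 + \<bar>s\<bar>) * (C * (1 + \<bar>s\<bar>) powr (- \<theta>)) \<le> B * (C * w s)" for s
  proof -
    have "(1 + \<bar>s\<bar>) powr (- \<theta>) / (1 + \<bar>s\<bar>) = (1 + \<bar>s\<bar>) powr (- \<theta> - 1)"
      by (simp add: powr_diff)
    also have "\<dots> \<le> w s" unfolding w_def using \<theta> by (intro powr_mono) auto
    finally have "(B * C) * ((1 + \<bar>s\<bar>) powr (- \<theta>) / (1 + \<bar>s\<bar>)) \<le> (B * C) * w s"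
      using B(1) C by (intro mult_left_mono) auto
    then show ?thesis by simp
  qed
  have H12: "norm (H1 s) \<le> C * w s" "norm (H2 s) \<le> C * w s" for s
    using H1_le H2_le by (auto simp: w_def)
  have nn: "C * w s \<ge> 0" for s using C w_nonneg by simp
  have t1: "norm (cutoff n s *\<^sub>R X) \<le> B * (C * w s)" if "norm X \<le> C * w s" for n s and X :: 'b
    unfolding norm_scaleR using cut_le that B(1) by (intro mult_mono) auto
  have t2: "norm (?c1 n s *\<^sub>R X) \<le> B * (C * w s)" if "norm X \<le> C * w s" for n s and X :: 'b
    unfolding norm_scaleR using order_trans[OF c1 B_le] that B(1) by (intro mult_mono) auto
  have t3: "norm (c *\<^sub>R H s) \<le> B * (C * w s)" if "\<bar>c\<bar> \<le> B / (1 + \<bar>s\<bar>)" for c s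
    unfolding norm_scaleR using mult_mono[OF that H_le[of s]] B(1) h_le[of s] by simp
  show thesis
  proof (rule that[of F1 F2 "4 * B * C"])
    show "C2 (\<lambda>s. cutoff n s *\<^sub>R H s) (F1 n) (F2 n)" for n by (rule F)
    show "0 \<le> 4 * B * C" using B(1) C by simp
    fix n s
    have "0 \<le> B * (C * w s)" using B(1) nn by simp
    then show "norm (F1 n s) \<le> 4 * B * C * w s"
      unfolding F1_def using norm_triangle_ineq[of "cutoff n s *\<^sub>R H1 s" "?c1 n s *\<^sub>R H s"]
        t1[OF H12(1), of n s] t3[OF c1, of n s] by (simp add: mult.assoc)
    show "norm (F2 n s) \<le> 4 * B * C * w s"
      unfolding F2_def
      using norm_triangle_ineq[of "cutoff n s *\<^sub>R H2 s + ?c1 n s *\<^sub>R H1 s" "?c1 n s *\<^sub>R H1 s + ?c2 n s *\<^sub>R H s"]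
        norm_triangle_ineq[of "cutoff n s *\<^sub>R H2 s" "?c1 n s *\<^sub>R H1 s"]
        norm_triangle_ineq[of "?c1 n s *\<^sub>R H1 s" "?c2 n s *\<^sub>R H s"]
        t1[OF H12(2), of n s] t2[OF H12(1), of n s] t3[OF c2, of n s] by (simp add: mult.assoc)
    show "F1 n s = H1 s" if s: "\<bar>s\<bar> \<le> real n"
    proof -
      have d1: "((\<lambda>s. cutoff n s *\<^sub>R H s) has_vector_derivative F1 n s) (at s)" using F by (simp add: C2_def)
      have "(H has_vector_derivative F1 n s) (at s)"
      \<comment> \<open>The cutoff is 1 up to n + 1, so the open interval of that radius contains
        the end points |s| = n as well.\<close>
      proof (rule has_vector_derivative_transform_within_open[OF d1, of "{- real (Suc n)<..<real (Suc n)}"])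
        show "cutoff n y *\<^sub>R H y = H y" if "y \<in> {- real (Suc n)<..<real (Suc n)}" for y
          unfolding cutoff_def using that
          by (subst plateau_eq_1) (auto simp: abs_divide divide_le_eq)
      qed (use s in auto)
      moreover have "(H has_vector_derivative H1 s) (at s)" using C2 by (simp add: C2_def)
      ultimately show ?thesis by (rule vector_derivative_unique_at)
    qed
  qed
qed

text \<open>Multiplication by t turns the kernel into the transform of \<open>F1\<close>, where the
  weight is integrable. The point t = 0 is left out because the envelope blows up there; only the
  products with |t| are controlled uniformly.\<close>

lemma kernel_properties:
  obtains env tail where "integrable lborel env" "\<And>n t. t \<noteq> 0 \<Longrightarrow> norm (kernel n t) \<le> env t"
    "tail \<longlonglongrightarrow> (0::real)" "\<And>n m N t. n \<ge> N \<Longrightarrow> m \<ge> N \<Longrightarrow> \<bar>t\<bar> * norm (kernel n t - kernel m t) \<le> tail N"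
proof -
  obtain F1 F2 Q where F: "\<And>n. C2 (\<lambda>s. cutoff n s *\<^sub>R H s) (F1 n) (F2 n)" and Q: "Q \<ge> 0"
    and F1: "\<And>n s. norm (F1 n s) \<le> Q * w s" and F2: "\<And>n s. norm (F2 n s) \<le> Q * w s"
    and F1_eq: "\<And>n s. \<bar>s\<bar> \<le> real n \<Longrightarrow> F1 n s = H1 s"
    using ex_cut_derivatives by blast
  note bs = cutoff_bounded_support[where f = H]
  note cc = C2_cc[OF F bs]
  have d1: "((\<lambda>s. cutoff n s *\<^sub>R H s) has_vector_derivative F1 n s) (at s)" for n s
    using F by (simp add: C2_def)
  have c1: "continuous_on UNIV (F1 n)" for n using C2_continuous(2)[OF F] .
  have first: "\<bar>t\<bar> * norm (kernel n t) = norm (inv_fourier (F1 n) t)" for n t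
  proof -
    have "norm ((\<i> * of_real t) *\<^sub>C kernel n t) = norm (- inv_fourier (F1 n) t)"
      unfolding kernel_def by (simp only: inv_fourier_derivative[OF d1 bs c1])
    then show ?thesis by (simp add: norm_scaleC norm_mult)
  qed
  define W0 where "W0 = (LINT s|lborel. Q * w s)"
  have W0: "W0 \<ge> 0" unfolding W0_def using Q w_nonneg by (intro Bochner_Integration.integral_nonneg) auto
  have second: "t\<^sup>2 * norm (kernel n t) \<le> W0" for n t
  proof -
    have "t\<^sup>2 * norm (kernel n t) = norm (inv_fourier (F2 n) t)"
    proof -
      have "norm (t\<^sup>2 *\<^sub>R kernel n t) = norm (- inv_fourier (F2 n) t)"
        unfolding kernel_def by (simp only: inv_fourier_second_derivative[OF F bs])
      then show ?thesis by simp
    qed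
    also have "\<dots> \<le> W0"
      unfolding W0_def using integrable_w F2 by (intro inv_fourier_bound cc) auto
    finally show ?thesis .
  qed
  \<comment> \<open>Half of the spare decay 2 \<theta> - 1 is spent on Hoelder continuity. The other
    half keeps |s|^\<gamma> times the weight integrable, with exponent \<theta> + 1/2 > 1.\<close>
  define \<gamma> where "\<gamma> = \<theta> - 1 / 2"
  have \<gamma>: "0 < \<gamma>" "\<gamma> \<le> 1" using \<theta> by (auto simp: \<gamma>_def)
  define g where "g s = Q * (1 + \<bar>s\<bar>) powr (- (\<theta> + 1 / 2))" for s :: real
  have gi: "integrable lborel g"
    unfolding g_def using \<theta> by (intro integrable_mult_right integrable_one_plus_abs_powr) auto
  have g_le: "\<bar>s\<bar> powr \<gamma> * norm (F1 n s) \<le> g s" for n s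
  proof -
    have "\<bar>s\<bar> powr \<gamma> * norm (F1 n s) \<le> (1 + \<bar>s\<bar>) powr \<gamma> * (Q * w s)"
      using F1 \<gamma> by (intro mult_mono powr_mono2) auto
    also have "\<dots> = Q * ((1 + \<bar>s\<bar>) powr \<gamma> * (1 + \<bar>s\<bar>) powr (- (2 * \<theta>)))" by (simp add: w_def)
    also have "(1 + \<bar>s\<bar>) powr \<gamma> * (1 + \<bar>s\<bar>) powr (- (2 * \<theta>)) = (1 + \<bar>s\<bar>) powr (- (\<theta> + 1 / 2))"
      by (simp add: powr_add[symmetric] \<gamma>_def)
    finally show ?thesis by (simp add: g_def)
  qed
  define W1 where "W1 = 2 * (LINT s|lborel. g s)"
  have W1: "W1 \<ge> 0" unfolding W1_def g_def using Q by (intro mult_nonneg_nonneg Bochner_Integration.integral_nonneg) auto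
  have small: "\<bar>t\<bar> * norm (kernel n t) \<le> W1 * \<bar>t\<bar> powr \<gamma>" for n t
    unfolding first W1_def using inv_fourier_derivative_holder[OF d1 bs c1 \<gamma> gi g_le, of n t] by (simp add: mult_ac)
  \<comment> \<open>Near 0 the Hoelder bound is divided by |t|, and \<gamma> - 1 > -1 makes it
    integrable. Away from 0 the bound W0 / t^2 is used, where 1 / t^2 \<le> 2 / (1 + t^2) for |t|
    \<ge> 1 explains the factor 2.\<close>
  define env where "env t = W1 * (indicator {-1..1} t * \<bar>t\<bar> powr (\<gamma> - 1)) + 2 * W0 * (1 / (1 + t\<^sup>2))" for t :: real
  have env_int: "integrable lborel env"
    unfolding env_def using \<gamma>
    by (intro Bochner_Integration.integrable_add integrable_mult_right integrable_abs_powr_near_0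
        integrable_inverse_one_plus_square) auto
  have env_le: "norm (kernel n t) \<le> env t" if "t \<noteq> 0" for n t
  proof (cases "\<bar>t\<bar> \<le> 1")
    case True
    have "norm (kernel n t) \<le> W1 * \<bar>t\<bar> powr \<gamma> / \<bar>t\<bar>"
      using small[of t n] that by (simp add: field_simps)
    also have "\<dots> = W1 * \<bar>t\<bar> powr (\<gamma> - 1)" using that by (simp add: powr_diff)
    also have "\<dots> \<le> env t" using True W0 by (auto simp: env_def indicator_def)
    finally show ?thesis .
  next
    case False
    then have t2: "1 \<le> t\<^sup>2" by (metis abs_le_square_iff abs_one less_eq_real_def linorder_not_le one_power2)
    have "norm (kernel n t) \<le> W0 / t\<^sup>2" using second[of t n] that by (simp add: field_simps)
    also have "\<dots> \<le> 2 * W0 / (1 + t\<^sup>2)"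
      using t2 W0 mult_left_mono[of 1 "t\<^sup>2" W0] by (simp add: divide_simps algebra_simps add_nonneg_eq_0_iff)
    also have "\<dots> \<le> env t" using W1 by (auto simp: env_def)
    finally show ?thesis .
  qed
  \<comment> \<open>For n, m \<ge> N the derivatives \<open>F1 n\<close> and \<open>F1 m\<close>
    agree with \<open>H1\<close> on [-N, N], so their difference lives outside, where each is at
    most Q \<open>w\<close>.\<close>
  define tail where "tail N = (LINT s|lborel. (if \<bar>s\<bar> \<le> real N then 0 else 2 * (Q * w s)))" for N
  have [measurable]: "w \<in> borel_measurable borel" using integrable_w by auto
  have tail_int: "integrable lborel (\<lambda>s. if \<bar>s\<bar> \<le> real N then 0 else 2 * (Q * w s))" for N
    by (rule Bochner_Integration.integrable_bound[OF integrable_mult_right[OF integrable_w, of "2 * Q"]]) auto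
  have "tail \<longlonglongrightarrow> (LINT s|(lborel :: real measure). (0::real))"
    unfolding tail_def
  proof (rule integral_dominated_convergence[where w = "\<lambda>s. 2 * Q * w s"])
    show "integrable lborel (\<lambda>s. 2 * Q * w s)" using integrable_w by simp
    show "AE s in lborel. (\<lambda>N. if \<bar>s\<bar> \<le> real N then 0 else 2 * (Q * w s)) \<longlonglongrightarrow> 0"
    proof (intro AE_I2)
      fix s :: real
      have "\<forall>\<^sub>F N in sequentially. 0 = (if \<bar>s\<bar> \<le> real N then 0 else 2 * (Q * w s))"
        using eventually_ge_at_top[of "nat \<lceil>\<bar>s\<bar>\<rceil>"] by eventually_elim (auto simp: nat_le_iff ceiling_le_iff)
      then show "(\<lambda>N. if \<bar>s\<bar> \<le> real N then 0 else 2 * (Q * w s)) \<longlonglongrightarrow> 0"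
        by (rule Lim_transform_eventually[OF tendsto_const])
    qed
  qed (use Q w_nonneg in auto)
  then have tail_lim: "tail \<longlonglongrightarrow> 0" by simp
  have tail_le: "\<bar>t\<bar> * norm (kernel n t - kernel m t) \<le> tail N" if nm: "n \<ge> N" "m \<ge> N" for n m N t
  proof -
    have e: "(\<i> * of_real t) *\<^sub>C kernel k t = - inv_fourier (F1 k) t" for k
      unfolding kernel_def by (rule inv_fourier_derivative[OF d1 bs c1])
    have "\<bar>t\<bar> * norm (kernel n t - kernel m t) = norm ((\<i> * of_real t) *\<^sub>C (kernel n t - kernel m t))"
      by (simp add: norm_scaleC norm_mult)
    also have "\<dots> = norm (inv_fourier (F1 n) t - inv_fourier (F1 m) t)"
      unfolding scaleC.diff_right e by (metis minus_diff_minus norm_minus_cancel)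
    also have "\<dots> = norm (inv_fourier (\<lambda>s. F1 n s - F1 m s) t)"
      using inv_fourier_diff(2)[OF cc(2)[of n] cc(2)[of m]] by simp
    also have "\<dots> \<le> tail N"
      unfolding tail_def
    proof (rule inv_fourier_bound[OF inv_fourier_diff(1)[OF cc(2) cc(2)] tail_int])
      fix s
      show "norm (F1 n s - F1 m s) \<le> (if \<bar>s\<bar> \<le> real N then 0 else 2 * (Q * w s))"
        using F1_eq[of s n] F1_eq[of s m] nm F1[of n s] F1[of m s] norm_triangle_ineq4[of "F1 n s" "F1 m s"]
        by auto
    qed
    finally show ?thesis .
  qed
  show thesis using that[OF env_int env_le tail_lim tail_le] by blast
qed

text \<open>Away from 0 the kernels converge locally uniformly, with error \<open>tail n\<close> /
  |t|, so the limit is continuous there. The common envelope then upgrades pointwise convergence off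
  0 to convergence in mean.\<close>

theorem ex_limit_kernel:
  obtains G where "\<And>t. t \<noteq> 0 \<Longrightarrow> isCont G t" "\<And>t. t \<noteq> 0 \<Longrightarrow> (\<lambda>n. kernel n t) \<longlonglongrightarrow> G t" "G 0 = 0"
    "integrable lborel (\<lambda>t. norm (G t))" "\<And>n. integrable lborel (\<lambda>t. norm (kernel n t - G t))"
    "(\<lambda>n. LINT t|lborel. norm (kernel n t - G t)) \<longlonglongrightarrow> 0"
proof -
  obtain env tail where env: "integrable lborel env" "\<And>n t. t \<noteq> 0 \<Longrightarrow> norm (kernel n t) \<le> env t"
    and tail: "tail \<longlonglongrightarrow> (0::real)"
      "\<And>n m N t. n \<ge> N \<Longrightarrow> m \<ge> N \<Longrightarrow> \<bar>t\<bar> * norm (kernel n t - kernel m t) \<le> tail N"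
    using kernel_properties by blast
  have k_cont: "continuous_on UNIV (kernel n)" for n
  proof (rule ex_cut_derivatives)
    fix F1 F2 assume F: "\<And>n. C2 (\<lambda>s. cutoff n s *\<^sub>R H s) (F1 n) (F2 n)"
    show ?thesis
      unfolding kernel_def by (intro continuous_inv_fourier C2_cc(1)[OF F] cutoff_bounded_support)
  qed
  have "convergent (\<lambda>n. kernel n t)" if "t \<noteq> 0" for t
  proof -
    have "Cauchy (\<lambda>n. kernel n t)"
    proof (rule metric_CauchyI)
      fix e :: real assume "e > 0"
      then have "\<forall>\<^sub>F N in sequentially. tail N < e * \<bar>t\<bar>"
        using order_tendstoD(2)[OF tail(1), of "e * \<bar>t\<bar>"] that by simp
      then obtain N where N: "tail N < e * \<bar>t\<bar>" by (auto simp: eventually_sequentially)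
      have "dist (kernel m t) (kernel n t) < e" if "m \<ge> N" "n \<ge> N" for m n
      proof -
        have "\<bar>t\<bar> * norm (kernel m t - kernel n t) < \<bar>t\<bar> * e"
          using tail(2)[OF that, of t] N by (simp add: mult.commute)
        then show ?thesis by (simp add: dist_norm mult_less_cancel_left)
      qed
      then show "\<exists>M. \<forall>m\<ge>M. \<forall>n\<ge>M. dist (kernel m t) (kernel n t) < e" by blast
    qed
    then show ?thesis by (rule Cauchy_convergent)
  qed
  then have "\<exists>l. t \<noteq> 0 \<longrightarrow> (\<lambda>n. kernel n t) \<longlonglongrightarrow> l" for t by (auto simp: convergent_def)
  then obtain L where L: "\<And>t. t \<noteq> 0 \<Longrightarrow> (\<lambda>n. kernel n t) \<longlonglongrightarrow> L t" by metis
  \<comment> \<open>The value at 0 is free for integration; choosing 0 makes \<open>G\<close>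
    complex linear at that point too.\<close>
  define G where "G t = (if t = 0 then 0 else L t)" for t
  have G_lim: "(\<lambda>n. kernel n t) \<longlonglongrightarrow> G t" if "t \<noteq> 0" for t using L[OF that] that by (simp add: G_def)
  have G_err: "norm (kernel n t - G t) \<le> tail n / \<bar>t\<bar>" if "t \<noteq> 0" for n t
  proof -
    have "(\<lambda>m. \<bar>t\<bar> * norm (kernel n t - kernel m t)) \<longlonglongrightarrow> \<bar>t\<bar> * norm (kernel n t - G t)"
      by (intro tendsto_intros G_lim that)
    then have "\<bar>t\<bar> * norm (kernel n t - G t) \<le> tail n"
      by (rule LIMSEQ_le_const2) (use tail(2)[of n n] in blast)
    then show ?thesis using that by (simp add: field_simps)
  qed
  have G_cont: "isCont G t" if t: "t \<noteq> 0" for t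
  proof -
    \<comment> \<open>An open neighbourhood of t on which |x| is bounded below, so that
      \<open>tail n\<close> / |x| tends to 0 uniformly.\<close>
    define S where "S = {x. \<bar>x\<bar> > \<bar>t\<bar> / 2}"
    have S: "open S" unfolding S_def by (intro open_Collect_less continuous_intros)
    have "uniform_limit S kernel G sequentially"
    proof (rule uniform_limitI)
      fix e :: real assume "e > 0"
      then have "\<forall>\<^sub>F n in sequentially. tail n < e * (\<bar>t\<bar> / 2)"
        using order_tendstoD(2)[OF tail(1), of "e * (\<bar>t\<bar> / 2)"] t by simp
      then show "\<forall>\<^sub>F n in sequentially. \<forall>x\<in>S. dist (kernel n x) (G x) < e"
      proof eventually_elim
        case (elim n)
        show ?case
        proof
          fix x assume "x \<in> S"
          then have x: "\<bar>x\<bar> > \<bar>t\<bar> / 2" "x \<noteq> 0" by (auto simp: S_def)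
          have "tail n < e * \<bar>x\<bar>"
            using elim mult_strict_left_mono[OF x(1) \<open>e > 0\<close>] by linarith
          then have "tail n / \<bar>x\<bar> < e" using x(2) by (simp add: divide_less_eq)
          then show "dist (kernel n x) (G x) < e" using G_err[OF x(2), of n] by (simp add: dist_norm)
        qed
      qed
    qed
    then have "continuous_on S G"
      by (rule uniform_limit_theorem[rotated])
        (auto intro!: always_eventually continuous_on_subset[OF k_cont])
    moreover have "t \<in> S" using t by (simp add: S_def)
    ultimately show ?thesis using S by (simp add: continuous_on_eq_continuous_at)
  qed
  have slG: "simple_limit borel G" by (rule simple_limit_if_isCont[OF G_cont])
  have slk: "simple_limit borel (kernel n)" for n by (rule simple_limit_continuous[OF k_cont])
  note [measurable] = simple_limit_norm[OF slG] simple_limit_norm[OF simple_limit_diff[OF slk slG]]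
    borel_measurable_integrable[OF env(1)]
  have G_env: "norm (G t) \<le> env t" if "t \<noteq> 0" for t
    by (rule LIMSEQ_le_const2[OF tendsto_norm[OF G_lim[OF that]]]) (use env(2)[OF that] in blast)
  have ne0: "AE t in lborel. t \<noteq> (0::real)"
    using AE_not_in[of "{0::real}" lborel] by (simp add: null_sets_def)
  have i1: "integrable lborel (\<lambda>t. norm (G t))"
  proof (rule Bochner_Integration.integrable_bound[OF env(1)])
    show "AE t in lborel. norm (norm (G t)) \<le> norm (env t)"
      using ne0 by eventually_elim (use G_env in \<open>auto intro: order_trans[OF _ abs_ge_self]\<close>)
  qed simp
  have d_env: "AE t in lborel. norm (norm (kernel n t - G t)) \<le> 2 * env t" for n
    using ne0
  proof eventually_elim
    case (elim t)
    then show ?case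
      using norm_triangle_ineq4[of "kernel n t" "G t"] env(2)[OF elim, of n] G_env[OF elim] by simp
  qed
  have i2: "integrable lborel (\<lambda>t. norm (kernel n t - G t))" for n
  proof (rule Bochner_Integration.integrable_bound)
    show "integrable lborel (\<lambda>t. 2 * env t)" using env(1) by simp
    show "AE t in lborel. norm (norm (kernel n t - G t)) \<le> norm (2 * env t)"
      using d_env[of n] by eventually_elim (auto intro: order_trans[OF _ abs_ge_self])
  qed simp
  have "(\<lambda>n. LINT t|lborel. norm (kernel n t - G t)) \<longlonglongrightarrow> (LINT t|(lborel :: real measure). (0::real))"
  proof (rule integral_dominated_convergence[where w = "\<lambda>t. 2 * env t"])
    show "AE t in lborel. (\<lambda>n. norm (kernel n t - G t)) \<longlonglongrightarrow> 0"
      using ne0 by eventually_elim (intro tendsto_norm_zero LIM_zero G_lim)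
  qed (use env(1) d_env in auto)
  then have "(\<lambda>n. LINT t|lborel. norm (kernel n t - G t)) \<longlonglongrightarrow> 0" by simp
  then show thesis using that[of G] G_cont G_lim i1 i2 by (simp add: G_def)
qed

end

section \<open>Convolutions and interval means\<close>

lemma integrable_indicator_interval: "integrable lborel (indicator {p..q::real} :: real \<Rightarrow> real)"
  by (intro integrable_real_indicator) (auto simp: emeasure_lborel_Icc_eq)

lemma set_integrable_interval_bounded:
  fixes g :: "real \<Rightarrow> 'a::{banach, second_countable_topology}"
  assumes "g \<in> borel_measurable borel" "\<And>x. norm (g x) \<le> B"
  shows "set_integrable lborel {p..q} g"
  unfolding set_integrable_def
proof (rule Bochner_Integration.integrable_bound)
  show "integrable lborel (\<lambda>x. indicator {p..q} x * B)" by (intro integrable_mult_left integrable_indicator_interval)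
  show "AE x in lborel. norm (indicator {p..q} x *\<^sub>R g x) \<le> norm (indicator {p..q} x * B)"
    using assms(2) by (intro AE_I2) (auto simp: indicator_def intro: order_trans[OF _ abs_ge_self])
qed (use assms in auto)

lemma interval_functional:
  fixes f :: "real \<Rightarrow> 'a::banach" and l :: "'a \<Rightarrow> 'c::{banach, second_countable_topology}"
  assumes f: "simple_limit borel f" "\<And>x. norm (f x) \<le> B" and l: "bounded_linear l"
  shows "set_integrable lborel {p..q} (\<lambda>x. l (f x))"
    and "l (bochner_integral (lebesgue_on {p..q}) f) = (LINT x:{p..q}|lborel. l (f x))"
proof -
  have "set_integrable lborel {p..q} (\<lambda>x. norm (f x))"
    by (rule set_integrable_interval_bounded[OF simple_limit_norm[OF f(1)], of B]) (simp add: f(2))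
  from bochner_integral_functional[OF _ f(1) this l]
  show "set_integrable lborel {p..q} (\<lambda>x. l (f x))"
    "l (bochner_integral (lebesgue_on {p..q}) f) = (LINT x:{p..q}|lborel. l (f x))"
    by simp_all
qed

lemma set_integral_interval_le:
  fixes g :: "real \<Rightarrow> real"
  assumes "p \<le> q" "set_integrable lborel {p..q} g" "\<And>x. x \<in> {p..q} \<Longrightarrow> g x \<le> B"
  shows "(LINT x:{p..q}|lborel. g x) \<le> (q - p) * B"
proof -
  have "(LINT x:{p..q}|lborel. g x) \<le> (LINT x:{p..q}|lborel. B)"
    by (rule set_integral_mono) (use assms in \<open>auto simp: set_integrable_def intro!: integrable_mult_left\<close>)
  also have "\<dots> = (q - p) * B"
    using assms(1) by (simp add: set_lebesgue_integral_def)
  finally show ?thesis .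
qed

lemma bochner_interval_dist:
  fixes f g :: "real \<Rightarrow> 'a::banach"
  assumes f: "simple_limit borel f" "\<And>x. norm (f x) \<le> B" and g: "simple_limit borel g" "\<And>x. norm (g x) \<le> B'"
    and pq: "p \<le> q" and e: "\<And>x. x \<in> {p..q} \<Longrightarrow> norm (f x - g x) \<le> e"
  shows "norm (bochner_integral (lebesgue_on {p..q}) f - bochner_integral (lebesgue_on {p..q}) g) \<le> (q - p) * e"
proof (rule norm_le_if_functionals_le)
  fix l :: "'a \<Rightarrow> real" assume l: "bounded_linear l" "\<And>y. \<bar>l y\<bar> \<le> norm y"
  note F = interval_functional[OF f l(1), of p q] interval_functional[OF g l(1), of p q]
  have "l (bochner_integral (lebesgue_on {p..q}) f - bochner_integral (lebesgue_on {p..q}) g)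
      = (LINT x:{p..q}|lborel. l (f x) - l (g x))"
    using F by (simp add: bounded_linear.linear[OF l(1), THEN linear_diff] set_integral_diff)
  also have "\<dots> \<le> (q - p) * e"
  proof (rule set_integral_interval_le[OF pq])
    show "set_integrable lborel {p..q} (\<lambda>x. l (f x) - l (g x))" using F by (intro set_integral_diff)
    show "l (f x) - l (g x) \<le> e" if "x \<in> {p..q}" for x
      using l(2)[of "f x - g x"] e[OF that] by (simp add: bounded_linear.linear[OF l(1), THEN linear_diff])
  qed
  finally show "l (bochner_integral (lebesgue_on {p..q}) f - bochner_integral (lebesgue_on {p..q}) g) \<le> (q - p) * e" .
qed

lemma bochner_interval_const:
  fixes c :: "'a::banach"
  assumes "p \<le> q"
  shows "bochner_integral (lebesgue_on {p..q}) (\<lambda>_. c) = (q - p) *\<^sub>R c"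
proof (rule eq_if_functionals_eq)
  fix l :: "'a \<Rightarrow> real" assume l: "bounded_linear l"
  show "l (bochner_integral (lebesgue_on {p..q}) (\<lambda>_. c)) = l ((q - p) *\<^sub>R c)"
    unfolding interval_functional(2)[OF simple_limit_const order_refl l]
    using assms by (simp add: set_lebesgue_integral_def bounded_linear.linear[OF l, THEN linear_scale])
qed

lemma norm_bochner_interval_le:
  fixes f :: "real \<Rightarrow> 'a::banach"
  assumes f: "simple_limit borel f" "\<And>x. norm (f x) \<le> B" and pq: "p \<le> q"
  shows "norm (bochner_integral (lebesgue_on {p..q}) f) \<le> (q - p) * B"
  using bochner_interval_dist[OF f simple_limit_const[of borel "0::'a"] _ pq, of 0 B] f(2)
  by (simp add: bochner_interval_const[OF pq])

lemmas op_integrand = convolution_integrand[OF bounded_bilinear_blinfun_apply norm_blinfun]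

lemma convolution_functional:
  fixes G :: "real \<Rightarrow> 'a::banach \<Rightarrow>\<^sub>L 'a" and l :: "'a \<Rightarrow> 'c::{banach, second_countable_topology}"
  assumes G: "simple_limit borel G" "integrable lborel (\<lambda>s. norm (G s))"
    and \<phi>: "simple_limit borel \<phi>" "\<And>s. norm (\<phi> s) \<le> M" and l: "bounded_linear l"
  shows "integrable lborel (\<lambda>s. l (blinfun_apply (G s) (\<phi> (t - s))))"
    and "l (convolution blinfun_apply G \<phi> t) = (LINT s|lborel. l (blinfun_apply (G s) (\<phi> (t - s))))"
  unfolding Defs.convolution_def
  using bochner_integral_functional_UNIV[OF op_integrand(1,2)[OF G \<phi>] l] by auto

lemma norm_convolution_le:
  fixes G :: "real \<Rightarrow> 'a::banach \<Rightarrow>\<^sub>L 'a"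
  assumes G: "simple_limit borel G" "integrable lborel (\<lambda>s. norm (G s))"
    and \<phi>: "simple_limit borel \<phi>" "\<And>s. norm (\<phi> s) \<le> M"
  shows "norm (convolution blinfun_apply G \<phi> t) \<le> (LINT s|lborel. norm (G s)) * M"
  unfolding Defs.convolution_def
  using norm_bochner_integral_le[OF op_integrand(1)[OF G \<phi>] integrable_mult_left[OF G(2), of M] op_integrand(3)[OF G \<phi>]]
  by simp

lemma convolution_dist:
  fixes G :: "real \<Rightarrow> 'a::banach \<Rightarrow>\<^sub>L 'a"
  assumes G: "simple_limit borel G" "integrable lborel (\<lambda>s. norm (G s))"
    and G': "simple_limit borel G'" "integrable lborel (\<lambda>s. norm (G' s))"
    and \<phi>: "simple_limit borel \<phi>" "\<And>s. norm (\<phi> s) \<le> M"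
    and d: "integrable lborel (\<lambda>s. norm (G s - G' s))"
  shows "norm (convolution blinfun_apply G \<phi> t - convolution blinfun_apply G' \<phi> t)
    \<le> (LINT s|lborel. norm (G s - G' s)) * M"
proof -
  have "convolution blinfun_apply G \<phi> t - convolution blinfun_apply G' \<phi> t
      = convolution blinfun_apply (\<lambda>s. G s - G' s) \<phi> t"
  proof (rule eq_if_functionals_eq)
    fix l :: "'a \<Rightarrow> real" assume l: "bounded_linear l"
    show "l (convolution blinfun_apply G \<phi> t - convolution blinfun_apply G' \<phi> t)
      = l (convolution blinfun_apply (\<lambda>s. G s - G' s) \<phi> t)"
      unfolding convolution_functional(2)[OF simple_limit_diff[OF G(1) G'(1)] d \<phi> l]
        bounded_linear.linear[OF l, THEN linear_diff] convolution_functional(2)[OF G \<phi> l] convolution_functional(2)[OF G' \<phi> l]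
      using convolution_functional(1)[OF G \<phi> l] convolution_functional(1)[OF G' \<phi> l]
      by (simp add: blinfun.diff_left bounded_linear.linear[OF l, THEN linear_diff])
  qed
  then show ?thesis using norm_convolution_le[OF simple_limit_diff[OF G(1) G'(1)] d \<phi>] by simp
qed

text \<open>Integration over an interval is shifted from the convolution to the function convolved.
  It serves both for mollifiers tested on intervals and for the interval means in the function
  class.\<close>

lemma convolution_interval_fubini:
  fixes G :: "real \<Rightarrow> 'a::banach \<Rightarrow>\<^sub>L 'a" and l :: "'a \<Rightarrow> 'c::{banach, second_countable_topology}"
  assumes G: "simple_limit borel G" "integrable lborel (\<lambda>s. norm (G s))"
    and \<phi>: "simple_limit borel \<phi>" "\<And>s. norm (\<phi> s) \<le> M" and l: "bounded_linear l"
  shows "(LINT r:{p..q}|lborel. l (convolution blinfun_apply G \<phi> (t + r)))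
    = (LINT s|lborel. l (blinfun_apply (G s) (bochner_integral (lebesgue_on {p..q}) (\<lambda>r. \<phi> (t + r - s)))))"
proof -
  obtain K where K: "K \<ge> 0" "\<And>x. norm (l x) \<le> norm x * K" using bounded_linear.nonneg_bounded[OF l] by blast
  have M: "M \<ge> 0" using order_trans[OF norm_ge_zero \<phi>(2)] .
  let ?w = "\<lambda>r s. indicator {p..q} r *\<^sub>R l (blinfun_apply (G s) (\<phi> (t + r - s)))"
  have "(LINT r:{p..q}|lborel. l (convolution blinfun_apply G \<phi> (t + r))) = (LINT r|lborel. LINT s|lborel. ?w r s)"
    unfolding set_lebesgue_integral_def convolution_functional(2)[OF G \<phi> l]
    using convolution_functional(1)[OF G \<phi> l] by (intro Bochner_Integration.integral_cong refl) simp
  also have "\<dots> = (LINT s|lborel. LINT r|lborel. ?w r s)"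
  proof (rule fubini_dominated_swap[where c = 0 and p = "indicator {p..q}" and q = "\<lambda>s. norm (G s) * (M * K)"])
    have "simple_limit (lborel \<Otimes>\<^sub>M lborel) (\<lambda>z. blinfun_apply (G (snd z)) (\<phi> (t + fst z - snd z)))"
      by (intro simple_limit_bilinear[OF bounded_bilinear_blinfun_apply] simple_limit_comp[OF G(1)]
          simple_limit_comp[OF \<phi>(1)]) measurable
    from simple_limit_borel_measurable[OF this linear_continuous_on[OF l]]
    have [measurable]: "(\<lambda>z. l (blinfun_apply (G (snd z)) (\<phi> (t + fst z - snd z)))) \<in> borel_measurable (lborel \<Otimes>\<^sub>M lborel)" .
    show "case_prod ?w \<in> borel_measurable (lborel \<Otimes>\<^sub>M lborel)" unfolding split_beta' by measurable
    show "integrable lborel (\<lambda>s. norm (G s) * (M * K))" using G(2) by simp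
    fix r s
    have "norm (l (blinfun_apply (G s) (\<phi> (t + r - s)))) \<le> norm (G s) * M * K"
      using order_trans[OF K(2) mult_right_mono[OF op_integrand(3)[OF G \<phi>] K(1)]] .
    then show "norm (?w r s) \<le> indicator {p..q} r * (norm (G (s - 0 * r)) * (M * K))"
      by (simp add: indicator_def mult.assoc)
  qed (rule integrable_indicator_interval)
  also have "\<dots> = (LINT s|lborel. l (blinfun_apply (G s) (bochner_integral (lebesgue_on {p..q}) (\<lambda>r. \<phi> (t + r - s)))))"
  proof (intro Bochner_Integration.integral_cong refl)
    fix s
    have "simple_limit borel (\<lambda>r. \<phi> (t + r - s))" by (intro simple_limit_comp[OF \<phi>(1)]) measurable
    from interval_functional(2)[OF this \<phi>(2) bounded_linear_compose[OF l blinfun.bounded_linear_right[of "G s"]], of p q]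
    show "(LINT r|lborel. ?w r s) = l (blinfun_apply (G s) (bochner_integral (lebesgue_on {p..q}) (\<lambda>r. \<phi> (t + r - s))))"
      by (simp add: set_lebesgue_integral_def)
  qed
  finally show ?thesis .
qed

text \<open>Since \<open>\<phi>\<close> may be discontinuous, the substitution s to t - s puts the
  variable t into the smooth kernel. After Fubini, the fundamental theorem of calculus applies for
  each fixed s.\<close>

lemma convolution_has_weak_derivative:
  fixes f :: "real \<Rightarrow> 'a::complex_banach \<Rightarrow>\<^sub>L 'a" and l :: "'a \<Rightarrow> real"
  assumes f: "C2 f f1 f2" "bounded_support f" and \<phi>: "simple_limit borel \<phi>" "\<And>s. norm (\<phi> s) \<le> M"
    and l: "bounded_linear l" and pq: "p \<le> q"
  shows "l (convolution blinfun_apply (inv_fourier f) \<phi> q - convolution blinfun_apply (inv_fourier f) \<phi> p)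
    = (LINT r:{p..q}|lborel. l (convolution blinfun_apply (inv_fourier (\<lambda>s. s *\<^sub>R (\<i> *\<^sub>C f s))) \<phi> r))"
proof -
  define f' where "f' = (\<lambda>s. s *\<^sub>R (\<i> *\<^sub>C f s))"
  obtain g1 g2 where f': "C2 f' g1 g2" "bounded_support f'" using C2_times_ident[OF f] unfolding f'_def by metis
  note cc = C2_cc(1)[OF f] C2_cc(1)[OF f']
  note F = simple_limit_inv_fourier[OF cc(1)] integrable_norm_inv_fourier[OF f]
  note F' = simple_limit_inv_fourier[OF cc(2)] integrable_norm_inv_fourier[OF f']
  have deriv: "(inv_fourier f has_vector_derivative inv_fourier f' t) (at t)" for t
    unfolding f'_def by (rule inv_fourier_has_vector_derivative[OF cc(1)])
  obtain K where K: "K \<ge> 0" "\<And>x. norm (l x) \<le> norm x * K" using bounded_linear.nonneg_bounded[OF l] by blast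
  have shift: "l (convolution blinfun_apply k \<phi> r) = (LINT s|lborel. l (blinfun_apply (k (r - s)) (\<phi> s)))"
    "integrable lborel (\<lambda>s. l (blinfun_apply (k (r - s)) (\<phi> s)))"
    if k: "simple_limit borel k" "integrable lborel (\<lambda>s. norm (k s))" for k r
    using convolution_functional[OF k \<phi> l, of r]
      lborel_integral_shift(1)[of "\<lambda>s. l (blinfun_apply (k s) (\<phi> (r - s)))" r]
      lborel_integrable_shift(1)[of "\<lambda>s. l (blinfun_apply (k s) (\<phi> (r - s)))" r] by simp_all
  let ?w = "\<lambda>r s. indicator {p..q} r *\<^sub>R l (blinfun_apply (inv_fourier f' (r - s)) (\<phi> s))"
  have "(LINT r:{p..q}|lborel. l (convolution blinfun_apply (inv_fourier f') \<phi> r)) = (LINT r|lborel. LINT s|lborel. ?w r s)"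
    unfolding set_lebesgue_integral_def shift(1)[OF F']
    using shift(2)[OF F'] by (intro Bochner_Integration.integral_cong refl) simp
  also have "\<dots> = (LINT s|lborel. LINT r|lborel. ?w r s)"
  proof (rule fubini_dominated_swap[where c = 1 and p = "indicator {p..q}" and q = "\<lambda>s. norm (inv_fourier f' (- s)) * (M * K)"])
    have "simple_limit (lborel \<Otimes>\<^sub>M lborel) (\<lambda>z. blinfun_apply (inv_fourier f' (fst z - snd z)) (\<phi> (snd z)))"
      by (intro simple_limit_bilinear[OF bounded_bilinear_blinfun_apply] simple_limit_comp[OF F'(1)]
          simple_limit_comp[OF \<phi>(1)]) measurable
    from simple_limit_borel_measurable[OF this linear_continuous_on[OF l]]
    have [measurable]: "(\<lambda>z. l (blinfun_apply (inv_fourier f' (fst z - snd z)) (\<phi> (snd z)))) \<in> borel_measurable (lborel \<Otimes>\<^sub>M lborel)" .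
    show "case_prod ?w \<in> borel_measurable (lborel \<Otimes>\<^sub>M lborel)" unfolding split_beta' by measurable
    show "integrable lborel (\<lambda>s. norm (inv_fourier f' (- s)) * (M * K))"
      using lborel_integrable_shift(1)[OF F'(2), of 0] by simp
    fix r s
    have "norm (blinfun_apply (inv_fourier f' (r - s)) (\<phi> s)) \<le> norm (inv_fourier f' (r - s)) * M"
      using order_trans[OF norm_blinfun mult_left_mono[OF \<phi>(2) norm_ge_zero]] .
    then have "norm (l (blinfun_apply (inv_fourier f' (r - s)) (\<phi> s))) \<le> norm (inv_fourier f' (r - s)) * M * K"
      using order_trans[OF K(2) mult_right_mono[OF _ K(1)]] by blast
    then show "norm (?w r s) \<le> indicator {p..q} r * (norm (inv_fourier f' (- (s - 1 * r))) * (M * K))"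
      by (simp add: indicator_def mult.assoc)
  qed (rule integrable_indicator_interval)
  also have "\<dots> = (LINT s|lborel. l (blinfun_apply (inv_fourier f (q - s)) (\<phi> s)) - l (blinfun_apply (inv_fourier f (p - s)) (\<phi> s)))"
  proof (intro Bochner_Integration.integral_cong refl)
    fix s
    define L where "L X = l (blinfun_apply X (\<phi> s))" for X :: "'a \<Rightarrow>\<^sub>L 'a"
    have L: "bounded_linear L"
      unfolding L_def by (intro bounded_linear_compose[OF l] blinfun.bounded_linear_left)
    have d: "((\<lambda>r. L (inv_fourier f (r - s))) has_vector_derivative L (inv_fourier f' (r - s))) (at r)" for r
    proof (rule bounded_linear.has_vector_derivative[OF L])
      have "((\<lambda>r. r - s) has_vector_derivative 1) (at r)"
        by (auto intro!: derivative_eq_intros simp: has_real_derivative_iff_has_vector_derivative[symmetric])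
      from vector_diff_chain_at[OF this deriv]
      show "((\<lambda>r. inv_fourier f (r - s)) has_vector_derivative inv_fourier f' (r - s)) (at r)"
        by (simp add: o_def)
    qed
    have c: "continuous_on {p..q} (\<lambda>r. L (inv_fourier f' (r - s)))"
      by (intro bounded_linear.continuous_on[OF L] continuous_on_compose2[OF continuous_inv_fourier[OF cc(2)]] continuous_intros) auto
    have "(LINT r|lborel. indicator {p..q} r *\<^sub>R L (inv_fourier f' (r - s))) = L (inv_fourier f (q - s)) - L (inv_fourier f (p - s))"
      by (rule integral_FTC_Icc[OF pq _ c]) (rule has_vector_derivative_at_within[OF d])
    then show "(LINT r|lborel. ?w r s) = l (blinfun_apply (inv_fourier f (q - s)) (\<phi> s)) - l (blinfun_apply (inv_fourier f (p - s)) (\<phi> s))"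
      by (simp add: L_def)
  qed
  also have "\<dots> = l (convolution blinfun_apply (inv_fourier f) \<phi> q - convolution blinfun_apply (inv_fourier f) \<phi> p)"
    unfolding bounded_linear.linear[OF l, THEN linear_diff] shift(1)[OF F]
    by (rule Bochner_Integration.integral_diff[OF shift(2)[OF F] shift(2)[OF F]])
  finally show ?thesis unfolding f'_def ..
qed

lemma convolution_lipschitz:
  fixes f :: "real \<Rightarrow> 'a::complex_banach \<Rightarrow>\<^sub>L 'a"
  assumes f: "C2 f f1 f2" "bounded_support f" and \<phi>: "simple_limit borel \<phi>" "\<And>s. norm (\<phi> s) \<le> M"
  obtains L where "\<And>p q. norm (convolution blinfun_apply (inv_fourier f) \<phi> q - convolution blinfun_apply (inv_fourier f) \<phi> p) \<le> L * \<bar>q - p\<bar>"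
proof -
  define f' where "f' = (\<lambda>s. s *\<^sub>R (\<i> *\<^sub>C f s))"
  obtain g1 g2 where f': "C2 f' g1 g2" "bounded_support f'" using C2_times_ident[OF f] unfolding f'_def by metis
  note F' = simple_limit_inv_fourier[OF C2_cc(1)[OF f']] integrable_norm_inv_fourier[OF f']
  define L where "L = (LINT s|lborel. norm (inv_fourier f' s)) * M"
  let ?u = "convolution blinfun_apply (inv_fourier f) \<phi>"
  have L: "L \<ge> 0" using order_trans[OF norm_ge_zero norm_convolution_le[OF F' \<phi>]] by (simp add: L_def)
  have le: "norm (?u q - ?u p) \<le> L * (q - p)" if pq: "p \<le> q" for p q
  proof (rule norm_le_if_functionals_le)
    fix l :: "'a \<Rightarrow> real" assume l: "bounded_linear l" "\<And>y. \<bar>l y\<bar> \<le> norm y"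
    have eq: "l (?u q - ?u p) = (LINT r:{p..q}|lborel. l (convolution blinfun_apply (inv_fourier f') \<phi> r))"
      unfolding f'_def by (rule convolution_has_weak_derivative[OF f \<phi> l(1) pq])
    have b: "\<bar>l (convolution blinfun_apply (inv_fourier f') \<phi> r)\<bar> \<le> L" for r
      using order_trans[OF l(2) norm_convolution_le[OF F' \<phi>]] by (simp add: L_def)
    show "l (?u q - ?u p) \<le> L * (q - p)"
    proof (cases "set_integrable lborel {p..q} (\<lambda>r. l (convolution blinfun_apply (inv_fourier f') \<phi> r))")
      case True
      have "l (convolution blinfun_apply (inv_fourier f') \<phi> r) \<le> L" for r using b[of r] by linarith
      then show ?thesis unfolding eq using set_integral_interval_le[OF pq True, of L] by (simp add: mult.commute)
    next
      \<comment> \<open>For a non-integrable integrand the integral is 0 by convention, and the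
        bound holds because L is nonnegative.\<close>
      case False
      then have "l (?u q - ?u p) = 0"
        unfolding eq set_lebesgue_integral_def set_integrable_def by (rule not_integrable_integral_eq)
      then show ?thesis using L pq by simp
    qed
  qed
  have "norm (?u q - ?u p) \<le> L * \<bar>q - p\<bar>" for p q
    using le[of p q] le[of q p] by (cases "p \<le> q") (auto simp: norm_minus_commute)
  then show thesis using that by blast
qed

lemma continuous_convolution_inv_fourier:
  fixes f :: "real \<Rightarrow> 'a::complex_banach \<Rightarrow>\<^sub>L 'a"
  assumes "C2 f f1 f2" "bounded_support f" "simple_limit borel \<phi>" "\<And>s. norm (\<phi> s) \<le> M"
  shows "uniformly_continuous_on UNIV (convolution blinfun_apply (inv_fourier f) \<phi>)"
proof -
  obtain L where L: "\<And>p q. norm (convolution blinfun_apply (inv_fourier f) \<phi> q - convolution blinfun_apply (inv_fourier f) \<phi> p) \<le> L * \<bar>q - p\<bar>"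
    using convolution_lipschitz[OF assms] by blast
  show ?thesis
    unfolding uniformly_continuous_on_def
  proof (intro allI impI)
    fix e :: real assume e: "e > 0"
    have "dist (convolution blinfun_apply (inv_fourier f) \<phi> q) (convolution blinfun_apply (inv_fourier f) \<phi> p) < e"
      if "dist q p < e / (\<bar>L\<bar> + 1)" for p q
    proof -
      have "L * \<bar>q - p\<bar> \<le> (\<bar>L\<bar> + 1) * \<bar>q - p\<bar>" by (intro mult_right_mono) auto
      also have "\<dots> < e" using that by (simp add: dist_real_def pos_less_divide_eq mult.commute add_nonneg_pos)
      finally show ?thesis using L[of q p] by (simp add: dist_norm)
    qed
    then show "\<exists>d>0. \<forall>x\<in>UNIV. \<forall>x'\<in>UNIV. dist x' x < d \<longrightarrow>
        dist (convolution blinfun_apply (inv_fourier f) \<phi> x') (convolution blinfun_apply (inv_fourier f) \<phi> x) < e"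
      using e by (intro exI[of _ "e / (\<bar>L\<bar> + 1)"]) (auto intro: add_nonneg_pos divide_pos_pos)
  qed
qed

lemma C2_cutoff:
  obtains c1 c2 where "C2 (cutoff n) c1 c2"
proof -
  obtain p1 p2 where "C2 plateau p1 p2" using ex_C2_plateau .
  from C2_affine[OF this, of "1 / real (Suc n)" 0] show thesis using that unfolding cutoff_def[abs_def] by blast
qed

lemma C2_of_real:
  assumes "C2 f f1 f2"
  shows "C2 (\<lambda>s. complex_of_real (f s)) (\<lambda>s. of_real (f1 s)) (\<lambda>s. of_real (f2 s))"
  by (rule C2_bounded_linear[OF bounded_linear_of_real assms])

lemma bounded_support_of_real: "bounded_support f \<Longrightarrow> bounded_support (\<lambda>s. complex_of_real (f s))"
  by (erule bounded_support_mono) simp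

text \<open>The transforms of the cutoffs are rescalings m v(m t), m = n + 1, of the single kernel
  \<open>v\<close> for the plateau. The inversion formula at frequency 0 gives \<open>v\<close> the
  integral 1, so they form an approximate identity.\<close>

lemma mollifier_limit:
  fixes g :: "real \<Rightarrow> complex"
  assumes g: "continuous_on UNIV g" "\<And>s. norm (g s) \<le> B"
  shows "(\<lambda>n. LINT s|lborel. inv_fourier (\<lambda>s. complex_of_real (cutoff n s)) s * g s) \<longlonglongrightarrow> g 0"
proof -
  obtain p1 p2 where p: "C2 plateau p1 p2" using ex_C2_plateau .
  note P = C2_of_real[OF p] bounded_support_of_real[OF bounded_support_plateau]
  define v where "v = inv_fourier (\<lambda>s. complex_of_real (plateau s))"
  have vi: "integrable lborel v" unfolding v_def by (rule integrable_inv_fourier[OF P])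
  note [measurable] = borel_measurable_integrable[OF vi] borel_measurable_continuous_onI[OF g(1)]
  have v1: "(LINT x|lborel. v x) = 1"
    using fourier_inversion[OF P, of 0] by (simp add: v_def plateau_eq_1)
  have scale: "inv_fourier (\<lambda>s. complex_of_real (cutoff n s)) t = of_real (real (Suc n)) * v (real (Suc n) * t)" for n t
  proof -
    obtain c1 c2 where c: "C2 (cutoff n) c1 c2" using C2_cutoff .
    let ?m = "real (Suc n)"
    have "(LINT s|lborel. cis (t * s) * complex_of_real (cutoff n s))
        = ?m *\<^sub>R (LINT s|lborel. cis (?m * t * s) * complex_of_real (plateau s))"
      using lborel_integral_real_affine[of ?m "\<lambda>s. cis (t * s) * complex_of_real (cutoff n s)" 0]
      by (simp add: cutoff_def mult_ac del: of_nat_Suc)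
    then show ?thesis
      unfolding v_def inv_fourier_complex[OF C2_cc(1)[OF C2_of_real[OF c] bounded_support_of_real[OF bounded_support_cutoff]]]
        inv_fourier_complex[OF C2_cc(1)[OF P]]
      by (simp add: scaleR_conv_of_real)
  qed
  have "(\<lambda>n. LINT x|lborel. v x * g (x / real (Suc n))) \<longlonglongrightarrow> (LINT x|lborel. v x * g 0)"
  proof (rule integral_dominated_convergence[where w = "\<lambda>x. norm (v x) * B"])
    show "AE x in lborel. (\<lambda>n. v x * g (x / real (Suc n))) \<longlonglongrightarrow> v x * g 0"
    proof (intro AE_I2 tendsto_mult tendsto_const)
      fix x
      have "(\<lambda>n. x / real (Suc n)) \<longlonglongrightarrow> 0"
        using tendsto_mult[OF tendsto_const[of x] LIMSEQ_inverse_real_of_nat] by (simp add: divide_inverse)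
      then show "(\<lambda>n. g (x / real (Suc n))) \<longlonglongrightarrow> g 0"
        using continuous_on_tendsto_compose[OF g(1), of _ 0] by simp
    qed
    show "AE x in lborel. norm (v x * g (x / real (Suc n))) \<le> norm (v x) * B" for n
      unfolding norm_mult by (intro AE_I2 mult_left_mono g) auto
  qed (use vi in auto)
  moreover have "(LINT x|lborel. v x * g (x / real (Suc n))) = (LINT s|lborel. inv_fourier (\<lambda>s. complex_of_real (cutoff n s)) s * g s)" for n
  proof -
    have "(LINT s|lborel. inv_fourier (\<lambda>s. complex_of_real (cutoff n s)) s * g s)
        = (LINT s|lborel. real (Suc n) *\<^sub>R (v (real (Suc n) * s) * g (real (Suc n) * s / real (Suc n))))"
      unfolding scale by (simp add: scaleR_conv_of_real mult.assoc del: of_nat_Suc)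
    also have "\<dots> = (LINT x|lborel. v x * g (x / real (Suc n)))"
      using lborel_integral_real_affine[of "real (Suc n)" "\<lambda>x. v x * g (x / real (Suc n))" 0]
      by (simp del: of_nat_Suc)
    finally show ?thesis by simp
  qed
  ultimately show ?thesis by (simp add: v1)
qed

text \<open>Moving the window changes the integral only through two end pieces of length |t' - t|
  each, on which the integrand is at most M.\<close>

lemma interval_mean_lipschitz:
  fixes \<phi> :: "real \<Rightarrow> 'a::banach"
  assumes \<phi>: "simple_limit borel \<phi>" "\<And>s. norm (\<phi> s) \<le> M"
  shows "norm (bochner_integral (lebesgue_on {p..q}) (\<lambda>r. \<phi> (t' + r)) - bochner_integral (lebesgue_on {p..q}) (\<lambda>r. \<phi> (t + r)))
    \<le> 2 * M * \<bar>t' - t\<bar>"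
proof -
  have M: "M \<ge> 0" using order_trans[OF norm_ge_zero \<phi>(2)] .
  have *: "norm (bochner_integral (lebesgue_on {p..q}) (\<lambda>r. \<phi> (t' + r)) - bochner_integral (lebesgue_on {p..q}) (\<lambda>r. \<phi> (t + r)))
    \<le> 2 * M * (t' - t)" if "t \<le> t'" for t t'
  proof (rule norm_le_if_functionals_le)
    fix l :: "'a \<Rightarrow> real" assume l: "bounded_linear l" "\<And>y. \<bar>l y\<bar> \<le> norm y"
    have m: "(\<lambda>x. l (\<phi> x)) \<in> borel_measurable borel"
      by (rule simple_limit_borel_measurable[OF \<phi>(1) linear_continuous_on[OF l(1)]])
    have b: "\<bar>l (\<phi> x)\<bar> \<le> M" for x using order_trans[OF l(2) \<phi>(2)] .
    have eq: "l (bochner_integral (lebesgue_on {p..q}) (\<lambda>r. \<phi> (t + r))) = (LINT x|lborel. indicator {p + t..q + t} x *\<^sub>R l (\<phi> x))" for t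
    proof -
      have "simple_limit borel (\<lambda>r. \<phi> (t + r))" by (intro simple_limit_comp[OF \<phi>(1)]) measurable
      from interval_functional(2)[OF this \<phi>(2) l(1)]
      have "l (bochner_integral (lebesgue_on {p..q}) (\<lambda>r. \<phi> (t + r))) = (LINT r|lborel. indicator {p..q} r *\<^sub>R l (\<phi> (t + r)))"
        by (simp add: set_lebesgue_integral_def)
      also have "\<dots> = (LINT x|lborel. indicator {p + t..q + t} x *\<^sub>R l (\<phi> x))"
        using lborel_integral_shift(2)[of "\<lambda>x. indicator {p + t..q + t} x *\<^sub>R l (\<phi> x)" t]
        by (simp add: indicator_def add.commute)
      finally show ?thesis .
    qed
    have int: "integrable lborel (\<lambda>x. indicator {p + t..q + t} x *\<^sub>R l (\<phi> x))" for t
      using set_integrable_interval_bounded[OF m, of M] b by (simp add: set_integrable_def)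
    have "l (bochner_integral (lebesgue_on {p..q}) (\<lambda>r. \<phi> (t' + r)) - bochner_integral (lebesgue_on {p..q}) (\<lambda>r. \<phi> (t + r)))
        = (LINT x|lborel. indicator {p + t'..q + t'} x *\<^sub>R l (\<phi> x) - indicator {p + t..q + t} x *\<^sub>R l (\<phi> x))"
      unfolding bounded_linear.linear[OF l(1), THEN linear_diff] eq
      by (rule Bochner_Integration.integral_diff[OF int int, symmetric])
    also have "\<dots> \<le> (LINT x|lborel. indicator {p + t..p + t'} x * M + indicator {q + t..q + t'} x * M)"
    proof (rule integral_mono)
      show "integrable lborel (\<lambda>x. indicator {p + t'..q + t'} x *\<^sub>R l (\<phi> x) - indicator {p + t..q + t} x *\<^sub>R l (\<phi> x))"
        by (intro Bochner_Integration.integrable_diff int)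
      show "integrable lborel (\<lambda>x. indicator {p + t..p + t'} x * M + indicator {q + t..q + t'} x * M)"
        by (intro Bochner_Integration.integrable_add integrable_mult_left integrable_indicator_interval)
      fix x
      have "l (\<phi> x) \<le> M" "- l (\<phi> x) \<le> M" using b[of x] by auto
      then show "indicator {p + t'..q + t'} x *\<^sub>R l (\<phi> x) - indicator {p + t..q + t} x *\<^sub>R l (\<phi> x)
          \<le> indicator {p + t..p + t'} x * M + indicator {q + t..q + t'} x * M"
        using M that by (auto simp: indicator_def)
    qed
    also have "\<dots> = 2 * M * (t' - t)"
      using that by (subst Bochner_Integration.integral_add)
        (auto intro!: integrable_mult_left integrable_indicator_interval)
    finally show "l (bochner_integral (lebesgue_on {p..q}) (\<lambda>r. \<phi> (t' + r)) - bochner_integral (lebesgue_on {p..q}) (\<lambda>r. \<phi> (t + r)))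
      \<le> 2 * M * (t' - t)" .
  qed
  show ?thesis using *[of t t'] *[of t' t] by (cases "t \<le> t'") (auto simp: norm_minus_commute)
qed

lemma lipschitz_imp_uniformly_continuous:
  fixes f :: "real \<Rightarrow> 'a::real_normed_vector"
  assumes "\<And>x y. norm (f y - f x) \<le> L * \<bar>y - x\<bar>"
  shows "uniformly_continuous_on UNIV f"
  unfolding uniformly_continuous_on_def
proof (intro allI impI)
  fix e :: real assume e: "e > 0"
  have "dist (f y) (f x) < e" if "dist y x < e / (\<bar>L\<bar> + 1)" for x y
  proof -
    have "L * \<bar>y - x\<bar> \<le> (\<bar>L\<bar> + 1) * \<bar>y - x\<bar>" by (intro mult_right_mono) auto
    also have "\<dots> < e" using that by (simp add: dist_real_def pos_less_divide_eq mult.commute add_nonneg_pos)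
    finally show ?thesis using assms[of y x] by (simp add: dist_norm)
  qed
  then show "\<exists>d>0. \<forall>x\<in>UNIV. \<forall>x'\<in>UNIV. dist x' x < d \<longrightarrow> dist (f x') (f x) < e"
    using e by (intro exI[of _ "e / (\<bar>L\<bar> + 1)"]) (auto intro: add_nonneg_pos divide_pos_pos)
qed

section \<open>Decay of the resolvent symbol and the truncated kernel equation\<close>

context closed_under_linear
begin

text \<open>Beyond a the cutoff and its derivatives vanish, so the symbol consists of powers of the
  resolvent and inherits powers of its bound. On [-a, a] continuity gives bounds, and the weights
  are bounded below there.\<close>

lemma decaying_symbol_resolvent:
  assumes \<eta>: "C2 \<eta> \<eta>1 \<eta>2" "\<And>s. \<bar>s\<bar> \<ge> a \<Longrightarrow> \<eta> s = 0" and a: "a > 0"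
    and U: "open U" "imag_spectrum \<subseteq> U" "\<And>s. s \<in> U \<Longrightarrow> \<eta> s = 1"
    and \<theta>0: "1 / 2 < \<theta>0" and bound: "\<And>s. \<bar>s\<bar> \<ge> a \<Longrightarrow> \<bar>s\<bar> powr \<theta>0 * norm (rim s) \<le> C0"
  obtains H1 H2 \<theta> C where "decaying_symbol (\<lambda>s. (1 - \<eta> s) *\<^sub>R rim s) H1 H2 \<theta> C"
proof -
  have \<psi>: "C2 (\<lambda>s. 1 - \<eta> s) (\<lambda>s. - \<eta>1 s) (\<lambda>s. - \<eta>2 s)"
    using C2_add[OF C2_const[of "1::real"] C2_bounded_linear[OF bounded_linear_minus[OF bounded_linear_ident] \<eta>(1)]] by simp
  define H where "H s = (1 - \<eta> s) *\<^sub>R rim s" for s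
  define H1 where "H1 s = (1 - \<eta> s) *\<^sub>R rim1 s + (- \<eta>1 s) *\<^sub>R rim s" for s
  define H2 where "H2 s = ((1 - \<eta> s) *\<^sub>R rim2 s + (- \<eta>1 s) *\<^sub>R rim1 s) + ((- \<eta>1 s) *\<^sub>R rim1 s + (- \<eta>2 s) *\<^sub>R rim s)" for s
  have C2H: "C2 H H1 H2"
    unfolding H_def[abs_def] H1_def[abs_def] H2_def[abs_def]
    by (rule C2_cutoff_resolvent[OF \<psi> U(1,2)]) (simp add: U(3))
  \<comment> \<open>Capping the exponent at 1 weakens the decay but meets the requirement of
    \<open>decaying_symbol\<close>, and the cap stays above 1/2.\<close>
  define \<theta> where "\<theta> = min \<theta>0 1"
  have \<theta>: "1 / 2 < \<theta>" "\<theta> \<le> 1" "\<theta> \<le> \<theta>0" using \<theta>0 by (auto simp: \<theta>_def)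
  define u where "u s = 1 + \<bar>s\<bar>" for s :: real
  have u: "u s \<ge> 1" for s by (simp add: u_def)
  have far: "\<eta> s = 0" "\<eta>1 s = 0" "\<eta>2 s = 0" if "\<bar>s\<bar> > a" for s
  proof -
    have op: "open {s. \<bar>s\<bar> > a}" by (intro open_Collect_less continuous_intros)
    have zero: "f' s = 0" if "\<And>s. (f has_vector_derivative f' s) (at s)" "\<And>s. \<bar>s\<bar> > a \<Longrightarrow> f s = 0" "\<bar>s\<bar> > a" for f f' :: "real \<Rightarrow> real" and s
    proof -
      have "((\<lambda>_. 0) has_vector_derivative f' s) (at s)"
        by (rule has_vector_derivative_transform_within_open[OF that(1) op]) (use that in auto)
      then show ?thesis using vector_derivative_unique_at has_vector_derivative_const by blast
    qed
    have e0: "\<eta> s = 0" if "\<bar>s\<bar> > a" for s using \<eta>(2) that by simp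
    have e1: "\<eta>1 s = 0" if "\<bar>s\<bar> > a" for s
      by (rule zero[of \<eta> \<eta>1]) (use \<eta>(1) e0 that in \<open>auto simp: C2_def\<close>)
    show "\<eta> s = 0" "\<eta>1 s = 0" by (rule e0[OF that], rule e1[OF that])
    show "\<eta>2 s = 0" by (rule zero[of \<eta>1 \<eta>2]) (use \<eta>(1) e1 that in \<open>auto simp: C2_def\<close>)
  qed
  \<comment> \<open>Chosen so that 1 + |s| \<le> c |s| for |s| \<ge> a, which turns powers of |s|
    into powers of 1 + |s|.\<close>
  define c where "c = 1 + 1 / a"
  define C1 where "C1 = \<bar>C0\<bar> * c powr \<theta>0"
  have C1: "C1 \<ge> 0" by (simp add: C1_def)
  have rim_far: "norm (rim s) \<le> C1 * u s powr (- \<theta>)" if s: "\<bar>s\<bar> > a" for s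
  proof -
    have s0: "\<bar>s\<bar> > 0" using s a by linarith
    have c0: "c > 0" using a by (simp add: c_def add_pos_pos)
    have "u s \<le> c * \<bar>s\<bar>" using s a by (simp add: u_def c_def field_simps)
    then have "u s powr \<theta> \<le> u s powr \<theta>0" "u s powr \<theta>0 \<le> (c * \<bar>s\<bar>) powr \<theta>0"
      using u[of s] \<theta> \<theta>0 by (auto intro!: powr_mono powr_mono2)
    then have le: "u s powr \<theta> \<le> c powr \<theta>0 * \<bar>s\<bar> powr \<theta>0" using c0 by (simp add: powr_mult)
    have "norm (rim s) * u s powr \<theta> \<le> norm (rim s) * (c powr \<theta>0 * \<bar>s\<bar> powr \<theta>0)"
      by (intro mult_left_mono le) auto
    also have "\<dots> = c powr \<theta>0 * (\<bar>s\<bar> powr \<theta>0 * norm (rim s))" by (simp add: mult_ac)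
    also have "\<dots> \<le> c powr \<theta>0 * \<bar>C0\<bar>"
      using bound[of s] s by (intro mult_left_mono) auto
    finally show ?thesis using u[of s] by (simp add: C1_def powr_minus field_simps)
  qed
  have pw: "u s powr (- \<theta>) * u s powr (- \<theta>) = u s powr (- (2 * \<theta>))" "u s powr (- \<theta>) \<le> 1" for s
    using u[of s] \<theta> powr_mono[of "- \<theta>" 0 "u s"] by (auto simp: powr_add[symmetric])
  have rim1_far: "norm (rim1 s) \<le> C1\<^sup>2 * u s powr (- (2 * \<theta>))" if s: "\<bar>s\<bar> > a" for s
  proof -
    have "norm (rim1 s) \<le> (C1 * u s powr (- \<theta>))\<^sup>2"
      using order_trans[OF norm_rim1 power_mono[OF rim_far[OF s]]] by simp
    also have "\<dots> = C1\<^sup>2 * (u s powr (- \<theta>) * u s powr (- \<theta>))" by (simp add: power2_eq_square mult_ac)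
    finally show ?thesis unfolding pw .
  qed
  have rim2_far: "norm (rim2 s) \<le> 2 * C1 ^ 3 * u s powr (- (2 * \<theta>))" if s: "\<bar>s\<bar> > a" for s
  proof -
    have "norm (rim2 s) \<le> 2 * (C1 * u s powr (- \<theta>)) ^ 3"
      using norm_rim2[of s] power_mono[OF rim_far[OF s], of 3] by simp
    also have "\<dots> = 2 * C1 ^ 3 * (u s powr (- \<theta>) * u s powr (- \<theta>)) * u s powr (- \<theta>)"
      by (simp add: power3_eq_cube mult_ac)
    \<comment> \<open>Of the three resolvent factors one is bounded by a power at most 1; the
      exponent 2 \<theta> is what the locale asks for.\<close>
    also have "\<dots> \<le> 2 * C1 ^ 3 * (u s powr (- \<theta>) * u s powr (- \<theta>)) * 1"
      by (intro mult_left_mono pw) (use C1 in auto)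
    finally show ?thesis unfolding pw by simp
  qed
  have "\<exists>B\<ge>0. \<forall>s. \<bar>s\<bar> \<le> a \<longrightarrow> norm (h s) \<le> B" if "continuous_on UNIV h" for h :: "real \<Rightarrow> 'x \<Rightarrow>\<^sub>L 'x"
  proof -
    have "compact (h ` {-a..a})"
      using that by (intro compact_continuous_image) (auto intro: continuous_on_subset)
    then obtain B where "\<And>y. y \<in> h ` {-a..a} \<Longrightarrow> norm y \<le> B" using compact_imp_bounded bounded_iff by metis
    then have "norm (h s) \<le> \<bar>B\<bar>" if "\<bar>s\<bar> \<le> a" for s
    proof -
      have "h s \<in> h ` {-a..a}" using that by (intro imageI) auto
      then show ?thesis using \<open>\<And>y. y \<in> h ` {-a..a} \<Longrightarrow> norm y \<le> B\<close>[of "h s"] by simp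
    qed
    then show ?thesis by (intro exI[of _ "\<bar>B\<bar>"]) auto
  qed
  note bounded_near = this
  obtain B0 B1 B2 where B: "B0 \<ge> 0" "B1 \<ge> 0" "B2 \<ge> 0" "\<And>s. \<bar>s\<bar> \<le> a \<Longrightarrow> norm (H s) \<le> B0"
    "\<And>s. \<bar>s\<bar> \<le> a \<Longrightarrow> norm (H1 s) \<le> B1" "\<And>s. \<bar>s\<bar> \<le> a \<Longrightarrow> norm (H2 s) \<le> B2"
    using bounded_near[OF C2_continuous(1)[OF C2H]] bounded_near[OF C2_continuous(2)[OF C2H]]
      bounded_near[OF C2_continuous(3)[OF C2H]] by blast
  \<comment> \<open>The largest value of (1 + |s|)^(2 \<theta>) on [-a, a], so that Q times either
    weight is at least 1 there.\<close>
  define Q where "Q = (1 + a) powr (2 * \<theta>)"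
  have near: "B \<le> B * Q * u s powr (- (2 * \<theta>))" "B \<le> B * Q * u s powr (- \<theta>)" if "\<bar>s\<bar> \<le> a" "B \<ge> 0" for s B
  proof -
    have "u s powr (2 * \<theta>) \<le> Q" unfolding Q_def using that(1) \<theta> u[of s] by (intro powr_mono2) (auto simp: u_def)
    then have "1 \<le> Q * u s powr (- (2 * \<theta>))" using u[of s] by (simp add: powr_minus field_simps)
    moreover have "u s powr (- (2 * \<theta>)) \<le> u s powr (- \<theta>)" using u[of s] \<theta> by (intro powr_mono) auto
    moreover have "Q \<ge> 0" by (simp add: Q_def)
    ultimately have "1 \<le> Q * u s powr (- (2 * \<theta>))" "1 \<le> Q * u s powr (- \<theta>)"
      using mult_left_mono[of "u s powr (- (2 * \<theta>))" "u s powr (- \<theta>)" Q] by auto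
    then show "B \<le> B * Q * u s powr (- (2 * \<theta>))" "B \<le> B * Q * u s powr (- \<theta>)"
      using mult_left_mono[OF _ that(2), of 1] by (auto simp: mult.assoc)
  qed
  define C where "C = B0 * Q + B1 * Q + B2 * Q + C1 + C1\<^sup>2 + 2 * C1 ^ 3"
  have Q: "Q \<ge> 0" by (simp add: Q_def)
  have parts: "0 \<le> B0 * Q" "0 \<le> B1 * Q" "0 \<le> B2 * Q" "0 \<le> C1\<^sup>2" "0 \<le> 2 * C1 ^ 3"
    using B Q C1 by auto
  have C_ge: "x * u s powr e \<le> C * u s powr e" if "x \<le> C" for x s e
    using that by (intro mult_right_mono) auto
  have "decaying_symbol H H1 H2 \<theta> C"
  proof
    show "C2 H H1 H2" by (rule C2H)
    show "1 / 2 < \<theta>" "\<theta> \<le> 1" by (rule \<theta>)+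
    show "0 \<le> C" unfolding C_def using parts C1 by linarith
    fix s
    show "norm (H s) \<le> C * (1 + \<bar>s\<bar>) powr (- \<theta>)"
    proof (cases "\<bar>s\<bar> \<le> a")
      case True
      have "B0 * Q \<le> C" unfolding C_def using parts C1 by linarith
      then show ?thesis using order_trans[OF order_trans[OF B(4)[OF True] near(2)[OF True B(1)]] C_ge] by (simp add: u_def)
    next
      case False
      have "C1 \<le> C" unfolding C_def using parts C1 by linarith
      then show ?thesis using order_trans[OF rim_far[of s] C_ge] False by (simp add: H_def far u_def)
    qed
    show "norm (H1 s) \<le> C * (1 + \<bar>s\<bar>) powr (- (2 * \<theta>))"
    proof (cases "\<bar>s\<bar> \<le> a")
      case True
      have "B1 * Q \<le> C" unfolding C_def using parts C1 by linarith
      then show ?thesis using order_trans[OF order_trans[OF B(5)[OF True] near(1)[OF True B(2)]] C_ge] by (simp add: u_def)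
    next
      case False
      have "C1\<^sup>2 \<le> C" unfolding C_def using parts C1 by linarith
      then show ?thesis using order_trans[OF rim1_far[of s] C_ge] False by (simp add: H1_def far u_def)
    qed
    show "norm (H2 s) \<le> C * (1 + \<bar>s\<bar>) powr (- (2 * \<theta>))"
    proof (cases "\<bar>s\<bar> \<le> a")
      case True
      have "B2 * Q \<le> C" unfolding C_def using parts C1 by linarith
      then show ?thesis using order_trans[OF order_trans[OF B(6)[OF True] near(1)[OF True B(3)]] C_ge] by (simp add: u_def)
    next
      case False
      have "2 * C1 ^ 3 \<le> C" unfolding C_def using parts C1 by linarith
      then show ?thesis using order_trans[OF rim2_far[of s] C_ge] False by (simp add: H2_def far u_def)
    qed
  qed
  then show thesis using that unfolding H_def[abs_def] by blast
qed

text \<open>This is the resolvent form of \<open>k' = A k + (\<rho> - \<beta>)\<close>, where \<open>\<rho>\<close> and \<open>\<beta>\<close> are the inverse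
  transforms of \<open>cutoff n\<close> and \<open>\<eta>\<close>.\<close>

lemma truncated_kernel_identity:
  assumes a: "a \<notin> imag_spectrum" "a > 0" "a \<le> real n"
    and \<eta>: "C2 \<eta> \<eta>1 \<eta>2" "\<And>s. \<bar>s\<bar> \<ge> a \<Longrightarrow> \<eta> s = 0" "\<And>s. s \<in> imag_spectrum \<Longrightarrow> \<eta> s = 1"
    and F: "C2 f f1 f2" "bounded_support f" and f: "\<And>s. f s = cutoff n s *\<^sub>R ((1 - \<eta> s) *\<^sub>R rim s)"
  shows "inv_fourier f t + (rim a o\<^sub>L (inv_fourier (\<lambda>s. s *\<^sub>R (\<i> *\<^sub>C f s)) t - (\<i> * of_real a) *\<^sub>C inv_fourier f t))
    = (inv_fourier (\<lambda>s. complex_of_real (cutoff n s)) t - inv_fourier (\<lambda>s. complex_of_real (\<eta> s)) t) *\<^sub>C rim a"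
proof -
  obtain g1 g2 where F': "C2 (\<lambda>s. s *\<^sub>R (\<i> *\<^sub>C f s)) g1 g2" "bounded_support (\<lambda>s. s *\<^sub>R (\<i> *\<^sub>C f s))"
    using C2_times_ident[OF F] by metis
  obtain c1 c2 where c: "C2 (cutoff n) c1 c2" using C2_cutoff .
  have b\<eta>: "bounded_support \<eta>" unfolding bounded_support_def using \<eta>(2) by (intro exI[of _ a]) auto
  note ccc = C2_cc(1)[OF C2_of_real[OF c] bounded_support_of_real[OF bounded_support_cutoff]]
  note cc\<eta> = C2_cc(1)[OF C2_of_real[OF \<eta>(1)] bounded_support_of_real[OF b\<eta>]]
  let ?L = "\<lambda>X. rim a o\<^sub>L X"
  have L: "bounded_linear ?L" by (rule bounded_bilinear.bounded_linear_right[OF bounded_bilinear_blinfun_compose])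
  have Lc: "?L (c *\<^sub>C X) = c *\<^sub>C ?L X" for c X
    using a(1) by (intro blinfun_eqI) (simp add: scaleC_blinfun.rep_eq rim_def res_scaleC imag_spectrum_def)
  note cf = C2_cc(1)[OF F] and cf' = C2_cc(1)[OF F']
  define h where "h s = s *\<^sub>R (\<i> *\<^sub>C f s) - (\<i> * of_real a) *\<^sub>C f s" for s
  have "bounded_support (\<lambda>s. (\<i> * of_real a) *\<^sub>C f s)"
    using F(2) by (rule bounded_support_mono) (simp add: scaleC.zero_right)
  then have cfa: "cc (\<lambda>s. (\<i> * of_real a) *\<^sub>C f s)"
    by (rule C2_cc(1)[OF C2_bounded_linear[OF scaleC.bounded_linear_right F(1)]])
  have ih: "inv_fourier h t = inv_fourier (\<lambda>s. s *\<^sub>R (\<i> *\<^sub>C f s)) t - (\<i> * of_real a) *\<^sub>C inv_fourier f t"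
    unfolding h_def inv_fourier_diff(2)[OF cf' cfa]
    by (subst inv_fourier_linear[OF scaleC.bounded_linear_right _ cf]) (simp_all add: scaleC_scaleC mult.commute)
  have cch: "cc h" unfolding h_def by (rule inv_fourier_diff(1)[OF cf' cfa])
  have ccLh: "cc (\<lambda>s. ?L (h s))"
    using cch bounded_linear.continuous_on[OF L] unfolding cc_def
    by (auto elim: bounded_support_mono simp: bounded_linear.linear[OF L, THEN linear_0])
  have point: "f s + ?L (h s) = (complex_of_real (cutoff n s) - complex_of_real (\<eta> s)) *\<^sub>C rim a" for s
  proof -
    \<comment> \<open>On the support of \<eta>, contained in [-a, a], the cutoff is 1 because a
      \<le> n; elsewhere both sides reduce to the cutoff.\<close>
    have cut: "cutoff n s * (1 - \<eta> s) = cutoff n s - \<eta> s"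
    proof (cases "\<bar>s\<bar> \<le> real n")
      case True then show ?thesis by (simp add: cutoff_eq_1)
    next
      case False then show ?thesis using \<eta>(2)[of s] a by simp
    qed
    \<comment> \<open>The resolvent identity between the frequencies a and s. On the imaginary
      spectrum the factor 1 - \<eta> s is 0 and both sides vanish.\<close>
    have e1: "(1 - \<eta> s) *\<^sub>R (rim s + (s - a) *\<^sub>R (\<i> *\<^sub>C (rim a o\<^sub>L rim s))) = (1 - \<eta> s) *\<^sub>R rim a"
    proof (cases "s \<in> imag_spectrum")
      case False
      have "rim a - rim s = (a - s) *\<^sub>R ((- \<i>) *\<^sub>C (rim a o\<^sub>L rim s))" by (rule rim_identity[OF a(1) False])
      also have "\<dots> = (s - a) *\<^sub>R (\<i> *\<^sub>C (rim a o\<^sub>L rim s))"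
        by (metis minus_diff_eq scaleC.minus_left scaleR_minus_left scaleR_minus_right)
      finally have "rim s + (s - a) *\<^sub>R (\<i> *\<^sub>C (rim a o\<^sub>L rim s)) = rim a" by (metis add_diff_cancel_left' diff_add_cancel add.commute)
      then show ?thesis by simp
    qed (simp add: \<eta>(3))
    have e2: "f s + ?L (h s) = cutoff n s *\<^sub>R ((1 - \<eta> s) *\<^sub>R (rim s + (s - a) *\<^sub>R (\<i> *\<^sub>C (rim a o\<^sub>L rim s))))"
    proof -
      have "h s = (s - a) *\<^sub>R (\<i> *\<^sub>C f s)"
        unfolding h_def by (simp add: scaleR_diff_left flip: scaleC_scaleC scaleC_of_real)
          (simp add: scaleC_scaleC mult.commute scaleC.diff_left right_diff_distrib)
      then have "?L (h s) = (s - a) *\<^sub>R (\<i> *\<^sub>C ?L (f s))"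
        by (simp add: Lc bounded_linear.linear[OF L, THEN linear_scale])
      also have "?L (f s) = cutoff n s *\<^sub>R ((1 - \<eta> s) *\<^sub>R ?L (rim s))"
        by (simp add: f bounded_linear.linear[OF L, THEN linear_scale])
      finally show ?thesis
        by (simp add: f scaleC_scaleR_commute scaleR_add_right mult_ac)
    qed
    have "f s + ?L (h s) = (cutoff n s * (1 - \<eta> s)) *\<^sub>R rim a" unfolding e2 e1 by simp
    then show ?thesis unfolding cut by (simp flip: scaleC_of_real of_real_diff)
  qed
  have "inv_fourier f t + ?L (inv_fourier h t) = inv_fourier (\<lambda>s. f s + ?L (h s)) t"
    using inv_fourier_add[OF cf ccLh, of t] inv_fourier_linear[OF L Lc cch, of t] by simp
  also have "\<dots> = inv_fourier (\<lambda>s. (complex_of_real (cutoff n s) - complex_of_real (\<eta> s)) *\<^sub>C rim a) t"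
    unfolding point ..
  also have "\<dots> = (inv_fourier (\<lambda>s. complex_of_real (cutoff n s) - complex_of_real (\<eta> s)) t) *\<^sub>C rim a"
    by (rule inv_fourier_linear[OF scaleC.bounded_linear_left _ inv_fourier_diff(1)[OF ccc cc\<eta>]])
      (simp add: scaleC_scaleC scaleC_complex_def)
  also have "inv_fourier (\<lambda>s. complex_of_real (cutoff n s) - complex_of_real (\<eta> s)) t
      = inv_fourier (\<lambda>s. complex_of_real (cutoff n s)) t - inv_fourier (\<lambda>s. complex_of_real (\<eta> s)) t"
    by (rule inv_fourier_diff(2)[OF ccc cc\<eta>])
  finally show ?thesis unfolding ih .
qed

end

text \<open>For fixed c and x the defect X (c x) - c (X x) is a complex-linear function of the
  operator X. It vanishes on the symbol, hence on its transform.\<close>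

lemma inv_fourier_bounded_clinear:
  fixes f :: "real \<Rightarrow> 'a::complex_banach \<Rightarrow>\<^sub>L 'a"
  assumes f: "cc f" and lin: "\<And>s. f s \<in> bounded_clinear_ops"
  shows "inv_fourier f t \<in> bounded_clinear_ops"
proof -
  have "blinfun_apply (inv_fourier f t) (c *\<^sub>C x) = c *\<^sub>C blinfun_apply (inv_fourier f t) x" for c x
  proof -
    define L where "L X = blinfun_apply X (c *\<^sub>C x) - c *\<^sub>C blinfun_apply X x" for X :: "'a \<Rightarrow>\<^sub>L 'a"
    have L: "bounded_linear L"
      unfolding L_def by (intro bounded_linear_sub blinfun.bounded_linear_left
          bounded_linear_compose[OF scaleC.bounded_linear_right blinfun.bounded_linear_left])
    have "inv_fourier (\<lambda>s. L (f s)) t = L (inv_fourier f t)"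
      by (rule inv_fourier_linear[OF L _ f])
        (simp add: L_def scaleC_blinfun.rep_eq scaleC.diff_right scaleC_scaleC mult.commute)
    moreover have "L (f s) = 0" for s using lin[of s] by (simp add: L_def bounded_clinear_ops_def)
    ultimately show ?thesis by (simp add: inv_fourier_def scaleC.zero_right L_def)
  qed
  then show ?thesis by (simp add: bounded_clinear_ops_def)
qed

lemma bounded_clinear_ops_limit:
  fixes X :: "nat \<Rightarrow> 'a::complex_banach \<Rightarrow>\<^sub>L 'a"
  assumes "X \<longlonglongrightarrow> Y" "\<And>n. X n \<in> bounded_clinear_ops"
  shows "Y \<in> bounded_clinear_ops"
proof -
  have "blinfun_apply Y (c *\<^sub>C x) = c *\<^sub>C blinfun_apply Y x" for c x
  proof (rule LIMSEQ_unique)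
    have "(\<lambda>n. c *\<^sub>C blinfun_apply (X n) x) \<longlonglongrightarrow> c *\<^sub>C blinfun_apply Y x"
      by (intro scaleC.tendsto tendsto_const blinfun.tendsto assms(1))
    moreover have "(\<lambda>n. blinfun_apply (X n) (c *\<^sub>C x)) = (\<lambda>n. c *\<^sub>C blinfun_apply (X n) x)"
      using assms(2) by (simp add: bounded_clinear_ops_def)
    ultimately show "(\<lambda>n. blinfun_apply (X n) (c *\<^sub>C x)) \<longlonglongrightarrow> c *\<^sub>C blinfun_apply Y x" by simp
    show "(\<lambda>n. blinfun_apply (X n) (c *\<^sub>C x)) \<longlonglongrightarrow> blinfun_apply Y (c *\<^sub>C x)"
      by (intro blinfun.tendsto tendsto_const assms(1))
  qed
  then show ?thesis by (simp add: bounded_clinear_ops_def)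
qed

text \<open>Pointwise the mollified \<open>\<phi>\<close> may fail to converge. After integration
  over an interval the mollifier acts on the Lipschitz function \<Delta> instead, and its limit at 0
  is the integral over the unshifted interval.\<close>

lemma mollified_interval_limit:
  fixes \<phi> :: "real \<Rightarrow> 'a::complex_banach" and l :: "'a \<Rightarrow> real"
  assumes \<phi>: "simple_limit borel \<phi>" "\<And>s. norm (\<phi> s) \<le> M" and l: "bounded_linear l" and pq: "p \<le> q"
  shows "(\<lambda>n. LINT r:{p..q}|lborel. l (convolution scaleC (inv_fourier (\<lambda>s. complex_of_real (cutoff n s))) \<phi> r))
    \<longlonglongrightarrow> l (bochner_integral (lebesgue_on {p..q}) \<phi>)"
proof -
  define \<Delta> where "\<Delta> s = bochner_integral (lebesgue_on {p..q}) (\<lambda>r. \<phi> (0 + r - s))" for s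
  define \<rho> where "\<rho> n = inv_fourier (\<lambda>s. complex_of_real (cutoff n s))" for n
  let ?L = "complex_functional l"
  have L: "bounded_linear ?L" by (rule bounded_linear_complex_functional[OF l])
  obtain B where B: "B \<ge> 0" "\<And>x. norm (?L x) \<le> norm x * B" using bounded_linear.nonneg_bounded[OF L] by blast
  have \<Delta>_lip: "norm (\<Delta> s' - \<Delta> s) \<le> 2 * M * \<bar>s' - s\<bar>" for s s'
    using interval_mean_lipschitz[OF \<phi>, of p q "- s'" "- s"] by (simp add: \<Delta>_def abs_minus_commute add.commute)
  have \<Delta>_bd: "norm (\<Delta> s) \<le> (q - p) * M" for s
  proof -
    have "simple_limit borel (\<lambda>r. \<phi> (0 + r - s))" by (intro simple_limit_comp[OF \<phi>(1)]) measurable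
    then show ?thesis unfolding \<Delta>_def by (rule norm_bochner_interval_le) (use \<phi>(2) pq in auto)
  qed
  have "(\<lambda>n. LINT s|lborel. \<rho> n s * ?L (\<Delta> s)) \<longlonglongrightarrow> ?L (\<Delta> 0)"
    unfolding \<rho>_def
  proof (rule mollifier_limit)
    show "continuous_on UNIV (\<lambda>s. ?L (\<Delta> s))"
      by (intro bounded_linear.continuous_on[OF L] uniformly_continuous_imp_continuous
          lipschitz_imp_uniformly_continuous[OF \<Delta>_lip])
    show "norm (?L (\<Delta> s)) \<le> (q - p) * M * B" for s
      using order_trans[OF B(2) mult_right_mono[OF \<Delta>_bd B(1)]] .
  qed
  from tendsto_Re[OF this]
  have "(\<lambda>n. Re (LINT s|lborel. \<rho> n s * ?L (\<Delta> s))) \<longlonglongrightarrow> l (bochner_integral (lebesgue_on {p..q}) \<phi>)"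
    by (simp add: Re_complex_functional \<Delta>_def)
  moreover have "Re (LINT s|lborel. \<rho> n s * ?L (\<Delta> s)) = (LINT r:{p..q}|lborel. l (convolution scaleC (\<rho> n) \<phi> r))" for n
  proof -
    obtain c1 c2 where c: "C2 (cutoff n) c1 c2" using C2_cutoff .
    note c' = C2_of_real[OF c] bounded_support_of_real[OF bounded_support_cutoff]
    note \<rho> = simple_limit_inv_fourier[OF C2_cc(1)[OF c']] integrable_norm_inv_fourier[OF c']
    \<comment> \<open>Multiples of the identity operator turn the scalar kernel into an operator
      kernel, so that \<open>convolution_interval_fubini\<close> applies.\<close>
    define G where "G s = \<rho> n s *\<^sub>C (id_blinfun :: 'a \<Rightarrow>\<^sub>L 'a)" for s
    have G: "simple_limit borel G" "integrable lborel (\<lambda>s. norm (G s))"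
    proof -
      show "simple_limit borel G"
        unfolding G_def \<rho>_def by (rule simple_limit_bilinear[OF bounded_bilinear_scaleC \<rho>(1) simple_limit_const])
      have "norm (G s) = norm (\<rho> n s) * norm (id_blinfun :: 'a \<Rightarrow>\<^sub>L 'a)" for s by (simp only: G_def norm_scaleC)
      then show "integrable lborel (\<lambda>s. norm (G s))" using \<rho>(2) by (simp add: \<rho>_def)
    qed
    have G_apply: "blinfun_apply (G s) x = \<rho> n s *\<^sub>C x" for s x by (simp add: G_def scaleC_blinfun.rep_eq)
    have "convolution scaleC (\<rho> n) \<phi> = convolution blinfun_apply G \<phi>"
      by (simp add: Defs.convolution_def G_apply fun_eq_iff)
    then have "(LINT r:{p..q}|lborel. ?L (convolution scaleC (\<rho> n) \<phi> r)) = (LINT s|lborel. \<rho> n s * ?L (\<Delta> s))"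
      using convolution_interval_fubini[OF G \<phi> L, of p q 0]
      by (simp add: G_apply complex_functional_scaleC[OF l] \<Delta>_def)
    moreover have int: "set_integrable lborel {p..q} (\<lambda>r. ?L (convolution scaleC (\<rho> n) \<phi> r))"
    proof (rule set_integrable_interval_bounded)
      have eq: "?L (convolution scaleC (\<rho> n) \<phi> r) = (LINT s|lborel. \<rho> n s * ?L (\<phi> (r - s)))" for r
        unfolding \<rho>_def by (rule complex_functional_convolution[OF l \<rho> \<phi>])
      have [measurable]: "\<rho> n \<in> borel_measurable borel" "(\<lambda>x. ?L (\<phi> x)) \<in> borel_measurable borel"
        using simple_limit_borel_measurable[OF \<rho>(1), of "\<lambda>x. x"] simple_limit_borel_measurable[OF \<phi>(1) linear_continuous_on[OF L]]
        by (auto simp: \<rho>_def continuous_on_id)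
      show "(\<lambda>r. ?L (convolution scaleC (\<rho> n) \<phi> r)) \<in> borel_measurable borel"
        unfolding eq by measurable
      show "norm (?L (convolution scaleC (\<rho> n) \<phi> r)) \<le> (LINT s|lborel. norm (G s)) * M * B" for r
        unfolding \<open>convolution scaleC (\<rho> n) \<phi> = convolution blinfun_apply G \<phi>\<close>
        using order_trans[OF B(2) mult_right_mono[OF norm_convolution_le[OF G \<phi>] B(1)]] .
    qed
    moreover have "Re (LINT r:{p..q}|lborel. ?L (convolution scaleC (\<rho> n) \<phi> r))
        = (LINT r:{p..q}|lborel. Re (?L (convolution scaleC (\<rho> n) \<phi> r)))"
      using integral_Re[OF int[unfolded set_integrable_def]] by (simp add: set_lebesgue_integral_def)
    ultimately show ?thesis by (simp add: Re_complex_functional)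
  qed
  ultimately show ?thesis by (simp add: \<rho>_def)
qed

lemma convolution_bounded_linear:
  fixes G :: "real \<Rightarrow> 'a::banach \<Rightarrow>\<^sub>L 'a"
  assumes G: "simple_limit borel G" "integrable lborel (\<lambda>s. norm (G s))"
    and \<phi>: "simple_limit borel \<phi>" "\<And>s. norm (\<phi> s) \<le> M" and L: "bounded_linear L"
    and l: "bounded_linear (l :: 'a \<Rightarrow> real)"
  shows "integrable lborel (\<lambda>s. l (L (blinfun_apply (G s) (\<phi> (t - s)))))"
    "l (L (convolution blinfun_apply G \<phi> t)) = (LINT s|lborel. l (L (blinfun_apply (G s) (\<phi> (t - s)))))"
  using convolution_functional[OF G \<phi> bounded_linear_compose[OF l L]] by auto

lemma uniformly_continuous_on_uniform_limit:
  fixes f :: "nat \<Rightarrow> real \<Rightarrow> 'a::real_normed_vector"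
  assumes f: "\<And>n. uniformly_continuous_on S (f n)" and lim: "uniform_limit S f g sequentially"
  shows "uniformly_continuous_on S g"
  unfolding uniformly_continuous_on_def
proof (intro allI impI)
  fix e :: real assume "e > 0"
  then have e: "e / 3 > 0" by simp
  from uniform_limitD[OF lim e] obtain n where n: "\<And>x. x \<in> S \<Longrightarrow> dist (f n x) (g x) < e / 3"
    by (auto simp: eventually_sequentially)
  obtain d where d: "d > 0" "\<And>x x'. x \<in> S \<Longrightarrow> x' \<in> S \<Longrightarrow> dist x' x < d \<Longrightarrow> dist (f n x') (f n x) < e / 3"
    using f[of n] e unfolding uniformly_continuous_on_def by blast
  have "dist (g x') (g x) < e" if "x \<in> S" "x' \<in> S" "dist x' x < d" for x x'
    using n[OF that(1)] n[OF that(2)] d(2)[OF that]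
      dist_triangle[of "g x'" "g x" "f n x'"] dist_triangle[of "f n x'" "g x" "f n x"]
    by (simp add: dist_commute)
  then show "\<exists>d>0. \<forall>x\<in>S. \<forall>x'\<in>S. dist x' x < d \<longrightarrow> dist (g x') (g x) < e"
    using d(1) by blast
qed

context closed_under_linear
begin

text \<open>The kernel identity is applied to \<phi>(t - s) and integrated in s. The part coming
  from \<eta> vanishes by \<open>kill\<close>, which is where the spectral condition enters the
  equation.\<close>

lemma truncated_solution_identity:
  assumes a: "a \<notin> imag_spectrum" "a > 0" "a \<le> real n"
    and \<eta>: "C2 \<eta> \<eta>1 \<eta>2" "\<And>s. \<bar>s\<bar> \<ge> a \<Longrightarrow> \<eta> s = 0" "\<And>s. s \<in> imag_spectrum \<Longrightarrow> \<eta> s = 1"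
    and kill: "\<And>t. convolution scaleC (inv_fourier (\<lambda>s. complex_of_real (\<eta> s))) \<phi> t = 0"
    and F: "C2 f f1 f2" "bounded_support f" and f: "\<And>s. f s = cutoff n s *\<^sub>R ((1 - \<eta> s) *\<^sub>R rim s)"
    and \<phi>: "simple_limit borel \<phi>" "\<And>s. norm (\<phi> s) \<le> M"
  defines "u \<equiv> convolution blinfun_apply (inv_fourier f) \<phi>"
    and "u' \<equiv> convolution blinfun_apply (inv_fourier (\<lambda>s. s *\<^sub>R (\<i> *\<^sub>C f s))) \<phi>"
  shows "u t + blinfun_apply (rim a) (u' t - (\<i> * of_real a) *\<^sub>C u t)
    = blinfun_apply (rim a) (convolution scaleC (inv_fourier (\<lambda>s. complex_of_real (cutoff n s))) \<phi> t)"
proof (rule eq_if_functionals_eq)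
  fix l :: "'x \<Rightarrow> real" assume l: "bounded_linear l"
  obtain g1 g2 where F': "C2 (\<lambda>s. s *\<^sub>R (\<i> *\<^sub>C f s)) g1 g2" "bounded_support (\<lambda>s. s *\<^sub>R (\<i> *\<^sub>C f s))"
    using C2_times_ident[OF F] by metis
  obtain c1 c2 where c: "C2 (cutoff n) c1 c2" using C2_cutoff .
  have b\<eta>: "bounded_support \<eta>" unfolding bounded_support_def using \<eta>(2) by (intro exI[of _ a]) auto
  note c' = C2_of_real[OF c] bounded_support_of_real[OF bounded_support_cutoff]
  note \<eta>' = C2_of_real[OF \<eta>(1)] bounded_support_of_real[OF b\<eta>]
  note K = simple_limit_inv_fourier[OF C2_cc(1)[OF F]] integrable_norm_inv_fourier[OF F]
  note K' = simple_limit_inv_fourier[OF C2_cc(1)[OF F']] integrable_norm_inv_fourier[OF F']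
  let ?R = "blinfun_apply (rim a)"
  have R: "bounded_linear ?R" by (rule blinfun.bounded_linear_right)
  let ?z = "\<i> * of_real a"
  have Rz: "bounded_linear (\<lambda>x. ?R (?z *\<^sub>C x))"
    by (rule bounded_linear_compose[OF R scaleC.bounded_linear_right])
  have I: "bounded_linear (\<lambda>x. x :: 'x)" by (rule bounded_linear_ident)
  have lR: "bounded_linear (\<lambda>x. l (?R x))" by (rule bounded_linear_compose[OF l R])
  have R_scaleC: "?R (c *\<^sub>C x) = c *\<^sub>C ?R x" for c x
    using a(1) by (simp add: rim_def res_scaleC imag_spectrum_def)
  have scalar: "l (?R (convolution scaleC (inv_fourier k) \<phi> t)) = (LINT s|lborel. l (?R (inv_fourier k s *\<^sub>C \<phi> (t - s))))"
    "integrable lborel (\<lambda>s. l (?R (inv_fourier k s *\<^sub>C \<phi> (t - s))))"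
    if k: "C2 k k1 k2" "bounded_support k" for k :: "real \<Rightarrow> complex" and k1 k2
    unfolding Defs.convolution_def
    using bochner_integral_functional_UNIV[OF convolution_integrand(1,2)[OF bounded_bilinear_scaleC norm_scaleC_le
        simple_limit_inv_fourier[OF C2_cc(1)[OF k]] integrable_norm_inv_fourier[OF k] \<phi>] lR] by auto
  note i1 = convolution_bounded_linear[OF K \<phi> I l, of t] and i2 = convolution_bounded_linear[OF K' \<phi> R l, of t]
    and i3 = convolution_bounded_linear[OF K \<phi> Rz l, of t]
  note sc = scalar[OF c'] scalar[OF \<eta>']
  have "l (u t + ?R (u' t - ?z *\<^sub>C u t)) = l (u t) + (l (?R (u' t)) - l (?R (?z *\<^sub>C u t)))"
    by (simp add: bounded_linear.linear[OF l, THEN linear_add] bounded_linear.linear[OF l, THEN linear_diff]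
        bounded_linear.linear[OF R, THEN linear_diff])
  also have "\<dots> = (LINT s|lborel. l (blinfun_apply (inv_fourier f s) (\<phi> (t - s)))
      + (l (?R (blinfun_apply (inv_fourier (\<lambda>s. s *\<^sub>R (\<i> *\<^sub>C f s)) s) (\<phi> (t - s))))
        - l (?R (?z *\<^sub>C blinfun_apply (inv_fourier f s) (\<phi> (t - s))))))"
    unfolding u_def u'_def i1(2) i2(2) i3(2) using i1(1) i2(1) i3(1) by simp
  also have "\<dots> = (LINT s|lborel. l (?R (inv_fourier (\<lambda>s. complex_of_real (cutoff n s)) s *\<^sub>C \<phi> (t - s)))
      - l (?R (inv_fourier (\<lambda>s. complex_of_real (\<eta> s)) s *\<^sub>C \<phi> (t - s))))"
  proof (intro Bochner_Integration.integral_cong refl)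
    fix s
    let ?x = "\<phi> (t - s)"
    have "blinfun_apply (inv_fourier f s) ?x + ?R (blinfun_apply (inv_fourier (\<lambda>s. s *\<^sub>R (\<i> *\<^sub>C f s)) s) ?x - ?z *\<^sub>C blinfun_apply (inv_fourier f s) ?x)
        = (inv_fourier (\<lambda>s. complex_of_real (cutoff n s)) s - inv_fourier (\<lambda>s. complex_of_real (\<eta> s)) s) *\<^sub>C ?R ?x"
      using arg_cong[OF truncated_kernel_identity[OF a \<eta> F f, of s], of "\<lambda>X. blinfun_apply X ?x"]
      by (simp add: blinfun.add_left blinfun.diff_left scaleC_blinfun.rep_eq)
    also have "\<dots> = ?R (inv_fourier (\<lambda>s. complex_of_real (cutoff n s)) s *\<^sub>C ?x) - ?R (inv_fourier (\<lambda>s. complex_of_real (\<eta> s)) s *\<^sub>C ?x)"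
      by (simp add: R_scaleC scaleC.diff_left)
    finally have e: "blinfun_apply (inv_fourier f s) ?x + ?R (blinfun_apply (inv_fourier (\<lambda>s. s *\<^sub>R (\<i> *\<^sub>C f s)) s) ?x - ?z *\<^sub>C blinfun_apply (inv_fourier f s) ?x)
        = ?R (inv_fourier (\<lambda>s. complex_of_real (cutoff n s)) s *\<^sub>C ?x) - ?R (inv_fourier (\<lambda>s. complex_of_real (\<eta> s)) s *\<^sub>C ?x)" .
    show "l (blinfun_apply (inv_fourier f s) ?x)
      + (l (?R (blinfun_apply (inv_fourier (\<lambda>s. s *\<^sub>R (\<i> *\<^sub>C f s)) s) ?x))
        - l (?R (?z *\<^sub>C blinfun_apply (inv_fourier f s) ?x)))
      = l (?R (inv_fourier (\<lambda>s. complex_of_real (cutoff n s)) s *\<^sub>C ?x)) - l (?R (inv_fourier (\<lambda>s. complex_of_real (\<eta> s)) s *\<^sub>C ?x))"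
      using arg_cong[OF e, of l]
      by (simp only: bounded_linear.linear[OF l, THEN linear_add] bounded_linear.linear[OF l, THEN linear_diff] blinfun.diff_right)
  qed
  also have "\<dots> = l (?R (convolution scaleC (inv_fourier (\<lambda>s. complex_of_real (cutoff n s))) \<phi> t))
      - l (?R (convolution scaleC (inv_fourier (\<lambda>s. complex_of_real (\<eta> s))) \<phi> t))"
    unfolding sc(1,3) using sc(2,4) by simp
  finally show "l (u t + ?R (u' t - ?z *\<^sub>C u t)) = l (?R (convolution scaleC (inv_fourier (\<lambda>s. complex_of_real (cutoff n s))) \<phi> t))"
    by (simp add: kill blinfun.zero_right bounded_linear.linear[OF l, THEN linear_0])
qed

text \<open>The interval equation is u(q) - u(p) = A I + P, with I and P the integrals of u and
  \<open>\<phi>\<close>, after application of R(ia, A). In this form it involves bounded operators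
  only and passes to the limit: convergence of the kernels in mean makes the truncated solutions
  converge uniformly.\<close>

theorem limit_solution:
  assumes a: "a \<notin> imag_spectrum" "a > 0"
    and \<eta>: "C2 \<eta> \<eta>1 \<eta>2" "\<And>s. \<bar>s\<bar> \<ge> a \<Longrightarrow> \<eta> s = 0" "\<And>s. s \<in> imag_spectrum \<Longrightarrow> \<eta> s = 1"
    and kill: "\<And>t. convolution scaleC (inv_fourier (\<lambda>s. complex_of_real (\<eta> s))) \<phi> t = 0"
    and \<phi>: "simple_limit borel \<phi>" "\<And>s. norm (\<phi> s) \<le> M"
    and H: "decaying_symbol (\<lambda>s. (1 - \<eta> s) *\<^sub>R rim s) H1 H2 \<theta> C"
  obtains G where "\<And>t. G t \<in> bounded_clinear_ops" "simple_limit borel G" "integrable lborel (\<lambda>t. norm (G t))"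
    "uniformly_continuous_on UNIV (convolution blinfun_apply G \<phi>)"
    "\<And>p q. p \<le> q \<Longrightarrow> bochner_integral (lebesgue_on {p..q}) (convolution blinfun_apply G \<phi>)
      + blinfun_apply (rim a) (convolution blinfun_apply G \<phi> q - convolution blinfun_apply G \<phi> p
          - (\<i> * of_real a) *\<^sub>C bochner_integral (lebesgue_on {p..q}) (convolution blinfun_apply G \<phi>))
      = blinfun_apply (rim a) (bochner_integral (lebesgue_on {p..q}) \<phi>)"
proof -
  interpret H: decaying_symbol "\<lambda>s. (1 - \<eta> s) *\<^sub>R rim s" H1 H2 \<theta> C by (rule H)
  obtain G where G: "\<And>t. t \<noteq> 0 \<Longrightarrow> isCont G t" "\<And>t. t \<noteq> 0 \<Longrightarrow> (\<lambda>n. H.kernel n t) \<longlonglongrightarrow> G t" "G 0 = 0"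
    "integrable lborel (\<lambda>t. norm (G t))" "\<And>n. integrable lborel (\<lambda>t. norm (H.kernel n t - G t))"
    "(\<lambda>n. LINT t|lborel. norm (H.kernel n t - G t)) \<longlonglongrightarrow> 0"
    using H.ex_limit_kernel by blast
  define f where "f n s = cutoff n s *\<^sub>R ((1 - \<eta> s) *\<^sub>R rim s)" for n s
  have "\<exists>f1 f2. C2 (f n) f1 f2" for n
  proof (rule H.ex_cut_derivatives)
    fix F1 F2 assume "\<And>n. C2 (\<lambda>s. cutoff n s *\<^sub>R ((1 - \<eta> s) *\<^sub>R rim s)) (F1 n) (F2 n)"
    then show "\<exists>f1 f2. C2 (f n) f1 f2" unfolding f_def[abs_def] by blast
  qed
  then obtain f1 f2 where F: "\<And>n. C2 (f n) (f1 n) (f2 n)" by metis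
  have bs: "bounded_support (f n)" for n unfolding f_def[abs_def] by (rule cutoff_bounded_support)
  have kern: "H.kernel n = inv_fourier (f n)" for n by (simp add: H.kernel_def f_def[abs_def])
  note cc = C2_cc(1)[OF F bs]
  note K = simple_limit_inv_fourier[OF cc] integrable_norm_inv_fourier[OF F bs]
  have slG: "simple_limit borel G" by (rule simple_limit_if_isCont[OF G(1)])
  have clin: "G t \<in> bounded_clinear_ops" for t
  proof (cases "t = 0")
    case True
    then show ?thesis by (simp add: G(3) bounded_clinear_ops_def scaleC.zero_right)
  next
    case False
    have "f n s \<in> bounded_clinear_ops" for n s
    proof (cases "s \<in> imag_spectrum")
      case True
      then show ?thesis by (simp add: f_def \<eta>(3) bounded_clinear_ops_def scaleC.zero_right)
    next
      case False
      then have "rim s \<in> bounded_clinear_ops" unfolding rim_def by (intro res_clinear) (simp add: imag_spectrum_def)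
      then show ?thesis by (simp add: f_def bounded_clinear_ops_def blinfun.scaleR_left scaleC_scaleR_commute)
    qed
    then show ?thesis
      using inv_fourier_bounded_clinear[OF cc] bounded_clinear_ops_limit[OF G(2)[OF False]] by (simp add: kern)
  qed
  define u where "u = convolution blinfun_apply G \<phi>"
  define un where "un n = convolution blinfun_apply (inv_fourier (f n)) \<phi>" for n
  define un' where "un' n = convolution blinfun_apply (inv_fourier (\<lambda>s. s *\<^sub>R (\<i> *\<^sub>C f n s))) \<phi>" for n
  define e where "e n = (LINT t|lborel. norm (H.kernel n t - G t)) * M" for n
  have e_lim: "e \<longlonglongrightarrow> 0" unfolding e_def using tendsto_mult_left_zero[OF G(6)] .
  have un_u: "norm (un n t - u t) \<le> e n" for n t
    unfolding un_def u_def e_def kern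
    by (rule convolution_dist[OF K slG G(4) \<phi>]) (use G(5) in \<open>simp add: kern\<close>)
  have un_uc: "uniformly_continuous_on UNIV (un n)" for n
    unfolding un_def by (rule continuous_convolution_inv_fourier[OF F bs \<phi>])
  have un_lim: "uniform_limit UNIV un u sequentially"
  proof (rule uniform_limitI)
    fix d :: real assume "d > 0"
    then have "\<forall>\<^sub>F n in sequentially. e n < d" using order_tendstoD(2)[OF e_lim] by blast
    then show "\<forall>\<^sub>F n in sequentially. \<forall>x\<in>UNIV. dist (un n x) (u x) < d"
      by eventually_elim (use un_u in \<open>auto simp: dist_norm intro: le_less_trans\<close>)
  qed
  have u_uc: "uniformly_continuous_on UNIV u"
    by (rule uniformly_continuous_on_uniform_limit[OF un_uc un_lim])
  have sl: "simple_limit borel u" "simple_limit borel (un n)" for n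
    using u_uc un_uc by (auto intro: simple_limit_continuous uniformly_continuous_imp_continuous)
  have bd: "norm (u t) \<le> (LINT s|lborel. norm (G s)) * M" "norm (un n t) \<le> (LINT s|lborel. norm (inv_fourier (f n) s)) * M" for t n
    unfolding u_def un_def by (rule norm_convolution_le[OF slG G(4) \<phi>], rule norm_convolution_le[OF K \<phi>])
  show thesis
  proof (rule that[OF clin slG G(4)])
    show "uniformly_continuous_on UNIV (convolution blinfun_apply G \<phi>)" using u_uc by (simp add: u_def)
    fix p q :: real assume pq: "p \<le> q"
    let ?I = "\<lambda>f. bochner_integral (lebesgue_on {p..q}) f"
    let ?R = "blinfun_apply (rim a)" and ?z = "\<i> * of_real a"
    have R: "bounded_linear ?R" by (rule blinfun.bounded_linear_right)
    have "?I u + ?R (u q - u p - ?z *\<^sub>C ?I u) = ?R (?I \<phi>)"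
    proof (rule eq_if_functionals_eq)
      fix l :: "'x \<Rightarrow> real" assume l: "bounded_linear l"
      have lR: "bounded_linear (\<lambda>x. l (?R x))" by (rule bounded_linear_compose[OF l R])
      have lRz: "bounded_linear (\<lambda>x. l (?R (?z *\<^sub>C x)))"
        by (rule bounded_linear_compose[OF lR scaleC.bounded_linear_right])
      note lin = bounded_linear.linear[OF l, THEN linear_add] bounded_linear.linear[OF l, THEN linear_diff] blinfun.diff_right
      have In: "(\<lambda>n. ?I (un n)) \<longlonglongrightarrow> ?I u"
      proof (rule LIM_zero_cancel, rule Lim_null_comparison)
        show "\<forall>\<^sub>F n in sequentially. norm (?I (un n) - ?I u) \<le> (q - p) * e n"
          by (intro always_eventually allI bochner_interval_dist[OF sl(2) bd(2) sl(1) bd(1) pq] un_u)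
        show "(\<lambda>n. (q - p) * e n) \<longlonglongrightarrow> 0" by (rule tendsto_mult_right_zero[OF e_lim])
      qed
      have un_t: "(\<lambda>n. un n t) \<longlonglongrightarrow> u t" for t
        using tendsto_uniform_limitI[OF un_lim] by simp
      have lim1: "(\<lambda>n. l (?I (un n) + ?R (un n q - un n p - ?z *\<^sub>C ?I (un n)))) \<longlonglongrightarrow> l (?I u + ?R (u q - u p - ?z *\<^sub>C ?I u))"
        by (intro bounded_linear.tendsto[OF l] tendsto_add In bounded_linear.tendsto[OF R] tendsto_diff un_t
            bounded_linear.tendsto[OF scaleC.bounded_linear_right])
      have ev: "\<forall>\<^sub>F n in sequentially. l (?I (un n) + ?R (un n q - un n p - ?z *\<^sub>C ?I (un n)))
          = (LINT r:{p..q}|lborel. l (?R (convolution scaleC (inv_fourier (\<lambda>s. complex_of_real (cutoff n s))) \<phi> r)))"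
        \<comment> \<open>Indices n \<ge> a are those for which the cutoff is 1 on the support of
          \<eta>.\<close>
        using eventually_ge_at_top[of "nat \<lceil>a\<rceil>"]
      proof eventually_elim
        case (elim n)
        then have an: "a \<le> real n" by linarith
        obtain g1 g2 where F': "C2 (\<lambda>s. s *\<^sub>R (\<i> *\<^sub>C f n s)) g1 g2" "bounded_support (\<lambda>s. s *\<^sub>R (\<i> *\<^sub>C f n s))"
          using C2_times_ident[OF F bs] by metis
        note K' = simple_limit_inv_fourier[OF C2_cc(1)[OF F']] integrable_norm_inv_fourier[OF F']
        have sl': "simple_limit borel (un' n)"
          unfolding un'_def
          by (intro simple_limit_continuous uniformly_continuous_imp_continuous continuous_convolution_inv_fourier[OF F' \<phi>])
        have bd': "norm (un' n t) \<le> (LINT s|lborel. norm (inv_fourier (\<lambda>s. s *\<^sub>R (\<i> *\<^sub>C f n s)) s)) * M" for t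
          unfolding un'_def by (rule norm_convolution_le[OF K' \<phi>])
        note j1 = interval_functional[OF sl(2)[of n] bd(2) l, of p q]
        note j2 = interval_functional[OF sl' bd' lR, of p q]
        note j3 = interval_functional[OF sl(2)[of n] bd(2) lRz, of p q]
        have "l (?I (un n) + ?R (un n q - un n p - ?z *\<^sub>C ?I (un n)))
            = l (?I (un n)) + (l (?R (un n q - un n p)) - l (?R (?z *\<^sub>C ?I (un n))))"
          by (simp add: lin)
        also have "l (?R (un n q - un n p)) = (LINT r:{p..q}|lborel. l (?R (un' n r)))"
          unfolding un_def un'_def by (rule convolution_has_weak_derivative[OF F bs \<phi> lR pq])
        also have "l (?I (un n)) + ((LINT r:{p..q}|lborel. l (?R (un' n r))) - l (?R (?z *\<^sub>C ?I (un n))))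
            = (LINT r:{p..q}|lborel. l (un n r) + (l (?R (un' n r)) - l (?R (?z *\<^sub>C un n r))))"
          unfolding j1(2) j3(2) using j1(1) j2(1) j3(1) by (simp add: set_integral_add set_integral_diff)
        also have "\<dots> = (LINT r:{p..q}|lborel. l (?R (convolution scaleC (inv_fourier (\<lambda>s. complex_of_real (cutoff n s))) \<phi> r)))"
        proof -
          have "un n r + ?R (un' n r - ?z *\<^sub>C un n r) = ?R (convolution scaleC (inv_fourier (\<lambda>s. complex_of_real (cutoff n s))) \<phi> r)" for r
            unfolding un_def un'_def by (rule truncated_solution_identity[OF a an \<eta> kill F bs f_def \<phi>])
          from arg_cong[OF this, of l]
          have "l (un n r) + (l (?R (un' n r)) - l (?R (?z *\<^sub>C un n r)))
            = l (?R (convolution scaleC (inv_fourier (\<lambda>s. complex_of_real (cutoff n s))) \<phi> r))" for r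
            by (simp only: lin)
          then show ?thesis by simp
        qed
        finally show ?case .
      qed
      have lim2: "(\<lambda>n. LINT r:{p..q}|lborel. l (?R (convolution scaleC (inv_fourier (\<lambda>s. complex_of_real (cutoff n s))) \<phi> r)))
          \<longlonglongrightarrow> l (?R (?I \<phi>))"
        by (rule mollified_interval_limit[OF \<phi> lR pq])
      show "l (?I u + ?R (u q - u p - ?z *\<^sub>C ?I u)) = l (?R (?I \<phi>))"
        by (rule LIMSEQ_unique[OF Lim_transform_eventually[OF lim1 ev] lim2])
    qed
    then show "bochner_integral (lebesgue_on {p..q}) (convolution blinfun_apply G \<phi>)
      + blinfun_apply (rim a) (convolution blinfun_apply G \<phi> q - convolution blinfun_apply G \<phi> p
          - (\<i> * of_real a) *\<^sub>C bochner_integral (lebesgue_on {p..q}) (convolution blinfun_apply G \<phi>))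
      = blinfun_apply (rim a) (bochner_integral (lebesgue_on {p..q}) \<phi>)"
      by (simp add: u_def)
  qed
qed

text \<open>Solving the identity for the integral V exhibits it as a value of R(ia, A). This places
  V in the domain, and applying ia - A recovers the equation with A.\<close>

lemma mild_solution_if_interval_identity:
  assumes a: "a \<notin> imag_spectrum" and u: "continuous_on UNIV u"
    and id: "\<And>p q. p \<le> q \<Longrightarrow> bochner_integral (lebesgue_on {p..q}) u
      + blinfun_apply (rim a) (u q - u p - (\<i> * of_real a) *\<^sub>C bochner_integral (lebesgue_on {p..q}) u)
      = blinfun_apply (rim a) (bochner_integral (lebesgue_on {p..q}) \<phi>)"
  shows "mild_solution D A \<phi> u"
  unfolding mild_solution_def
proof (intro conjI allI u)
  fix t
  define V where "V = integral_from_0 t u"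
  define P where "P = integral_from_0 t \<phi>"
  let ?R = "blinfun_apply (rim a)" and ?z = "\<i> * of_real a"
  have "V + ?R (u t - u 0 - ?z *\<^sub>C V) = ?R P"
  proof (cases "0 \<le> t")
    case True
    then show ?thesis using id[of 0 t] by (simp add: V_def P_def integral_from_0_def)
  next
    case False
    \<comment> \<open>For negative t the integral from 0 is minus the integral over [t, 0], so the
      identity on that interval is the required one with all signs reversed.\<close>
    then have "- V + ?R (u 0 - u t - ?z *\<^sub>C (- V)) = ?R (- P)"
      using id[of t 0] by (simp add: V_def P_def integral_from_0_def)
    then have "- (V + ?R (u t - u 0 - ?z *\<^sub>C V)) = - ?R P"
      by (simp add: blinfun.diff_right blinfun.minus_right scaleC.minus_right blinfun.add_right algebra_simps)
    then show ?thesis by (simp only: neg_equal_iff_equal)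
  qed
  then have V: "V = ?R (?z *\<^sub>C V - (u t - u 0 - P))"
    by (simp add: blinfun.diff_right blinfun.add_right algebra_simps)
  have a': "?z \<notin> op_spectrum D A" using a by (simp add: imag_spectrum_def)
  have "?z *\<^sub>C V - A V = ?z *\<^sub>C V - (u t - u 0 - P)"
    using res_apply(2)[OF a', of "?z *\<^sub>C V - (u t - u 0 - P)"] V by (simp add: rim_def)
  then show "u t = u 0 + A (integral_from_0 t u) + integral_from_0 t \<phi>"
    unfolding V_def[symmetric] P_def[symmetric] by (simp add: algebra_simps)
  show "integral_from_0 t u \<in> D"
    unfolding V_def[symmetric] using res_apply(1)[OF a'] V by (metis rim_def)
qed

end

section \<open>Function classes invariant under convolution\<close>

lemma BUC_UNIV_iff: "f \<in> BUC UNIV \<longleftrightarrow> bounded (range f) \<and> uniformly_continuous_on UNIV f"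
  by (simp add: BUC_def restr_def)

lemma restr_BUC:
  assumes "f \<in> BUC UNIV" shows "restr J f \<in> BUC J"
proof -
  have "bounded (f ` J)" "uniformly_continuous_on J f"
    using assms unfolding BUC_UNIV_iff uniformly_continuous_on_def
    by (auto intro: bounded_subset) (meson UNIV_I)
  moreover have "restr J f ` J = f ` J" by (auto simp: restr_def)
  moreover have "uniformly_continuous_on J (restr J f) \<longleftrightarrow> uniformly_continuous_on J f"
    unfolding uniformly_continuous_on_def by (simp add: restr_def)
  moreover have "restr J (restr J f) = restr J f" by (auto simp: restr_def fun_eq_iff)
  ultimately show ?thesis by (simp add: BUC_def)
qed

lemma BUC_UNIV_simple_limit: "f \<in> BUC UNIV \<Longrightarrow> simple_limit borel f"
  by (intro simple_limit_continuous uniformly_continuous_imp_continuous) (simp add: BUC_UNIV_iff)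

lemma BUC_UNIV_bounded:
  assumes "f \<in> BUC UNIV" obtains M where "\<And>t. norm (f t) \<le> M" "M \<ge> 0"
proof -
  obtain M where M: "\<And>t. norm (f t) \<le> M" using assms unfolding BUC_UNIV_iff bounded_iff by blast
  then show thesis using that order_trans[OF norm_ge_zero M[of 0]] by blast
qed

lemma interval_mean_BUC:
  fixes \<phi> :: "real \<Rightarrow> 'a::banach"
  assumes \<phi>: "simple_limit borel \<phi>" "\<And>s. norm (\<phi> s) \<le> M" and h: "h \<ge> 0"
  shows "(\<lambda>t. c *\<^sub>R bochner_integral (lebesgue_on {0..h}) (\<lambda>r. \<phi> (t + r))) \<in> BUC UNIV"
  unfolding BUC_UNIV_iff
proof
  have "norm (c *\<^sub>R bochner_integral (lebesgue_on {0..h}) (\<lambda>r. \<phi> (t + r))) \<le> \<bar>c\<bar> * ((h - 0) * M)" for t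
  proof -
    have "simple_limit borel (\<lambda>r. \<phi> (t + r))" by (intro simple_limit_comp[OF \<phi>(1)]) measurable
    from norm_bochner_interval_le[OF this \<phi>(2) h]
    show ?thesis by (simp add: mult_left_mono)
  qed
  then show "bounded (range (\<lambda>t. c *\<^sub>R bochner_integral (lebesgue_on {0..h}) (\<lambda>r. \<phi> (t + r))))"
    unfolding bounded_iff by blast
  have "norm (c *\<^sub>R bochner_integral (lebesgue_on {0..h}) (\<lambda>r. \<phi> (t' + r)) - c *\<^sub>R bochner_integral (lebesgue_on {0..h}) (\<lambda>r. \<phi> (t + r)))
      \<le> \<bar>c\<bar> * (2 * M) * \<bar>t' - t\<bar>" for t t'
    using mult_left_mono[OF interval_mean_lipschitz[OF \<phi>, of 0 h t' t], of "\<bar>c\<bar>"]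
    by (simp add: mult.assoc flip: scaleR_diff_right)
  then show "uniformly_continuous_on UNIV (\<lambda>t. c *\<^sub>R bochner_integral (lebesgue_on {0..h}) (\<lambda>r. \<phi> (t + r)))"
    by (rule lipschitz_imp_uniformly_continuous)
qed

lemma bochner_integral_bounded_clinear:
  fixes G :: "real \<Rightarrow> 'a::complex_banach \<Rightarrow>\<^sub>L 'a"
  assumes G: "simple_limit borel G" "integrable lborel (\<lambda>s. norm (G s))" "\<And>s. G s \<in> bounded_clinear_ops"
    and S: "S \<in> sets borel"
  shows "bochner_integral (lebesgue_on S) G \<in> bounded_clinear_ops"
proof -
  have int: "set_integrable lborel S (\<lambda>s. norm (G s))"
    unfolding set_integrable_def using G(2) S by (intro integrable_mult_indicator) auto
  have "blinfun_apply (bochner_integral (lebesgue_on S) G) (c *\<^sub>C x) = c *\<^sub>C blinfun_apply (bochner_integral (lebesgue_on S) G) x" for c x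
  proof (rule eq_if_functionals_eq)
    fix l :: "'a \<Rightarrow> real" assume l: "bounded_linear l"
    have l1: "bounded_linear (\<lambda>X :: 'a \<Rightarrow>\<^sub>L 'a. l (blinfun_apply X (c *\<^sub>C x)))"
      by (rule bounded_linear_compose[OF l blinfun.bounded_linear_left])
    have l2: "bounded_linear (\<lambda>X :: 'a \<Rightarrow>\<^sub>L 'a. l (c *\<^sub>C blinfun_apply X x))"
      by (rule bounded_linear_compose[OF l bounded_linear_compose[OF scaleC.bounded_linear_right blinfun.bounded_linear_left]])
    show "l (blinfun_apply (bochner_integral (lebesgue_on S) G) (c *\<^sub>C x)) = l (c *\<^sub>C blinfun_apply (bochner_integral (lebesgue_on S) G) x)"
      unfolding bochner_integral_functional(2)[OF S G(1) int l1] bochner_integral_functional(2)[OF S G(1) int l2]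
      using G(3) by (simp add: bounded_clinear_ops_def)
  qed
  then show ?thesis by (simp add: bounded_clinear_ops_def)
qed

text \<open>These closure conditions are tailored to Riemann sums of a convolution: translates,
  operators and finite sums, with \<open>zero\<close> for the empty sum, followed by a uniform
  limit.\<close>

locale function_class =
  fixes J :: "real set" and \<F> :: "(real \<Rightarrow> 'x::complex_banach) set"
  assumes zero: "(\<lambda>_. 0) \<in> \<F>"
    and add: "f \<in> \<F> \<Longrightarrow> g \<in> \<F> \<Longrightarrow> (\<lambda>t. f t + g t) \<in> \<F>"
    and limit: "(\<And>n::nat. \<phi>s n \<in> \<F> \<inter> BUC J) \<Longrightarrow> uniform_limit J \<phi>s \<psi> sequentially \<Longrightarrow> restr J \<psi> \<in> \<F>"
    and translate: "f \<in> BUC UNIV \<Longrightarrow> restr J f \<in> \<F> \<Longrightarrow> restr J (\<lambda>t. f (b + t)) \<in> \<F>"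
    and operator: "f \<in> BUC UNIV \<Longrightarrow> restr J f \<in> \<F> \<Longrightarrow> B \<in> bounded_clinear_ops
      \<Longrightarrow> restr J (\<lambda>t. blinfun_apply B (f t)) \<in> \<F>"
begin

lemma limit_BUC:
  assumes "\<And>n::nat. f n \<in> BUC UNIV" "\<And>n. restr J (f n) \<in> \<F>" and lim: "uniform_limit UNIV f g sequentially"
  shows "restr J g \<in> \<F>"
proof (rule limit[of "\<lambda>n. restr J (f n)"])
  show "restr J (f n) \<in> \<F> \<inter> BUC J" for n using assms(1,2) restr_BUC by blast
  show "uniform_limit J (\<lambda>n. restr J (f n)) g sequentially"
    using uniform_limit_on_subset[OF lim subset_UNIV, of J]
    by (auto simp: uniform_limit_iff restr_def)
qed

lemma translated_operator:
  assumes f: "f \<in> BUC UNIV" "restr J f \<in> \<F>" and B: "B \<in> bounded_clinear_ops"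
  shows "(\<lambda>t. blinfun_apply B (f (b + t))) \<in> BUC UNIV" "restr J (\<lambda>t. blinfun_apply B (f (b + t))) \<in> \<F>"
proof -
  have fb: "(\<lambda>t. f (b + t)) \<in> BUC UNIV"
  proof -
    have "bounded (range (\<lambda>t. f (b + t)))" using f(1) unfolding BUC_UNIV_iff by (auto intro: bounded_subset)
    moreover have "uniformly_continuous_on UNIV (\<lambda>t. f (b + t))"
      using f(1) unfolding BUC_UNIV_iff uniformly_continuous_on_def by (auto simp: dist_real_def) (metis add_diff_cancel_left)
    ultimately show ?thesis by (simp add: BUC_UNIV_iff)
  qed
  show "restr J (\<lambda>t. blinfun_apply B (f (b + t))) \<in> \<F>"
    by (rule operator[OF fb translate[OF f] B])
  have "bounded (blinfun_apply B ` range (\<lambda>t. f (b + t)))"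
    using fb by (intro bounded_linear_image[OF _ blinfun.bounded_linear_right, of "range (\<lambda>t. f (b + t))"])
      (simp add: BUC_UNIV_iff)
  moreover have "uniformly_continuous_on UNIV (\<lambda>t. blinfun_apply B (f (b + t)))"
    by (rule bounded_linear.uniformly_continuous_on[OF blinfun.bounded_linear_right])
      (use fb in \<open>simp add: BUC_UNIV_iff\<close>)
  ultimately show "(\<lambda>t. blinfun_apply B (f (b + t))) \<in> BUC UNIV"
    by (simp add: BUC_UNIV_iff image_image)
qed

lemma sum_translated_operators:
  assumes f: "f \<in> BUC UNIV" "restr J f \<in> \<F>" and "finite X" "\<And>j. B j \<in> bounded_clinear_ops"
  shows "(\<lambda>t. \<Sum>j\<in>X. blinfun_apply (B j) (f (b j + t))) \<in> BUC UNIV \<and>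
    restr J (\<lambda>t. \<Sum>j\<in>X. blinfun_apply (B j) (f (b j + t))) \<in> \<F>"
  using assms(3)
proof (induction X rule: finite_induct)
  case empty
  have "restr J (\<lambda>t. 0) = (\<lambda>t. 0 :: 'x)" by (simp add: restr_def fun_eq_iff)
  then show ?case using zero by (simp add: BUC_UNIV_iff uniformly_continuous_on_const)
next
  case (insert j X)
  let ?g = "\<lambda>t. blinfun_apply (B j) (f (b j + t))" and ?s = "\<lambda>t. \<Sum>j\<in>X. blinfun_apply (B j) (f (b j + t))"
  note g = translated_operator[OF f assms(4)[of j], of "b j"]
  have "restr J (\<lambda>t. ?g t + ?s t) = (\<lambda>t. restr J ?g t + restr J ?s t)" by (auto simp: restr_def fun_eq_iff)
  moreover have "(\<lambda>t. ?g t + ?s t) \<in> BUC UNIV"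
  proof -
    obtain M where M: "\<And>t. norm (?g t) \<le> M" using BUC_UNIV_bounded[OF g(1)] by blast
    obtain N where N: "\<And>t. norm (?s t) \<le> N" using BUC_UNIV_bounded[of ?s] insert.IH by blast
    have "norm (?g t + ?s t) \<le> M + N" for t using norm_triangle_mono[OF M N] .
    moreover have "uniformly_continuous_on UNIV (\<lambda>t. ?g t + ?s t)"
      using g(1) insert.IH unfolding BUC_UNIV_iff by (intro uniformly_continuous_on_add) auto
    ultimately show ?thesis unfolding BUC_UNIV_iff bounded_iff by blast
  qed
  ultimately show ?case using insert add g(2) by simp
qed

text \<open>The convolution is a uniform limit of Riemann sums whose coefficients are the integrals of the kernel over small cells.\<close>

lemma convolution_mem:
  assumes f: "f \<in> BUC UNIV" "restr J f \<in> \<F>"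
    and G: "simple_limit borel G" "integrable lborel (\<lambda>s. norm (G s))" "\<And>s. G s \<in> bounded_clinear_ops"
  shows "restr J (convolution blinfun_apply G f) \<in> \<F>"
proof -
  obtain M where M: "\<And>t. norm (f t) \<le> M" "M \<ge> 0" using BUC_UNIV_bounded[OF f(1)] by blast
  have slf: "simple_limit borel f" by (rule BUC_UNIV_simple_limit[OF f(1)])
  define m where "m n = real (Suc n)" for n
  have m: "m n > 0" for n by (simp add: m_def)
  \<comment> \<open>Half-open cells partition the line, so that s lies in exactly one of them, with
    index floor(m s).\<close>
  define cell where "cell n j = {of_int j / m n..<(of_int j + 1) / m n}" for n and j :: int
  \<comment> \<open>With m = n + 1 these 2 m^2 indices label the cells of width 1 / m that fill [-m,
    m).\<close>
  define X where "X n = {- (int (Suc n) * int (Suc n))..<int (Suc n) * int (Suc n)}" for n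
  define B where "B n j = bochner_integral (lebesgue_on (cell n j)) G" for n j
  define S where "S n t = (\<Sum>j\<in>X n. blinfun_apply (B n j) (f (- (of_int j / m n) + t)))" for n t
  have cell_borel: "cell n j \<in> sets borel" for n j by (simp add: cell_def)
  have in_cell: "s \<in> cell n j \<longleftrightarrow> \<lfloor>m n * s\<rfloor> = j" for s n j
    using m[of n] by (auto simp: cell_def floor_eq_iff field_simps)
  have in_X: "\<lfloor>m n * s\<rfloor> \<in> X n \<longleftrightarrow> s \<in> {- m n..<m n}" for s n
  proof -
    have "\<lfloor>m n * s\<rfloor> \<in> X n \<longleftrightarrow> of_int (- (int (Suc n) * int (Suc n))) \<le> m n * s \<and> m n * s < of_int (int (Suc n) * int (Suc n))"
      unfolding X_def atLeastLessThan_iff le_floor_iff floor_less_iff ..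
    also have "\<dots> \<longleftrightarrow> m n * (- m n) \<le> m n * s \<and> m n * s < m n * m n"
      by (simp add: m_def del: of_nat_Suc)
    also have "\<dots> \<longleftrightarrow> s \<in> {- m n..<m n}"
      using m[of n] by (simp only: mult_le_cancel_left_pos mult_less_cancel_left_pos atLeastLessThan_iff)
    finally show ?thesis .
  qed
  have S_mem: "S n \<in> BUC UNIV" "restr J (S n) \<in> \<F>" for n
    using sum_translated_operators[OF f, of "X n" "B n" "\<lambda>j. - (of_int j / m n)"]
      bochner_integral_bounded_clinear[OF G cell_borel]
    by (auto simp: S_def[abs_def] B_def X_def)
  define tail where "tail n = (LINT s|lborel. indicator (- {- m n..<m n}) s * norm (G s))" for n
  have [measurable]: "(\<lambda>s. norm (G s)) \<in> borel_measurable borel" using G(2) by auto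
  have tail_int: "integrable lborel (\<lambda>s. indicator (- {- m n..<m n}) s * norm (G s))" for n
    by (rule Bochner_Integration.integrable_bound[OF G(2)]) (auto simp: indicator_def)
  have tail_lim: "tail \<longlonglongrightarrow> 0"
  proof -
    have "tail \<longlonglongrightarrow> (LINT s|(lborel :: real measure). (0::real))"
      unfolding tail_def
    proof (rule integral_dominated_convergence[where w = "\<lambda>s. norm (G s)"])
      show "AE s in lborel. (\<lambda>n. indicator (- {- m n..<m n}) s * norm (G s)) \<longlonglongrightarrow> 0"
      proof (intro AE_I2)
        fix s :: real
        have "\<forall>\<^sub>F n in sequentially. 0 = indicator (- {- m n..<m n}) s * norm (G s)"
          using eventually_ge_at_top[of "nat \<lceil>\<bar>s\<bar>\<rceil>"]
        proof eventually_elim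
          case (elim n)
          then have "\<bar>s\<bar> < m n" by (simp add: m_def)
          then show ?case by (auto simp: indicator_def)
        qed
        then show "(\<lambda>n. indicator (- {- m n..<m n}) s * norm (G s)) \<longlonglongrightarrow> 0"
          by (rule Lim_transform_eventually[OF tendsto_const])
      qed
    qed (use G(2) in \<open>auto simp: indicator_def\<close>)
    then show ?thesis by simp
  qed
  \<comment> \<open>On [-m, m) the sample point differs from t - s by at most 1 / m and the
    oscillation of \<open>f\<close> is at most e. Outside no cell contributes, and the whole
    integrand is charged to the tail.\<close>
  have err: "norm (S n t - convolution blinfun_apply G f t) \<le> e * (LINT s|lborel. norm (G s)) + M * tail n"
    if e: "e > 0" "\<And>x y. \<bar>x - y\<bar> \<le> 1 / m n \<Longrightarrow> norm (f x - f y) \<le> e" for e n t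
  proof (rule norm_le_if_functionals_le)
    fix l :: "'x \<Rightarrow> real" assume l: "bounded_linear l" "\<And>y. \<bar>l y\<bar> \<le> norm y"
    have cellint: "set_integrable lborel (cell n j) (\<lambda>s. norm (G s))" for j
      unfolding set_integrable_def using G(2) cell_borel by (intro integrable_mult_indicator) auto
    note bl = bounded_linear_compose[OF l(1) blinfun.bounded_linear_left]
    note cf = bochner_integral_functional[OF cell_borel G(1) cellint bl]
    let ?term = "\<lambda>s j. indicator (cell n j) s *\<^sub>R l (blinfun_apply (G s) (f (- (of_int j / m n) + t)))"
    have ti: "integrable lborel (\<lambda>s. ?term s j)" for j
    proof -
      have "set_integrable lborel (cell n j) (\<lambda>s. l (blinfun_apply (G s) (f (- (of_int j / m n) + t))))"
        by (rule cf(1))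
      then show ?thesis by (simp add: set_integrable_def)
    qed
    have lS: "l (S n t) = (LINT s|lborel. (\<Sum>j\<in>X n. ?term s j))"
      unfolding S_def B_def bounded_linear.linear[OF l(1), THEN linear_sum] cf(2) set_lebesgue_integral_def
      by (rule Bochner_Integration.integral_sum[OF ti, symmetric])
    note lc = convolution_functional[OF G(1,2) slf M(1) l(1), of t]
    have "l (S n t - convolution blinfun_apply G f t)
        = (LINT s|lborel. (\<Sum>j\<in>X n. ?term s j) - l (blinfun_apply (G s) (f (t - s))))"
      unfolding bounded_linear.linear[OF l(1), THEN linear_diff] lS lc(2)
      by (rule Bochner_Integration.integral_diff[OF Bochner_Integration.integrable_sum[OF ti] lc(1), symmetric])
    also have "\<dots> \<le> (LINT s|lborel. e * norm (G s) + M * (indicator (- {- m n..<m n}) s * norm (G s)))"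
    proof (rule integral_mono)
      show "integrable lborel (\<lambda>s. (\<Sum>j\<in>X n. ?term s j) - l (blinfun_apply (G s) (f (t - s))))"
        by (intro Bochner_Integration.integrable_diff Bochner_Integration.integrable_sum ti lc(1))
      show "integrable lborel (\<lambda>s. e * norm (G s) + M * (indicator (- {- m n..<m n}) s * norm (G s)))"
        by (intro Bochner_Integration.integrable_add integrable_mult_right G(2) tail_int)
      fix s
      have "(\<Sum>j\<in>X n. ?term s j) = (\<Sum>j\<in>X n. if j = \<lfloor>m n * s\<rfloor> then l (blinfun_apply (G s) (f (- (of_int j / m n) + t))) else 0)"
        by (intro sum.cong refl) (auto simp: indicator_def in_cell)
      also have "\<dots> = (if \<lfloor>m n * s\<rfloor> \<in> X n then l (blinfun_apply (G s) (f (- (of_int \<lfloor>m n * s\<rfloor> / m n) + t))) else 0)"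
        by (rule sum.delta) (simp add: X_def)
      finally have sum_eq: "(\<Sum>j\<in>X n. ?term s j) = (if s \<in> {- m n..<m n} then l (blinfun_apply (G s) (f (- (of_int \<lfloor>m n * s\<rfloor> / m n) + t))) else 0)"
        unfolding in_X .
      show "(\<Sum>j\<in>X n. ?term s j) - l (blinfun_apply (G s) (f (t - s)))
          \<le> e * norm (G s) + M * (indicator (- {- m n..<m n}) s * norm (G s))"
      proof (cases "s \<in> {- m n..<m n}")
        case True
        let ?y = "- (of_int \<lfloor>m n * s\<rfloor> / m n) + t"
        have "\<bar>?y - (t - s)\<bar> = \<bar>m n * s - of_int \<lfloor>m n * s\<rfloor>\<bar> / m n"
        proof -
          have "?y - (t - s) = (m n * s - of_int \<lfloor>m n * s\<rfloor>) / m n" using m[of n] by (simp add: field_simps)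
          then show ?thesis using m[of n] by simp
        qed
        also have "\<dots> \<le> 1 / m n" using m[of n] by (intro divide_right_mono) linarith+
        finally have "norm (f ?y - f (t - s)) \<le> e" by (rule e(2))
        then have "norm (blinfun_apply (G s) (f ?y - f (t - s))) \<le> norm (G s) * e"
          using order_trans[OF norm_blinfun mult_left_mono] by (metis norm_ge_zero)
        then have "l (blinfun_apply (G s) (f ?y) - blinfun_apply (G s) (f (t - s))) \<le> e * norm (G s)"
          using l(2)[of "blinfun_apply (G s) (f ?y - f (t - s))"] by (simp add: blinfun.diff_right mult.commute)
        then show ?thesis
          unfolding sum_eq using True by (simp add: bounded_linear.linear[OF l(1), THEN linear_diff])
      next
        case False
        have "norm (blinfun_apply (G s) (f (t - s))) \<le> norm (G s) * M"
          by (rule order_trans[OF norm_blinfun mult_left_mono[OF M(1)]]) simp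
        then have "- l (blinfun_apply (G s) (f (t - s))) \<le> M * norm (G s)"
          using l(2)[of "blinfun_apply (G s) (f (t - s))"] by (simp add: mult.commute)
        moreover have "0 \<le> e * norm (G s)" using e(1) by simp
        ultimately show ?thesis unfolding sum_eq using False by (auto simp: indicator_def)
      qed
    qed
    also have "\<dots> = e * (LINT s|lborel. norm (G s)) + M * tail n"
      unfolding tail_def using G(2) tail_int
      by (subst Bochner_Integration.integral_add) auto
    finally show "l (S n t - convolution blinfun_apply G f t) \<le> e * (LINT s|lborel. norm (G s)) + M * tail n" .
  qed
  have "uniform_limit UNIV S (convolution blinfun_apply G f) sequentially"
  proof (rule uniform_limitI)
    fix \<epsilon> :: real assume \<epsilon>: "\<epsilon> > 0"
    define I where "I = (LINT s|lborel. norm (G s))"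
    have I: "I \<ge> 0" by (simp add: I_def)
    \<comment> \<open>The added 1 keeps the quotient defined when the kernel has integral norm
      0.\<close>
    define e where "e = \<epsilon> / (2 * (I + 1))"
    have e: "e > 0" using \<epsilon> I by (simp add: e_def)
    have "e * I \<le> e * (I + 1)" using e by (intro mult_left_mono) auto
    also have "e * (I + 1) = \<epsilon> / 2" using I by (simp add: e_def field_simps)
    finally have eI: "e * I \<le> \<epsilon> / 2" .
    obtain d where d: "d > 0" "\<And>x y. dist x y < d \<Longrightarrow> dist (f x) (f y) < e"
      using f(1) e unfolding BUC_UNIV_iff uniformly_continuous_on_def by blast
    have "\<forall>\<^sub>F n in sequentially. M * tail n < \<epsilon> / 2"
      using order_tendstoD(2)[OF tendsto_mult_right_zero[OF tail_lim, of M], of "\<epsilon> / 2"] \<epsilon> by simp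
    moreover have "\<forall>\<^sub>F n in sequentially. 1 / m n < d"
      using order_tendstoD(2)[OF LIMSEQ_inverse_real_of_nat d(1)] by (simp add: m_def inverse_eq_divide)
    ultimately show "\<forall>\<^sub>F n in sequentially. \<forall>t\<in>UNIV. dist (S n t) (convolution blinfun_apply G f t) < \<epsilon>"
    proof eventually_elim
      case (elim n)
      have "norm (f x - f y) \<le> e" if "\<bar>x - y\<bar> \<le> 1 / m n" for x y
        using d(2)[of x y] elim(2) that by (simp add: dist_norm)
      from err[OF e this] have "norm (S n t - convolution blinfun_apply G f t) \<le> e * I + M * tail n" for t
        by (simp add: I_def)
      moreover have "e * I + M * tail n < \<epsilon>" using eI elim(1) by linarith
      ultimately show ?case by (auto simp: dist_norm intro: le_less_trans)
    qed
  qed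
  then show ?thesis by (rule limit_BUC[OF S_mem])
qed

text \<open>\<open>convolution_mem\<close> requires a uniformly continuous function. The interval
  means of \<open>\<phi>\<close> are Lipschitz and take its place, because averaging commutes with
  convolution by Fubini.\<close>

lemma convolution_mem_if_means_mem:
  assumes \<phi>: "simple_limit borel \<phi>" "\<And>s. norm (\<phi> s) \<le> M"
    and means: "\<And>h. h > 0 \<Longrightarrow> restr J (\<lambda>t. (1 / h) *\<^sub>R bochner_integral (lebesgue_on {0..h}) (\<lambda>r. \<phi> (t + r))) \<in> \<F>"
    and G: "simple_limit borel G" "integrable lborel (\<lambda>s. norm (G s))" "\<And>s. G s \<in> bounded_clinear_ops"
    and u: "uniformly_continuous_on UNIV (convolution blinfun_apply G \<phi>)"
  shows "restr J (convolution blinfun_apply G \<phi>) \<in> \<F>"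
proof -
  let ?u = "convolution blinfun_apply G \<phi>"
  define h where "h n = 1 / real (Suc n)" for n
  have h: "h n > 0" for n by (simp add: h_def)
  define \<phi>h where "\<phi>h n t = (1 / h n) *\<^sub>R bochner_integral (lebesgue_on {0..h n}) (\<lambda>r. \<phi> (t + r))" for n t
  define uh where "uh n t = (1 / h n) *\<^sub>R bochner_integral (lebesgue_on {0..h n}) (\<lambda>r. ?u (t + r))" for n t
  have slu: "simple_limit borel ?u" by (intro simple_limit_continuous uniformly_continuous_imp_continuous u)
  note bu = norm_convolution_le[OF G(1,2) \<phi>]
  have \<phi>h: "\<phi>h n \<in> BUC UNIV" "uh n \<in> BUC UNIV" for n
    unfolding \<phi>h_def uh_def using h[of n]
    by (rule interval_mean_BUC[OF \<phi> less_imp_le], rule interval_mean_BUC[OF slu bu less_imp_le])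
  have sl_shift: "simple_limit borel (\<lambda>r. \<psi> (t + r))" if "simple_limit borel \<psi>" for \<psi> :: "real \<Rightarrow> 'x" and t
    by (intro simple_limit_comp[OF that]) measurable
  have conv: "convolution blinfun_apply G (\<phi>h n) = uh n" for n
  proof
    fix t
    obtain Mh where Mh: "\<And>t. norm (\<phi>h n t) \<le> Mh" using BUC_UNIV_bounded[OF \<phi>h(1)] by metis
    show "convolution blinfun_apply G (\<phi>h n) t = uh n t"
    proof (rule eq_if_functionals_eq)
      fix l :: "'x \<Rightarrow> real" assume l: "bounded_linear l"
      have "l (uh n t) = (1 / h n) * (LINT r:{0..h n}|lborel. l (?u (t + r)))"
        unfolding uh_def using interval_functional(2)[OF sl_shift[OF slu] bu l]
        by (simp add: bounded_linear.linear[OF l, THEN linear_scale])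
      also have "\<dots> = (1 / h n) * (LINT s|lborel. l (blinfun_apply (G s) (bochner_integral (lebesgue_on {0..h n}) (\<lambda>r. \<phi> (t + r - s)))))"
        unfolding convolution_interval_fubini[OF G(1,2) \<phi> l] ..
      also have "\<dots> = (LINT s|lborel. l (blinfun_apply (G s) (\<phi>h n (t - s))))"
        by (simp add: \<phi>h_def blinfun.scaleR_right bounded_linear.linear[OF l, THEN linear_scale] diff_add_eq)
      also have "\<dots> = l (convolution blinfun_apply G (\<phi>h n) t)"
        by (rule convolution_functional(2)[OF G(1,2) BUC_UNIV_simple_limit[OF \<phi>h(1)] Mh l, symmetric])
      finally show "l (convolution blinfun_apply G (\<phi>h n) t) = l (uh n t)" ..
    qed
  qed
  have mem: "restr J (uh n) \<in> \<F>" for n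
    using convolution_mem[OF \<phi>h(1) _ G, of n] means[OF h[of n]] unfolding conv by (simp add: \<phi>h_def[abs_def])
  have "uniform_limit UNIV uh ?u sequentially"
  proof (rule uniform_limitI)
    fix \<epsilon> :: real assume \<epsilon>: "\<epsilon> > 0"
    then obtain d where d: "d > 0" "\<And>x y. dist x y < d \<Longrightarrow> dist (?u x) (?u y) < \<epsilon> / 2"
      using u unfolding uniformly_continuous_on_def by (metis UNIV_I half_gt_zero)
    have "\<forall>\<^sub>F n in sequentially. h n < d"
      using order_tendstoD(2)[OF LIMSEQ_inverse_real_of_nat d(1)] by (simp add: h_def inverse_eq_divide)
    then show "\<forall>\<^sub>F n in sequentially. \<forall>t\<in>UNIV. dist (uh n t) (?u t) < \<epsilon>"
    proof eventually_elim
      case (elim n)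
      have "dist (uh n t) (?u t) < \<epsilon>" for t
      proof -
        have dle: "norm (bochner_integral (lebesgue_on {0..h n}) (\<lambda>r. ?u (t + r)) - bochner_integral (lebesgue_on {0..h n}) (\<lambda>_. ?u t))
            \<le> (h n - 0) * (\<epsilon> / 2)"
        proof (rule bochner_interval_dist[OF sl_shift[OF slu] bu simple_limit_const order_refl])
          show "0 \<le> h n" using h[of n] by simp
          fix x assume "x \<in> {0..h n}"
          then have "dist (t + x) t < d" using elim by (simp add: dist_norm)
          then show "norm (?u (t + x) - ?u t) \<le> \<epsilon> / 2" using d(2) by (simp add: dist_norm less_imp_le)
        qed
        have c: "bochner_integral (lebesgue_on {0..h n}) (\<lambda>_. ?u t) = h n *\<^sub>R ?u t"
          using bochner_interval_const[of 0 "h n" "?u t"] h[of n] by simp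
        have "uh n t - ?u t = (1 / h n) *\<^sub>R (bochner_integral (lebesgue_on {0..h n}) (\<lambda>r. ?u (t + r)) - h n *\<^sub>R ?u t)"
          using h[of n] by (simp add: uh_def scaleR_diff_right)
        then have "norm (uh n t - ?u t) = (1 / h n) * norm (bochner_integral (lebesgue_on {0..h n}) (\<lambda>r. ?u (t + r)) - h n *\<^sub>R ?u t)"
          using h[of n] by (simp only: norm_scaleR) simp
        also have "\<dots> \<le> (1 / h n) * ((h n - 0) * (\<epsilon> / 2))"
          using h[of n] by (intro mult_left_mono dle[unfolded c]) auto
        finally have "norm (uh n t - ?u t) \<le> (1 / h n) * ((h n - 0) * (\<epsilon> / 2))" .
        then have "norm (uh n t - ?u t) \<le> \<epsilon> / 2" using h[of n] by simp
        then show ?thesis using \<epsilon> by (simp add: dist_norm)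
      qed
      then show ?case by blast
    qed
  qed
  then show ?thesis by (rule limit_BUC[OF \<phi>h(2) mem])
qed

end

section \<open>Independence of null sets and assembly of the result\<close>

lemma AE_lebesgue_on:
  assumes "AE x in lborel. P x" "S \<in> sets borel"
  shows "AE x in lebesgue_on S. P x"
  using AE_completion[OF assms(1)] assms(2) by (subst AE_restrict_space_iff) (auto elim: eventually_mono)

lemma convolution_cong_AE_right:
  assumes "AE t in lborel. \<phi> t = \<phi>' t"
  shows "convolution p g \<phi> = convolution p g \<phi>'"
proof
  fix t
  have "AE s in lebesgue. \<phi> (t - s) = \<phi>' (t - s)"
    using AE_completion[OF AE_lborel_affine[OF assms, of "-1" t]] by simp
  then have "AE s in lebesgue. p (g s) (\<phi> (t - s)) = p (g s) (\<phi>' (t - s))"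
    by (rule eventually_mono) simp
  then show "convolution p g \<phi> t = convolution p g \<phi>' t"
    unfolding Defs.convolution_def by (rule bochner_integral_cong_AE)
qed

lemma convolution_cong_AE_left:
  assumes "AE t in lborel. \<phi> t = \<phi>' t"
  shows "convolution p \<phi> f = convolution p \<phi>' f"
proof
  fix t
  have "AE s in lebesgue. p (\<phi> s) (f (t - s)) = p (\<phi>' s) (f (t - s))"
    using AE_completion[OF assms] by (rule eventually_mono) simp
  then show "convolution p \<phi> f t = convolution p \<phi>' f t"
    unfolding Defs.convolution_def by (rule bochner_integral_cong_AE)
qed

lemma integral_from_0_cong_AE:
  "AE t in lborel. \<phi> t = \<phi>' t \<Longrightarrow> integral_from_0 t \<phi> = integral_from_0 t \<phi>'"
  unfolding integral_from_0_def by (auto intro!: bochner_integral_cong_AE AE_lebesgue_on arg_cong[where f = uminus])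

theorem theorem6p3:
  fixes D :: "'x::complex_banach set" and A :: "'x \<Rightarrow> 'x"
    and T :: "real \<Rightarrow> 'x \<Rightarrow>\<^sub>L 'x"
    and K F J :: "real set" and a \<theta> :: real
    and \<phi> :: "real \<Rightarrow> 'x" and \<F> :: "(real \<Rightarrow> 'x) set"
  assumes "C0_semigroup T" and "is_generator D A T"
    and "K = {t. \<i> * complex_of_real t \<in> op_spectrum D A}"
    and "0 < a" and "K \<subseteq> {-a<..<a}"
    and "1 / 2 < \<theta>"
    and "bdd_above ((\<lambda>t. \<bar>t\<bar> powr \<theta> * onorm (resolvent D A (\<i> * complex_of_real t)))
           ` (UNIV - {-a<..<a}))"
    and "closed F" and "F \<subseteq> UNIV - K"
    and "\<phi> \<in> Linf" and "beurling_spectrum \<phi> \<subseteq> F"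
    and "J = UNIV \<or> J = {0..}"
    and "\<F> \<subseteq> L1loc J"
    and "(\<lambda>_. 0) \<in> \<F>"
    and "\<And>f g. f \<in> \<F> \<Longrightarrow> g \<in> \<F> \<Longrightarrow> (\<lambda>t. f t + g t) \<in> \<F>"
    and "\<And>c f. f \<in> \<F> \<Longrightarrow> (\<lambda>t. c *\<^sub>C f t) \<in> \<F>"
    and "\<And>\<phi>s \<psi>. (\<And>n::nat. \<phi>s n \<in> \<F> \<inter> BUC J) \<Longrightarrow> uniform_limit J \<phi>s \<psi> sequentially
           \<Longrightarrow> restr J \<psi> \<in> \<F>"
    and "\<And>f b. f \<in> BUC UNIV \<Longrightarrow> restr J f \<in> \<F> \<Longrightarrow> restr J (\<lambda>t. f (b + t)) \<in> \<F>"
    and "\<And>f B. f \<in> BUC UNIV \<Longrightarrow> restr J f \<in> \<F> \<Longrightarrow> B \<in> bounded_clinear_ops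
           \<Longrightarrow> restr J (\<lambda>t. blinfun_apply B (f t)) \<in> \<F>"
    and "restr J \<phi> \<in> mean_class J \<F>"
  shows "\<exists>G :: real \<Rightarrow> 'x \<Rightarrow>\<^sub>L 'x.
           (\<forall>t. G t \<in> bounded_clinear_ops) \<and> bochner_integrable lebesgue G \<and>
           mild_solution D A \<phi> (convolution blinfun_apply G \<phi>) \<and>
           convolution blinfun_apply G \<phi> \<in> BUC UNIV \<and>
           restr J (convolution blinfun_apply G \<phi>) \<in> \<F>"
proof -
  interpret closed_under_linear D A by (rule generator_linear[OF assms(1,2)])
  interpret function_class J \<F>
    by unfold_locales (fact assms(14), fact assms(15), fact assms(17), fact assms(18), fact assms(19))
  have K: "imag_spectrum = K" by (simp add: imag_spectrum_def assms(3))
  have outside: "s \<notin> imag_spectrum" if "\<bar>s\<bar> \<ge> a" for s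
  proof
    assume "s \<in> imag_spectrum"
    then have "s \<in> {-a<..<a}" using assms(5) K by blast
    then show False using that by auto
  qed
  obtain C where "AE t in lebesgue. norm (\<phi> t) \<le> C" and meas: "strongly_measurable lebesgue \<phi>"
    using assms(10) by (auto simp: Linf_def)
  then have C: "AE t in lebesgue. norm (\<phi> t) \<le> max C 0" by (auto elim: eventually_mono)
  \<comment> \<open>An everywhere bounded Borel representative. Convolutions, spectrum, means and
    integrals do not see the change, so the construction runs with it throughout.\<close>
  obtain \<phi>' where \<phi>': "simple_limit borel \<phi>'" "AE t in lborel. \<phi> t = \<phi>' t" "\<And>t. norm (\<phi>' t) \<le> max C 0"
    using strongly_measurable_ex_simple_limit[OF meas C] by auto
  have conv: "convolution blinfun_apply G \<phi> = convolution blinfun_apply G \<phi>'" for G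
    by (rule convolution_cong_AE_right[OF \<phi>'(2)])
  have "beurling_spectrum \<phi> = beurling_spectrum \<phi>'"
    unfolding beurling_spectrum_def convolution_cong_AE_left[OF \<phi>'(2)] ..
  then have disj: "imag_spectrum \<inter> beurling_spectrum \<phi>' = {}" using assms(9,11) by (auto simp: K)
  have "bounded imag_spectrum" using assms(5) by (auto simp: K intro: bounded_subset[of "{-a<..<a}"])
  then have comp: "compact imag_spectrum" using closed_imag_spectrum by (simp add: compact_eq_bounded_closed)
  obtain \<eta> \<eta>1 \<eta>2 :: "real \<Rightarrow> real" and U where \<eta>: "C2 \<eta> \<eta>1 \<eta>2" "\<And>s. \<bar>s\<bar> \<ge> a \<Longrightarrow> \<eta> s = 0"
    "open U" "imag_spectrum \<subseteq> U" "\<And>s. s \<in> U \<Longrightarrow> \<eta> s = 1"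
    "\<And>t. convolution scaleC (inv_fourier (\<lambda>s. complex_of_real (\<eta> s))) \<phi>' t = 0"
    using ex_spectral_cutoff[OF \<phi>'(1,3) comp assms(5)[folded K] disj] by metis
  obtain C0 where C0: "\<And>s. \<bar>s\<bar> \<ge> a \<Longrightarrow> \<bar>s\<bar> powr \<theta> * norm (rim s) \<le> C0"
  proof -
    obtain C0 where C0: "\<And>t. t \<in> UNIV - {-a<..<a} \<Longrightarrow> \<bar>t\<bar> powr \<theta> * onorm (resolvent D A (\<i> * complex_of_real t)) \<le> C0"
    proof -
      obtain M where M: "\<forall>x\<in>(\<lambda>t. \<bar>t\<bar> powr \<theta> * onorm (resolvent D A (\<i> * complex_of_real t))) ` (UNIV - {-a<..<a}). x \<le> M"
        using assms(7) unfolding bdd_above_def by blast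
      show thesis by (rule that[of M]) (use M in blast)
    qed
    show thesis
    proof (rule that)
      fix s assume s: "\<bar>s\<bar> \<ge> a"
      then have "s \<in> UNIV - {-a<..<a}" by auto
      from C0[OF this] show "\<bar>s\<bar> powr \<theta> * norm (rim s) \<le> C0"
        using outside[OF s] onorm_resolvent[of "\<i> * complex_of_real s"] by (simp add: rim_def imag_spectrum_def)
    qed
  qed
  obtain H1 H2 \<theta>' C' where H: "decaying_symbol (\<lambda>s. (1 - \<eta> s) *\<^sub>R rim s) H1 H2 \<theta>' C'"
    using decaying_symbol_resolvent[OF \<eta>(1,2) assms(4) \<eta>(3-5) assms(6) C0] by metis
  \<comment> \<open>Since the imaginary spectrum lies strictly inside (-a, a), R(ia, A) is available
    as the bounded operator that replaces A.\<close>
  have a: "a \<notin> imag_spectrum" using outside[of a] by simp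
  have \<eta>K: "\<eta> s = 1" if "s \<in> imag_spectrum" for s using \<eta>(4,5) that by blast
  obtain G where G: "\<And>t. G t \<in> bounded_clinear_ops" "simple_limit borel G" "integrable lborel (\<lambda>t. norm (G t))"
    "uniformly_continuous_on UNIV (convolution blinfun_apply G \<phi>')"
    "\<And>p q. p \<le> q \<Longrightarrow> bochner_integral (lebesgue_on {p..q}) (convolution blinfun_apply G \<phi>')
      + blinfun_apply (rim a) (convolution blinfun_apply G \<phi>' q - convolution blinfun_apply G \<phi>' p
          - (\<i> * of_real a) *\<^sub>C bochner_integral (lebesgue_on {p..q}) (convolution blinfun_apply G \<phi>'))
      = blinfun_apply (rim a) (bochner_integral (lebesgue_on {p..q}) \<phi>')"
    using limit_solution[OF a assms(4) \<eta>(1,2) \<eta>K \<eta>(6) \<phi>'(1,3) H] by blast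
  have "mild_solution D A \<phi>' (convolution blinfun_apply G \<phi>')"
    by (rule mild_solution_if_interval_identity[OF a uniformly_continuous_imp_continuous[OF G(4)] G(5)])
  then have mild: "mild_solution D A \<phi> (convolution blinfun_apply G \<phi>)"
    unfolding conv mild_solution_def integral_from_0_cong_AE[OF \<phi>'(2)] .
  have buc: "convolution blinfun_apply G \<phi> \<in> BUC UNIV"
    unfolding conv BUC_UNIV_iff bounded_iff using G(4) norm_convolution_le[OF G(2,3) \<phi>'(1,3)] by blast
  have "restr J (\<lambda>t. (1 / h) *\<^sub>R bochner_integral (lebesgue_on {0..h}) (\<lambda>r. \<phi>' (t + r))) \<in> \<F>" if h: "h > 0" for h
  proof -
    have "bochner_integral (lebesgue_on {0..h}) (\<lambda>s. restr J \<phi> (t + s)) = bochner_integral (lebesgue_on {0..h}) (\<lambda>r. \<phi>' (t + r))"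
      if t: "t \<in> J" for t
    proof (rule bochner_integral_cong_AE)
      have "AE s in lebesgue_on {0..h}. \<phi> (t + s) = \<phi>' (t + s)"
        using AE_lborel_affine[OF \<phi>'(2), of 1 t] by (intro AE_lebesgue_on) auto
      \<comment> \<open>Both choices of J are closed under adding a nonnegative number, so a mean
        taken at a point of J never meets the zero extension outside J.\<close>
      moreover have "AE s in lebesgue_on {0..h}. t + s \<in> J"
        using t assms(12) by (intro AE_I2) auto
      ultimately show "AE s in lebesgue_on {0..h}. restr J \<phi> (t + s) = \<phi>' (t + s)"
        by eventually_elim (simp add: restr_def)
    qed
    then have "mean J h (restr J \<phi>) = restr J (\<lambda>t. (1 / h) *\<^sub>R bochner_integral (lebesgue_on {0..h}) (\<lambda>r. \<phi>' (t + r)))"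
      unfolding mean_def by (simp add: restr_def[of J "\<lambda>t. _ *\<^sub>R _ t"] fun_eq_iff)
    moreover have "mean J h (restr J \<phi>) \<in> \<F>" using assms(20) h by (simp add: mean_class_def)
    ultimately show ?thesis by simp
  qed
  then have "restr J (convolution blinfun_apply G \<phi>) \<in> \<F>"
    unfolding conv by (rule convolution_mem_if_means_mem[OF \<phi>'(1,3) _ G(2,3,1,4)])
  then show ?thesis using G(1) bochner_integrable_UNIV[OF G(2,3)] mild buc by blast
qed

end
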